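(* Let $F$ be a field of characteristic zero, complete for a nonarchimedean absolute value, equipped with $n$ commuting nonzero derivations $\partial_1,\dots,\partial_n$. Suppose that the ratios $|\partial_i|_F/|\partial_i|_{F,\mathrm{sp}}$ for $i=1,\dots,n$ are all equal to a common value $s_0$. Let $V$ be a differential module over $F$. Then there is a unique decomposition $V=V_+\oplus\bigoplus_{s>s_0}V_s$ into differential submodules (all but finitely many zero) such that each Jordan–Hölder factor of $V_s$ has scale $s$ and each Jordan–Hölder factor of $V_+$ has scale at most $s_0$.
   Context: $|\partial_i|_F$ is the operator norm of $\partial_i$ on $F$, and for an operator $D$ on a normed space $W$, $|D|_{W,\mathrm{sp}}=\lim_m|D^m|_W^{1/m}$ is its spectral norm. A differential module over $F$ is a finite-dimensional $F$-vector space $V$ with additive maps $\partial_1,\dots,\partial_n$ satisfying $\partial_i(fv)=\partial_i(f)v+f\partial_i(v)$; spectral norms on $V$ are computed with the supremum norm for any basis (basis-independent). The scale of $V$ is $\max_i\max\{1,|\partial_i|_{V,\mathrm{sp}}/|\partial_i|_{F,\mathrm{sp}}\}$. Jordan–Hölder factors are taken in the category of differential modules.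
   Formalization: The actions of the derivations on the differential module V are also required to commute with one another (without this the decomposition can fail to exist), and the derivations are assumed bounded on F, so that their operator norms are finite. *)

theory Defs
  imports "HOL-Analysis.Analysis"
begin

text \<open>The absolute value is a function on a type of class \<^class>\<open>field_char_0\<close>; no topology from
  the type class hierarchy is involved. The trivial absolute value is allowed.\<close>

locale complete_nonarch_field =
  fixes av :: "'f::field_char_0 \<Rightarrow> real"
  assumes av_nonneg: "0 \<le> av x"
    and av_eq_0_iff: "av x = 0 \<longleftrightarrow> x = 0"
    and av_mult: "av (x * y) = av x * av y"
    and av_ultrametric: "av (x + y) \<le> max (av x) (av y)"
    and av_complete: "Metric_space.mcomplete UNIV (\<lambda>x y. av (x - y))"

definition derivation :: "('f::ring \<Rightarrow> 'f) \<Rightarrow> bool" where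
  "derivation \<delta> \<longleftrightarrow> (\<forall>x y. \<delta> (x + y) = \<delta> x + \<delta> y) \<and> (\<forall>x y. \<delta> (x * y) = \<delta> x * y + x * \<delta> y)"

text \<open>Operator norm and spectral norm of \<open>T\<close> on \<open>S\<close> with respect to the (semi)norm \<open>N\<close>. Elements
  \<open>w\<close> of norm zero contribute the value \<open>x / 0 = 0\<close>, as in \<^const>\<open>onorm\<close>; in particular both norms
  vanish on the zero module. The supremum is meaningful only for bounded \<open>T\<close>.\<close>

definition op_norm :: "('w \<Rightarrow> real) \<Rightarrow> 'w set \<Rightarrow> ('w \<Rightarrow> 'w) \<Rightarrow> real" where
  "op_norm N S T = (SUP w\<in>S. N (T w) / N w)"

definition spectral_norm :: "('w \<Rightarrow> real) \<Rightarrow> 'w set \<Rightarrow> ('w \<Rightarrow> 'w) \<Rightarrow> real" where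
  "spectral_norm N S T = lim (\<lambda>m. root m (op_norm N S (T ^^ m)))"

text \<open>The index type of the derivations is an arbitrary finite (hence nonempty) type, standing for
  \<open>{1, ..., n}\<close> with \<open>n \<ge> 1\<close>. The actions of the derivations on a differential module commute,
  like the derivations themselves.\<close>

locale differential_module = vector_space smul
  for smul :: "'f::field \<Rightarrow> 'v::ab_group_add \<Rightarrow> 'v" +
  fixes d :: "'i::finite \<Rightarrow> 'f \<Rightarrow> 'f" and D :: "'i \<Rightarrow> 'v \<Rightarrow> 'v"
  assumes finite_dim: "\<exists>X. finite X \<and> span X = UNIV"
    and D_add: "D i (v + w) = D i v + D i w"
    and D_smul: "D i (smul f v) = smul (d i f) v + smul f (D i v)"
    and D_commute: "D i (D j v) = D j (D i v)"

definition diff_submodule ::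
    "('f::field \<Rightarrow> 'v::ab_group_add \<Rightarrow> 'v) \<Rightarrow> ('i \<Rightarrow> 'v \<Rightarrow> 'v) \<Rightarrow> 'v set \<Rightarrow> bool" where
  "diff_submodule smul D W \<longleftrightarrow> module.subspace smul W \<and> (\<forall>i. D i ` W \<subseteq> W)"

text \<open>A subquotient \<open>B / A\<close> of a differential module, for differential submodules \<open>A \<subseteq> B\<close>, is handled
  through representatives in \<open>B\<close>: the class of \<open>v\<close> is \<open>v\<close> modulo \<open>A\<close>, and the induced operators are
  given on representatives by the operators \<open>D i\<close>. The module itself is the case
  \<open>A = {0}\<close>, \<open>B = UNIV\<close>.\<close>

definition is_coords ::
    "('f::field \<Rightarrow> 'v::ab_group_add \<Rightarrow> 'v) \<Rightarrow> 'v set \<Rightarrow> 'v set \<Rightarrow> 'v \<Rightarrow> ('v \<Rightarrow> 'f) \<Rightarrow> bool" where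
  "is_coords smul A X v c \<longleftrightarrow> (\<forall>x. x \<notin> X \<longrightarrow> c x = 0) \<and> v - (\<Sum>x\<in>X. smul (c x) x) \<in> A"

text \<open>\<open>X\<close> is a set of representatives in \<open>B\<close> of a basis of \<open>B / A\<close>.\<close>

definition quot_basis ::
    "('f::field \<Rightarrow> 'v::ab_group_add \<Rightarrow> 'v) \<Rightarrow> 'v set \<Rightarrow> 'v set \<Rightarrow> 'v set \<Rightarrow> bool" where
  "quot_basis smul A B X \<longleftrightarrow> finite X \<and> X \<subseteq> B \<and> (\<forall>v\<in>B. \<exists>!c. is_coords smul A X v c)"

text \<open>The norm of the class of \<open>v\<close> for the supremum norm on \<open>B / A\<close> given by the basis \<open>X\<close>.\<close>

definition sup_norm ::
    "('f::field \<Rightarrow> real) \<Rightarrow> ('f \<Rightarrow> 'v::ab_group_add \<Rightarrow> 'v) \<Rightarrow> 'v set \<Rightarrow> 'v set \<Rightarrow> 'v \<Rightarrow> real" where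
  "sup_norm av smul A X v = Max (insert 0 ((\<lambda>x. av ((THE c. is_coords smul A X v c) x)) ` X))"

text \<open>The spectral norm does not depend on the basis chosen.\<close>

definition quot_spectral_norm ::
    "('f::field \<Rightarrow> real) \<Rightarrow> ('f \<Rightarrow> 'v::ab_group_add \<Rightarrow> 'v) \<Rightarrow> 'v set \<Rightarrow> 'v set \<Rightarrow> ('v \<Rightarrow> 'v) \<Rightarrow> real" where
  "quot_spectral_norm av smul A B T =
     spectral_norm (sup_norm av smul A (SOME X. quot_basis smul A B X)) B T"

definition quot_scale ::
    "('f::field \<Rightarrow> real) \<Rightarrow> ('i::finite \<Rightarrow> 'f \<Rightarrow> 'f) \<Rightarrow> ('f \<Rightarrow> 'v::ab_group_add \<Rightarrow> 'v) \<Rightarrow>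
     ('i \<Rightarrow> 'v \<Rightarrow> 'v) \<Rightarrow> 'v set \<Rightarrow> 'v set \<Rightarrow> real" where
  "quot_scale av d smul D A B =
     Max (range (\<lambda>i. max 1 (quot_spectral_norm av smul A B (D i) / spectral_norm av UNIV (d i))))"

definition irreducible_quot ::
    "('f::field \<Rightarrow> 'v::ab_group_add \<Rightarrow> 'v) \<Rightarrow> ('i \<Rightarrow> 'v \<Rightarrow> 'v) \<Rightarrow> 'v set \<Rightarrow> 'v set \<Rightarrow> bool" where
  "irreducible_quot smul D A B \<longleftrightarrow> diff_submodule smul D A \<and> diff_submodule smul D B \<and> A \<subset> B \<and>
     (\<forall>C. diff_submodule smul D C \<and> A \<subseteq> C \<and> C \<subseteq> B \<longrightarrow> C = A \<or> C = B)"

definition composition_series ::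
    "('f::field \<Rightarrow> 'v::ab_group_add \<Rightarrow> 'v) \<Rightarrow> ('i \<Rightarrow> 'v \<Rightarrow> 'v) \<Rightarrow> 'v set \<Rightarrow> 'v set list \<Rightarrow> bool" where
  "composition_series smul D W Ws \<longleftrightarrow> Ws \<noteq> [] \<and> hd Ws = {0} \<and> last Ws = W \<and>
     (\<forall>k. Suc k < length Ws \<longrightarrow> irreducible_quot smul D (Ws ! k) (Ws ! Suc k))"

text \<open>\<open>B / A\<close> is a factor of some composition series of the submodule \<open>W\<close>.\<close>

definition JH_factor ::
    "('f::field \<Rightarrow> 'v::ab_group_add \<Rightarrow> 'v) \<Rightarrow> ('i \<Rightarrow> 'v \<Rightarrow> 'v) \<Rightarrow> 'v set \<Rightarrow> 'v set \<Rightarrow> 'v set \<Rightarrow> bool" where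
  "JH_factor smul D W A B \<longleftrightarrow>
     (\<exists>Ws k. composition_series smul D W Ws \<and> Suc k < length Ws \<and> A = Ws ! k \<and> B = Ws ! Suc k)"

text \<open>Decompositions are indexed by the reals \<open>s > s0\<close>. To obtain literal uniqueness of the
  function \<open>Vs\<close>, it is set to \<open>{0}\<close> at the irrelevant arguments \<open>s \<le> s0\<close>.\<close>

definition scale_decomposition ::
    "('f::field \<Rightarrow> real) \<Rightarrow> ('i::finite \<Rightarrow> 'f \<Rightarrow> 'f) \<Rightarrow> ('f \<Rightarrow> 'v::ab_group_add \<Rightarrow> 'v) \<Rightarrow>
     ('i \<Rightarrow> 'v \<Rightarrow> 'v) \<Rightarrow> real \<Rightarrow> 'v set \<Rightarrow> (real \<Rightarrow> 'v set) \<Rightarrow> bool" where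
  "scale_decomposition av d smul D s0 Vplus Vs \<longleftrightarrow>
     diff_submodule smul D Vplus \<and>
     (\<forall>s>s0. diff_submodule smul D (Vs s)) \<and>
     (\<forall>s\<le>s0. Vs s = {0}) \<and>
     finite {s. s > s0 \<and> Vs s \<noteq> {0}} \<and>
     (\<forall>v. \<exists>!pf. fst pf \<in> Vplus \<and> (\<forall>s. snd pf s \<in> Vs s) \<and>
        v = fst pf + (\<Sum>s | s > s0 \<and> Vs s \<noteq> {0}. snd pf s)) \<and>
     (\<forall>s>s0. \<forall>A B. JH_factor smul D (Vs s) A B \<longrightarrow> quot_scale av d smul D A B = s) \<and>
     (\<forall>A B. JH_factor smul D Vplus A B \<longrightarrow> quot_scale av d smul D A B \<le> s0)"

end

theory Submission
  imports Defs
begin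

text \<open>Fix one derivation \<open>d\<close> acting on a module as \<open>T\<close>, and let \<open>fwd \<sigma>\<close> be the set of vectors with
  \<open>T\<^sup>m v = O(\<sigma>\<^sup>m)\<close> and \<open>bwd \<sigma>\<close> the set of those with a backward orbit \<open>z m\<close> of size \<open>O(\<sigma>\<^sup>-\<^sup>m)\<close>. For
  \<open>\<sigma> > |d|\<close> both are submodules, also for operators commuting with \<open>T\<close>, and they are independent as
  soon as the second rate exceeds the first. If neither jumps on an interval above \<open>|d|\<close>, they span:
  otherwise take \<open>v\<close> outside their sum \<open>U\<close> and a shortest relation \<open>p(T) v \<in> U\<close>. For a generic radius
  \<open>R\<close> in the interval one term of \<open>p\<close> dominates. If it is the leading term, \<open>v\<close> has forward rate \<open>R\<close>
  modulo \<open>U\<close>; otherwise Weierstrass factorization of \<open>p\<close> as a twisted polynomial gives a vector outside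
  \<open>U\<close> with backward rate \<open>R\<close> modulo \<open>U\<close>. Convergent series remove the words ``modulo \<open>U\<close>'', a
  contradiction. In particular no cyclic vectors are needed. Intersecting over the derivations gives,
  for each \<open>t \<ge> s0\<close>, a splitting into the parts of scale \<open>\<le> t\<close> and \<open>> t\<close>, and \<open>V\<^sub>s\<close> is cut out by the jump of
  this filtration at \<open>s\<close>.\<close>

section \<open>Spectral norms of bounded operators\<close>

text \<open>For rates above |d| the Leibniz term \<open>\<delta> f\<close> costs no more than one
  step of \<open>T\<close>; this makes the vectors of a given rate a subspace over the field. Below
  |d| the argument fails, hence the single undivided piece V_+. The common ratio s0 makes the
  thresholds \<open>t * \<mu> i\<close> reach |d_i| for all i together, namely from t = s0 on.

  The dominant term of a relation has to dominate strictly, because the ratio of the runner-up to it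
  is the contraction factor of the factorization. Ties occur at finitely many radii only, so an
  interval without jumps leaves room for a good radius; finite dimension provides such an interval
  just above any threshold.

  Scales are spectral norms of quotients, which are uniform in the vector. Forward rates of a lifted
  basis bound them from above; one backward orbit with nonzero class bounds them from below.\<close>

lemma submultiplicative_root_convergent:
  fixes a :: "nat \<Rightarrow> real"
  assumes nonneg: "\<And>m. 0 \<le> a m" and submult: "\<And>m n. a (m + n) \<le> a m * a n"
  shows "convergent (\<lambda>m. root m (a m))"
proof -
  define L where "L = (INF m\<in>{1..}. root m (a m))"
  have bdd: "bdd_below ((\<lambda>m. root m (a m)) ` {1..})"
    by (rule bdd_belowI2[of _ 0]) (use nonneg in auto)
  have L_le: "L \<le> root m (a m)" if "m \<ge> 1" for m
    unfolding L_def using that bdd by (intro cINF_lower) auto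
  have L_ge: "0 \<le> L"
    unfolding L_def by (intro cINF_greatest) (use nonneg in auto)
  have "(\<lambda>m. root m (a m)) \<longlonglongrightarrow> L"
  proof (rule order_tendstoI)
    fix l assume "l < L"
    then have "l < root m (a m)" if "m \<ge> 1" for m using L_le[OF that] by simp
    then show "eventually (\<lambda>m. l < root m (a m)) sequentially"
      by (rule eventually_mono[OF eventually_ge_at_top[of "1::nat"]])
  next
    fix u assume "L < u"
    then obtain b where b: "L < b" "b < u" using dense by blast
    \<comment> \<open>Fekete's argument: one exponent \<open>q\<close> whose root is below
      \<open>b\<close> controls every \<open>m\<close> through division with remainder; the finitely
      many remainders cost only a constant, whose roots tend to 1.\<close>
    obtain q where q: "q \<ge> 1" "root q (a q) < b"
      using b(1) cINF_less_iff[OF _ bdd, of b] unfolding L_def by auto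
    have b0: "0 < b" using L_ge b by simp
    have aq: "a q \<le> b ^ q"
    proof -
      have "a q = root q (a q) ^ q" using q nonneg by simp
      also have "\<dots> \<le> b ^ q" using q nonneg by (intro power_mono) auto
      finally show ?thesis .
    qed
    have aqt: "a (q * t + s) \<le> (b ^ q) ^ t * a s" for t s
    proof (induction t)
      case (Suc t)
      have "a (q * Suc t + s) = a (q + (q * t + s))" by (simp add: algebra_simps)
      also have "\<dots> \<le> a q * a (q * t + s)" by (rule submult)
      also have "\<dots> \<le> b ^ q * ((b ^ q) ^ t * a s)"
        using aq Suc nonneg b0 by (intro mult_mono) auto
      finally show ?case by (simp add: mult.assoc)
    qed simp
    define K where "K = 1 + (\<Sum>s<q. a s / b ^ s)"
    have K: "0 < K" unfolding K_def
      using nonneg b0 by (intro add_pos_nonneg sum_nonneg) auto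
    have bound: "a m \<le> b ^ m * K" for m
    proof -
      have "a m \<le> (b ^ q) ^ (m div q) * a (m mod q)"
        using aqt[of "m div q" "m mod q"] by simp
      also have "\<dots> = b ^ m * (a (m mod q) / b ^ (m mod q))"
      proof -
        have "b ^ m = (b ^ q) ^ (m div q) * b ^ (m mod q)"
          by (metis mult_div_mod_eq power_add power_mult)
        then show ?thesis using b0 by simp
      qed
      also have "\<dots> \<le> b ^ m * K"
      proof (rule mult_left_mono)
        have "a (m mod q) / b ^ (m mod q) \<le> (\<Sum>s<q. a s / b ^ s)"
          by (rule member_le_sum[of "m mod q" "{..<q}" "\<lambda>s. a s / b ^ s"])
            (use q nonneg b0 in auto)
        then show "a (m mod q) / b ^ (m mod q) \<le> K" by (simp add: K_def)
      qed (use b0 in simp)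
      finally show ?thesis .
    qed
    have "(\<lambda>m. b * root m K) \<longlonglongrightarrow> b * 1"
      by (intro tendsto_intros LIMSEQ_root_const K)
    then have "eventually (\<lambda>m. b * root m K < u) sequentially"
      using b by (intro order_tendstoD(2)[of _ b]) auto
    then show "eventually (\<lambda>m. root m (a m) < u) sequentially"
      using eventually_ge_at_top[of "1::nat"]
    proof eventually_elim
      case (elim m)
      have "root m (a m) \<le> root m (b ^ m * K)" using elim bound by simp
      also have "\<dots> = b * root m K" using elim b0 by (simp add: real_root_mult real_root_power_cancel)
      finally show ?case using elim by simp
    qed
  qed
  then show ?thesis by (auto simp: convergent_def)
qed

text \<open>Neither additivity nor definiteness of \<open>N\<close> is built in, so the locale
  covers both the absolute value on the field and the norm of a quotient evaluated on
  representatives.\<close>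

locale bounded_endo =
  fixes N :: "'w \<Rightarrow> real" and S :: "'w set" and T :: "'w \<Rightarrow> 'w" and K :: real
  assumes N_nonneg: "w \<in> S \<Longrightarrow> 0 \<le> N w"
    and nonempty: "S \<noteq> {}"
    and maps: "w \<in> S \<Longrightarrow> T w \<in> S"
    and K_nonneg: "0 \<le> K"
    and bounded: "w \<in> S \<Longrightarrow> N (T w) \<le> K * N w"
begin

lemma ratio_le:
  assumes "w \<in> S" "x \<le> C * N w" "0 \<le> C"
  shows "x / N w \<le> C"
  using assms N_nonneg[of w] by (cases "N w = 0") (auto simp: divide_simps)

lemma bdd_above_ratios: "bdd_above ((\<lambda>w. N (T w) / N w) ` S)"
  by (rule bdd_aboveI2[of _ _ K]) (use ratio_le bounded K_nonneg in auto)

lemma op_norm_nonneg: "0 \<le> op_norm N S T"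
proof -
  obtain w where "w \<in> S" using nonempty by blast
  then show ?thesis unfolding op_norm_def
    using N_nonneg maps by (intro cSUP_upper2[OF bdd_above_ratios, of w]) auto
qed

lemma op_norm_le:
  assumes "0 \<le> C" "\<And>w. w \<in> S \<Longrightarrow> N (T w) \<le> C * N w"
  shows "op_norm N S T \<le> C"
  unfolding op_norm_def using assms ratio_le nonempty by (intro cSUP_least) auto

lemma le_op_norm:
  assumes "w \<in> S"
  shows "N (T w) \<le> op_norm N S T * N w"
proof (cases "N w = 0")
  case True
  then show ?thesis using bounded[OF assms] by simp
next
  case False
  then have "0 < N w" using N_nonneg[OF assms] by simp
  moreover have "N (T w) / N w \<le> op_norm N S T"
    unfolding op_norm_def using assms bdd_above_ratios by (intro cSUP_upper) auto
  ultimately show ?thesis by (simp add: divide_simps)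
qed

lemma funpow_maps: "w \<in> S \<Longrightarrow> (T ^^ m) w \<in> S"
  by (induction m) (auto intro: maps)

lemma funpow_bounded: "w \<in> S \<Longrightarrow> N ((T ^^ m) w) \<le> K ^ m * N w"
proof (induction m)
  case (Suc m)
  have "N ((T ^^ Suc m) w) \<le> K * N ((T ^^ m) w)" using bounded funpow_maps Suc by simp
  also have "\<dots> \<le> K * (K ^ m * N w)" using Suc K_nonneg by (intro mult_left_mono) auto
  finally show ?case by (simp add: mult.assoc)
qed simp

lemma bounded_endo_funpow: "bounded_endo N S (T ^^ m) (K ^ m)"
  by unfold_locales (use N_nonneg nonempty funpow_maps K_nonneg funpow_bounded in auto)

lemma spectral_norm_tendsto: "(\<lambda>m. root m (op_norm N S (T ^^ m))) \<longlonglongrightarrow> spectral_norm N S T"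
  unfolding spectral_norm_def
proof (rule convergent_LIMSEQ_iff[THEN iffD1], rule submultiplicative_root_convergent)
  fix m n
  show nonneg: "0 \<le> op_norm N S (T ^^ m)" for m
    using bounded_endo.op_norm_nonneg[OF bounded_endo_funpow] .
  show "op_norm N S (T ^^ (m + n)) \<le> op_norm N S (T ^^ m) * op_norm N S (T ^^ n)"
  proof (rule bounded_endo.op_norm_le[OF bounded_endo_funpow])
    fix w assume w: "w \<in> S"
    have "N ((T ^^ m) ((T ^^ n) w)) \<le> op_norm N S (T ^^ m) * N ((T ^^ n) w)"
      by (rule bounded_endo.le_op_norm[OF bounded_endo_funpow funpow_maps[OF w]])
    also have "\<dots> \<le> op_norm N S (T ^^ m) * (op_norm N S (T ^^ n) * N w)"
      by (rule mult_left_mono[OF bounded_endo.le_op_norm[OF bounded_endo_funpow w] nonneg])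
    finally show "N ((T ^^ (m + n)) w) \<le> op_norm N S (T ^^ m) * op_norm N S (T ^^ n) * N w"
      by (simp add: funpow_add mult.assoc)
  qed (use nonneg in simp)
qed

lemma spectral_norm_nonneg: "0 \<le> spectral_norm N S T"
proof (rule LIMSEQ_le_const[OF spectral_norm_tendsto], intro exI allI impI)
  show "0 \<le> root m (op_norm N S (T ^^ m))" for m
    using bounded_endo.op_norm_nonneg[OF bounded_endo_funpow] by (cases "m = 0") auto
qed

lemma spectral_norm_le:
  assumes "0 \<le> s" "\<And>m w. w \<in> S \<Longrightarrow> N ((T ^^ m) w) \<le> C * s ^ m * N w"
  shows "spectral_norm N S T \<le> s"
proof -
  \<comment> \<open>Roots of a constant tend to 1 only if it is positive, and \<open>C\<close> may
    be zero or negative.\<close>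
  define C' where "C' = max C 1"
  have "root m (op_norm N S (T ^^ m)) \<le> root m C' * s" if m: "m \<ge> 1" for m
  proof -
    have "op_norm N S (T ^^ m) \<le> C' * s ^ m"
    proof (rule bounded_endo.op_norm_le[OF bounded_endo_funpow])
      fix w assume w: "w \<in> S"
      have "C * (s ^ m * N w) \<le> C' * (s ^ m * N w)"
        using assms N_nonneg[OF w] by (intro mult_right_mono) (auto simp: C'_def)
      then show "N ((T ^^ m) w) \<le> C' * s ^ m * N w"
        using assms(2)[OF w, of m] by (simp add: mult.assoc)
    qed (use assms in \<open>auto simp: C'_def\<close>)
    then have "root m (op_norm N S (T ^^ m)) \<le> root m (C' * s ^ m)" using m by simp
    also have "\<dots> = root m C' * s" using m assms by (simp add: real_root_mult real_root_power_cancel)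
    finally show ?thesis .
  qed
  moreover have "(\<lambda>m. root m C' * s) \<longlonglongrightarrow> 1 * s"
    by (intro tendsto_intros LIMSEQ_root_const) (simp add: C'_def)
  ultimately show ?thesis
    by (intro LIMSEQ_le[OF spectral_norm_tendsto, of _ s]) auto
qed

lemma spectral_norm_ge:
  assumes "0 < c" "0 \<le> s" "\<And>m. c * s ^ m \<le> op_norm N S (T ^^ m)"
  shows "s \<le> spectral_norm N S T"
proof -
  have "root m c * s \<le> root m (op_norm N S (T ^^ m))" if m: "m \<ge> 1" for m
  proof -
    have "root m c * s = root m (c * s ^ m)" using m assms by (simp add: real_root_mult real_root_power_cancel)
    then show ?thesis using m assms by simp
  qed
  moreover have "(\<lambda>m. root m c * s) \<longlonglongrightarrow> 1 * s"
    by (intro tendsto_intros LIMSEQ_root_const assms)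
  ultimately show ?thesis
    by (intro LIMSEQ_le[OF _ spectral_norm_tendsto, of _ s]) auto
qed

end

section \<open>Nonarchimedean norms on finite-dimensional spaces\<close>

context complete_nonarch_field
begin

lemma av_0 [simp]: "av 0 = 0"
  by (simp add: av_eq_0_iff)

lemma av_1 [simp]: "av 1 = 1"
  using av_mult[of 1 1] av_eq_0_iff[of 1] by simp

lemma av_minus [simp]: "av (- x) = av x"
proof -
  have "av (-1) * av (-1) = 1" using av_mult[of "-1" "-1"] by simp
  then have "av (-1) = 1" using av_nonneg[of "-1"] square_eq_1_iff by fastforce
  then show ?thesis using av_mult[of "-1" x] by simp
qed

lemma av_diff_le: "av (x - y) \<le> max (av x) (av y)"
  using av_ultrametric[of x "- y"] by simp

lemma av_add_le: "av x \<le> M \<Longrightarrow> av y \<le> M \<Longrightarrow> av (x + y) \<le> M"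
  using av_ultrametric[of x y] by linarith

lemma av_sub_le: "av x \<le> M \<Longrightarrow> av y \<le> M \<Longrightarrow> av (x - y) \<le> M"
  using av_diff_le[of x y] by linarith

lemma av_sum_le:
  assumes "\<And>i. i \<in> I \<Longrightarrow> av (x i) \<le> M" "0 \<le> M"
  shows "av (sum x I) \<le> M"
  using assms by (induction I rule: infinite_finite_induct) (simp_all add: av_add_le)

lemma av_inverse: "av (inverse x) = inverse (av x)"
proof (cases "x = 0")
  case False
  then have "av (inverse x) * av x = 1" by (simp flip: av_mult)
  then show ?thesis by (metis inverse_unique mult.commute)
qed simp

lemma av_divide: "av (x / y) = av x / av y"
  by (simp add: divide_inverse av_mult av_inverse)

lemma av_summable:
  assumes "(\<lambda>k. av (x k)) \<longlonglongrightarrow> 0"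
  shows "\<exists>s. (\<lambda>n. av (s - (\<Sum>k<n. x k))) \<longlonglongrightarrow> 0"
proof -
  interpret M: Metric_space UNIV "\<lambda>x y. av (x - y)"
  proof
    show "av (x - y) = av (y - x)" for x y using av_minus[of "x - y"] by simp
    show "av (x - z) \<le> av (x - y) + av (y - z)" for x y z
      using av_ultrametric[of "x - y" "y - z"] av_nonneg[of "x - y"] av_nonneg[of "y - z"] by simp
  qed (auto simp: av_nonneg av_eq_0_iff)
  define S where "S n = (\<Sum>k<n. x k)" for n
  have "M.MCauchy S"
    unfolding M.MCauchy_def
  proof (intro conjI allI impI)
    fix e :: real assume "0 < e"
    then obtain N where N: "\<And>k. k \<ge> N \<Longrightarrow> av (x k) < e / 2"
      using order_tendstoD(2)[OF assms, of "e / 2"] by (auto simp: eventually_sequentially)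
    have *: "av (S (n + m) - S n) \<le> e / 2" if "n \<ge> N" for n m
    proof (induction m)
      case (Suc m)
      have "S (n + Suc m) - S n = (S (n + m) - S n) + x (n + m)" by (simp add: S_def)
      then show ?case using Suc N[of "n + m"] that by (metis av_add_le less_imp_le trans_le_add1)
    qed (use \<open>0 < e\<close> in simp)
    have **: "av (S m - S n) < e" if "n \<ge> N" "n \<le> m" for n m
      using *[of n "m - n"] that \<open>0 < e\<close> by simp
    show "\<exists>N. \<forall>n n'. N \<le> n \<longrightarrow> N \<le> n' \<longrightarrow> av (S n - S n') < e"
      using ** M.commute by (metis nle_le)
  qed simp
  then obtain s where "limitin M.mtopology S s sequentially"
    using av_complete unfolding M.mcomplete_def by blast
  then have "\<forall>e>0. \<exists>N. \<forall>n\<ge>N. av (S n - s) < e"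
    by (simp add: M.limit_metric_sequentially)
  then have "(\<lambda>n. av (s - S n)) \<longlonglongrightarrow> 0"
    using av_nonneg M.commute by (simp add: LIMSEQ_iff)
  then show ?thesis unfolding S_def by blast
qed

lemma le_zero_if_le_power:
  fixes a :: real
  assumes "\<And>t. a \<le> \<theta> ^ t * C" "0 \<le> \<theta>" "\<theta> < 1"
  shows "a \<le> 0"
proof -
  have "(\<lambda>t. \<theta> ^ t * C) \<longlonglongrightarrow> 0"
    using LIMSEQ_realpow_zero[of \<theta>] assms by (intro tendsto_mult_left_zero) auto
  then show ?thesis using LIMSEQ_le_const[of _ 0 a] assms(1) by auto
qed

lemma av_eq_0_if_le_power:
  assumes "\<And>t. av x \<le> \<theta> ^ t * C" "0 \<le> \<theta>" "\<theta> < 1"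
  shows "x = 0"
  using le_zero_if_le_power[OF assms] av_nonneg[of x] av_eq_0_iff[of x] by simp

text \<open>In an ultrametric the tail of a telescoping sum is bounded by its largest increment, so
  the error bound is that of the increments, without a factor
  \<open>1 / (1 - \<theta>)\<close>.\<close>

lemma av_geometric_limit:
  assumes x: "\<And>t. av (x (Suc t) - x t) \<le> \<theta> ^ t * C" and \<theta>: "0 \<le> \<theta>" "\<theta> < 1"
  shows "\<exists>l. \<forall>t. av (l - x t) \<le> \<theta> ^ t * C"
proof -
  have C: "0 \<le> C" using x[of 0] av_nonneg[of "x (Suc 0) - x 0"] by simp
  have "(\<lambda>t. \<theta> ^ t * C) \<longlonglongrightarrow> 0"
    using LIMSEQ_realpow_zero[OF \<theta>] by (rule tendsto_mult_left_zero)
  then have "(\<lambda>t. av (x (Suc t) - x t)) \<longlonglongrightarrow> 0"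
    by (rule tendsto_sandwich[OF _ _ tendsto_const, rotated 2]) (use x av_nonneg in auto)
  from av_summable[OF this] obtain s where s: "(\<lambda>n. av (s - (\<Sum>k<n. x (Suc k) - x k))) \<longlonglongrightarrow> 0"
    by blast
  have "av (s + x 0 - x t) \<le> \<theta> ^ t * C" for t
  proof -
    have 1: "av (x (t + m) - x t) \<le> \<theta> ^ t * C" for m
    proof (induction m)
      case (Suc m)
      have "\<theta> ^ (t + m) * C \<le> \<theta> ^ t * C"
        using \<theta> C by (intro mult_right_mono power_decreasing) auto
      then have "av (x (Suc (t + m)) - x (t + m)) \<le> \<theta> ^ t * C" using x order_trans by blast
      from av_add_le[OF this Suc] show ?case by simp
    qed (use \<theta> C in simp)
    have "av (s + x 0 - x t) \<le> max (av (s - (\<Sum>k<t + m. x (Suc k) - x k))) (\<theta> ^ t * C)" for m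
    proof -
      let ?e = "s - (\<Sum>k<t + m. x (Suc k) - x k)"
      have "s + x 0 - x t = ?e + (x (t + m) - x t)"
        by (simp only: sum_lessThan_telescope) simp
      moreover have "av (?e + (x (t + m) - x t)) \<le> max (av ?e) (\<theta> ^ t * C)"
        using av_ultrametric[of ?e "x (t + m) - x t"] 1[of m] by linarith
      ultimately show ?thesis by (simp only:)
    qed
    moreover have "(\<lambda>m. max (av (s - (\<Sum>k<t + m. x (Suc k) - x k))) (\<theta> ^ t * C)) \<longlonglongrightarrow> max 0 (\<theta> ^ t * C)"
      using LIMSEQ_ignore_initial_segment[OF s, of t] by (intro tendsto_max) (auto simp: add.commute)
    ultimately have "av (s + x 0 - x t) \<le> max 0 (\<theta> ^ t * C)"
      using LIMSEQ_le_const[of _ _ "av (s + x 0 - x t)"] by blast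
    then show ?thesis using \<theta> C by (simp add: max_def split: if_splits)
  qed
  then show ?thesis by blast
qed

text \<open>Banach iteration for \<open>x = c - T x\<close>. It is stated for additive maps because
  \<open>T\<close> will be built from the derivation and is not linear over the field.\<close>

lemma contraction_surj:
  assumes add: "\<And>x y. T (x + y) = T x + T y"
    and T: "\<And>x. av (T x) \<le> \<theta> * av x" and \<theta>: "0 \<le> \<theta>" "\<theta> < 1"
  shows "\<exists>x. x + T x = c \<and> av x \<le> av c"
proof -
  define x where "x t = ((\<lambda>x. c - T x) ^^ t) 0" for t
  have x_0: "x 0 = 0" and x_Suc: "x (Suc t) = c - T (x t)" for t by (simp_all add: x_def)
  have Tsub: "T (x - y) = T x - T y" for x y
    using add[of "x - y" y] by simp
  have T1: "av (T y) \<le> \<theta> ^ Suc t * av c" if "av y \<le> \<theta> ^ t * av c" for y t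
    using T[of y] mult_left_mono[OF that \<theta>(1)] by (simp add: mult.assoc)
  have "av (x (Suc t) - x t) \<le> \<theta> ^ t * av c" for t
  proof (induction t)
    case 0
    show ?case using Tsub[of 0 0] by (simp add: x_0 x_Suc)
  next
    case (Suc t)
    have "x (Suc (Suc t)) - x (Suc t) = - T (x (Suc t) - x t)" by (simp add: x_Suc Tsub)
    then show ?case using T1[OF Suc] by simp
  qed
  then obtain l where l: "\<And>t. av (l - x t) \<le> \<theta> ^ t * av c"
    using av_geometric_limit[OF _ \<theta>] by metis
  have "av (l + T l - c) \<le> \<theta> ^ t * (\<theta> * av c)" for t
  proof -
    have "l + T l - c = (l - x (Suc t)) + T (l - x t)" by (simp add: x_Suc Tsub)
    then show ?thesis using l[of "Suc t"] T1[OF l[of t]] by (simp only:) (intro av_add_le, auto simp: ac_simps)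
  qed
  from av_eq_0_if_le_power[OF this \<theta>] have "l + T l = c" by simp
  moreover have "av l \<le> av c" using l[of 0] x_0 by simp
  ultimately show ?thesis by blast
qed

end

section \<open>The supremum norm and convergent series\<close>

locale nonarch_vector_space = complete_nonarch_field av + finite_dimensional_vector_space smul Basis
  for av :: "'f::field_char_0 \<Rightarrow> real" and smul :: "'f \<Rightarrow> 'v::ab_group_add \<Rightarrow> 'v" and Basis :: "'v set"
begin

definition nrm :: "'v \<Rightarrow> real" where
  "nrm v = Max (insert 0 ((\<lambda>b. av (representation Basis v b)) ` Basis))"

lemma av_coord_le_nrm: "b \<in> Basis \<Longrightarrow> av (representation Basis v b) \<le> nrm v"
  unfolding nrm_def using finite_Basis by (intro Max_ge) auto

lemma nrm_nonneg: "0 \<le> nrm v"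
  unfolding nrm_def using finite_Basis by (intro Max_ge) auto

lemma nrm_le:
  assumes "0 \<le> M" "\<And>b. b \<in> Basis \<Longrightarrow> av (representation Basis v b) \<le> M"
  shows "nrm v \<le> M"
  unfolding nrm_def using finite_Basis assms by (subst Max_le_iff) auto

lemma in_span_Basis: "v \<in> span Basis"
  by (simp add: span_Basis)

lemma basis_expansion: "v = (\<Sum>b\<in>Basis. smul (representation Basis v b) b)"
  using sum_representation_eq[OF independent_Basis in_span_Basis finite_Basis order_refl] by simp

lemma nrm_0 [simp]: "nrm 0 = 0"
  using nrm_le[of 0 0] nrm_nonneg[of 0] by (simp add: representation_zero)

lemma nrm_eq_0_iff: "nrm v = 0 \<longleftrightarrow> v = 0"
proof
  assume "nrm v = 0"
  then have "representation Basis v b = 0" if "b \<in> Basis" for b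
    using av_coord_le_nrm[OF that, of v] av_nonneg[of "representation Basis v b"] av_eq_0_iff by force
  then show "v = 0" using basis_expansion[of v] by simp
qed simp

lemma nrm_add_le:
  assumes "nrm v \<le> M" "nrm w \<le> M"
  shows "nrm (v + w) \<le> M"
proof (rule nrm_le)
  show "0 \<le> M" using assms(1) nrm_nonneg[of v] by linarith
  fix b assume "b \<in> Basis"
  then have "av (representation Basis v b) \<le> M" "av (representation Basis w b) \<le> M"
    using av_coord_le_nrm[of b v] av_coord_le_nrm[of b w] assms by linarith+
  then show "av (representation Basis (v + w) b) \<le> M"
    by (simp add: representation_add[OF independent_Basis in_span_Basis in_span_Basis] av_add_le)
qed

lemma nrm_smul_le: "nrm (smul c v) \<le> av c * nrm v"
proof (rule nrm_le)
  fix b assume "b \<in> Basis"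
  then have "av c * av (representation Basis v b) \<le> av c * nrm v"
    by (intro mult_left_mono av_coord_le_nrm av_nonneg)
  then show "av (representation Basis (smul c v) b) \<le> av c * nrm v"
    by (simp add: representation_scale[OF independent_Basis in_span_Basis] av_mult)
qed (simp add: av_nonneg nrm_nonneg)

lemma nrm_smul: "nrm (smul c v) = av c * nrm v"
proof (cases "c = 0")
  case False
  have "nrm v = nrm (smul (inverse c) (smul c v))" using False by simp
  also have "\<dots> \<le> inverse (av c) * nrm (smul c v)" using nrm_smul_le by (metis av_inverse)
  finally have "av c * nrm v \<le> nrm (smul c v)"
    using False av_eq_0_iff[of c] av_nonneg[of c] by (simp add: field_simps)
  then show ?thesis using nrm_smul_le[of c v] by linarith
qed simp

lemma nrm_minus [simp]: "nrm (- v) = nrm v"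
  using nrm_smul[of "-1" v] by simp

lemma nrm_diff_le: "nrm v \<le> M \<Longrightarrow> nrm w \<le> M \<Longrightarrow> nrm (v - w) \<le> M"
  using nrm_add_le[of v M "- w"] by simp

lemma nrm_sum_le:
  assumes "0 \<le> M" "\<And>i. i \<in> I \<Longrightarrow> nrm (x i) \<le> M"
  shows "nrm (sum x I) \<le> M"
  using assms by (induction I rule: infinite_finite_induct) (simp_all add: nrm_add_le)

text \<open>Equivalence of norms: after extending \<open>X\<close> to a basis of the whole space,
  its coordinates are fixed linear combinations of the coordinates in \<open>Basis\<close>.\<close>

lemma coord_bound:
  assumes X: "independent X"
  shows "\<exists>C\<ge>0. \<forall>v\<in>span X. \<forall>x\<in>X. av (representation X v x) \<le> C * nrm v"
proof -
  define Y where "Y = extend_basis X"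
  have Y: "independent Y" "X \<subseteq> Y" "span Y = UNIV"
    using X by (auto simp: Y_def independent_extend_basis extend_basis_superset)
  define C where "C = (\<Sum>b\<in>Basis. \<Sum>x\<in>X. av (representation Y b x))"
  have finX: "finite X" using X finiteI_independent by blast
  have C0: "0 \<le> C" unfolding C_def by (intro sum_nonneg av_nonneg)
  have *: "av (representation Y v x) \<le> C * nrm v" if x: "x \<in> X" for v x
  proof -
    have "representation Y v x = (\<Sum>b\<in>Basis. representation Basis v b * representation Y b x)"
      by (subst basis_expansion[of v])
        (simp add: representation_sum[OF Y(1)] representation_scale[OF Y(1)] Y(3))
    also have "av \<dots> \<le> C * nrm v"
    proof (rule av_sum_le)
      fix b assume b: "b \<in> Basis"
      have "av (representation Y b x) \<le> (\<Sum>x\<in>X. av (representation Y b x))"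
        using x finX av_nonneg by (intro member_le_sum) auto
      also have "\<dots> \<le> C" unfolding C_def
        using b finite_Basis av_nonneg
        by (intro member_le_sum[of b Basis "\<lambda>b. \<Sum>x\<in>X. av (representation Y b x)"]) (auto intro: sum_nonneg)
      finally have "av (representation Basis v b) * av (representation Y b x) \<le> nrm v * C"
        by (intro mult_mono av_coord_le_nrm b nrm_nonneg av_nonneg)
      then show "av (representation Basis v b * representation Y b x) \<le> C * nrm v"
        by (simp add: av_mult mult.commute)
    qed (use C0 nrm_nonneg in auto)
    finally show ?thesis .
  qed
  have "av (representation X v x) \<le> C * nrm v" if "v \<in> span X" "x \<in> X" for v x
    using *[OF that(2), of v] representation_extend[OF Y(1) that(1) Y(2)] by simp
  then show ?thesis using C0 by blast
qed

lemma subspace_basis: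
  assumes "subspace W"
  obtains X where "finite X" "X \<subseteq> W" "independent X" "span X = W"
proof -
  obtain X where X: "X \<subseteq> W" "independent X" "W \<subseteq> span X"
    using maximal_independent_subset[of W] by blast
  then have "span X = W" using assms span_minimal[of X W] by blast
  then show ?thesis using that X finiteI_independent by blast
qed

text \<open>The coordinates complementary to a basis of \<open>W\<close> vanish on every
  \<open>w n\<close> and are continuous by \<open>coord_bound\<close>, so they vanish at the
  limit.\<close>

lemma subspace_closed:
  assumes W: "subspace W" and w: "\<And>n. w n \<in> W" and lim: "(\<lambda>n. nrm (s - w n)) \<longlonglongrightarrow> 0"
  shows "s \<in> W"
proof -
  obtain X where X: "finite X" "X \<subseteq> W" "independent X" "span X = W"
    using subspace_basis[OF W] .
  define Y where "Y = extend_basis X"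
  have Y: "independent Y" "X \<subseteq> Y" "span Y = UNIV"
    using X by (auto simp: Y_def independent_extend_basis extend_basis_superset)
  have finY: "finite Y" using Y finiteI_independent by blast
  obtain C where C: "\<And>v x. x \<in> Y \<Longrightarrow> av (representation Y v x) \<le> C * nrm v"
    using coord_bound[OF Y(1)] Y(3) by auto
  have "representation Y s y = 0" if y: "y \<in> Y" "y \<notin> X" for y
  proof -
    have "representation Y (w n) y = 0" for n
    proof -
      have "representation Y (w n) = representation X (w n)"
        using representation_extend[OF Y(1) _ Y(2), of "w n"] w X(4) by auto
      then show ?thesis using y(2) representation_ne_zero by metis
    qed
    then have "representation Y (s - w n) y = representation Y s y" for n
      by (simp add: representation_diff[OF Y(1)] Y(3))
    then have "av (representation Y s y) \<le> C * nrm (s - w n)" for n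
      using C[OF y(1), of "s - w n"] by simp
    moreover have "(\<lambda>n. C * nrm (s - w n)) \<longlonglongrightarrow> 0" using lim by (rule tendsto_mult_right_zero)
    ultimately have "av (representation Y s y) \<le> 0"
      using LIMSEQ_le_const[of _ 0 "av (representation Y s y)"] by auto
    then show ?thesis using av_nonneg av_eq_0_iff by (metis order_antisym)
  qed
  then have "s = (\<Sum>y\<in>X. smul (representation Y s y) y)"
    using sum_representation_eq[OF Y(1) _ finY order_refl, of s] Y(2,3) finY
    by (subst sum.mono_neutral_left[of Y X]) (auto)
  also have "\<dots> \<in> span X" by (intro span_sum span_scale span_base)
  finally show ?thesis using X(4) by simp
qed

lemma nrm_tendsto_0:
  assumes "\<And>n. nrm (x n) \<le> h n" "h \<longlonglongrightarrow> 0"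
  shows "(\<lambda>n. nrm (x n)) \<longlonglongrightarrow> 0"
  by (rule tendsto_sandwich[OF _ _ tendsto_const assms(2)]) (use assms(1) nrm_nonneg in auto)

text \<open>Convergence is spelled out through \<open>nrm\<close>, since the type of vectors carries
  no topology.\<close>

definition sums_to :: "(nat \<Rightarrow> 'v) \<Rightarrow> 'v \<Rightarrow> bool" where
  "sums_to x s \<longleftrightarrow> (\<lambda>n. nrm (s - (\<Sum>k<n. x k))) \<longlonglongrightarrow> 0"

text \<open>Null sequences are summable in a complete ultrametric field; this is applied coordinate
  by coordinate.\<close>

lemma sums_to_exists:
  assumes "(\<lambda>k. nrm (x k)) \<longlonglongrightarrow> 0"
  shows "\<exists>s. sums_to x s"
proof -
  have "\<exists>s. (\<lambda>n. av (s - (\<Sum>k<n. representation Basis (x k) b))) \<longlonglongrightarrow> 0" if "b \<in> Basis" for b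
    by (intro av_summable tendsto_sandwich[OF _ _ tendsto_const assms])
      (use that av_nonneg av_coord_le_nrm in auto)
  then obtain s where s: "\<And>b. b \<in> Basis \<Longrightarrow> (\<lambda>n. av (s b - (\<Sum>k<n. representation Basis (x k) b))) \<longlonglongrightarrow> 0"
    by metis
  let ?s = "\<Sum>b\<in>Basis. smul (s b) b"
  have "nrm (?s - (\<Sum>k<n. x k)) \<le> (\<Sum>b\<in>Basis. av (s b - (\<Sum>k<n. representation Basis (x k) b)))" for n
  proof (rule nrm_le)
    fix b assume b: "b \<in> Basis"
    have "representation Basis ?s b = s b"
      using b by (simp add: representation_sum[OF independent_Basis] representation_scale[OF independent_Basis]
          in_span_Basis representation_basis[OF independent_Basis] if_distrib[of "(*) _"] sum.delta'[OF finite_Basis]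
          eq_commute[of b] cong: if_cong)
    then have "representation Basis (?s - (\<Sum>k<n. x k)) b = s b - (\<Sum>k<n. representation Basis (x k) b)"
      by (simp add: representation_diff[OF independent_Basis] representation_sum[OF independent_Basis] in_span_Basis)
    then show "av (representation Basis (?s - (\<Sum>k<n. x k)) b)
        \<le> (\<Sum>b\<in>Basis. av (s b - (\<Sum>k<n. representation Basis (x k) b)))"
      using member_le_sum[OF b, of "\<lambda>b. av (s b - (\<Sum>k<n. representation Basis (x k) b))"] av_nonneg finite_Basis
      by auto
  qed (auto intro: sum_nonneg av_nonneg)
  moreover have "(\<lambda>n. \<Sum>b\<in>Basis. av (s b - (\<Sum>k<n. representation Basis (x k) b))) \<longlonglongrightarrow> 0"
    using s by (intro tendsto_null_sum) auto
  ultimately have "sums_to x ?s" unfolding sums_to_def by (rule nrm_tendsto_0)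
  then show ?thesis by blast
qed

lemma sums_to_mem:
  assumes "sums_to x s" "subspace W" "\<And>k. x k \<in> W"
  shows "s \<in> W"
  by (rule subspace_closed[of W "\<lambda>n. \<Sum>k<n. x k"]) (use assms in \<open>auto simp: sums_to_def subspace_sum\<close>)

lemma sums_to_unique:
  assumes "sums_to x s" "sums_to x t"
  shows "s = t"
proof -
  have "nrm (s - t) \<le> max (nrm (s - (\<Sum>k<n. x k))) (nrm (t - (\<Sum>k<n. x k)))" for n
    using nrm_diff_le[of "s - (\<Sum>k<n. x k)" _ "t - (\<Sum>k<n. x k)"] by simp
  moreover have "(\<lambda>n. max (nrm (s - (\<Sum>k<n. x k))) (nrm (t - (\<Sum>k<n. x k)))) \<longlonglongrightarrow> max 0 0"
    using assms unfolding sums_to_def by (intro tendsto_max) auto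
  ultimately have "nrm (s - t) \<le> 0"
    using LIMSEQ_le_const[of _ 0 "nrm (s - t)"] by auto
  then show ?thesis using nrm_nonneg nrm_eq_0_iff by (metis order_antisym eq_iff_diff_eq_0)
qed

lemma sums_to_nrm_le:
  assumes "sums_to x s" "\<And>k. nrm (x k) \<le> M"
  shows "nrm s \<le> M"
proof -
  have M: "0 \<le> M" using assms(2)[of 0] nrm_nonneg[of "x 0"] by linarith
  have "nrm s \<le> max (nrm (s - (\<Sum>k<n. x k))) M" for n
  proof -
    have "nrm (\<Sum>k<n. x k) \<le> M" by (intro nrm_sum_le assms M)
    then show ?thesis using nrm_add_le[of "s - (\<Sum>k<n. x k)" _ "\<Sum>k<n. x k"] by simp
  qed
  moreover have "(\<lambda>n. max (nrm (s - (\<Sum>k<n. x k))) M) \<longlonglongrightarrow> max 0 M"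
    using assms unfolding sums_to_def by (intro tendsto_max) auto
  ultimately have "nrm s \<le> max 0 M"
    using LIMSEQ_le_const[of _ "max 0 M" "nrm s"] by auto
  then show ?thesis using M by simp
qed

lemma sums_to_add:
  assumes "sums_to x s" "sums_to y t"
  shows "sums_to (\<lambda>k. x k + y k) (s + t)"
proof -
  have "nrm (s + t - (\<Sum>k<n. x k + y k)) \<le> nrm (s - (\<Sum>k<n. x k)) + nrm (t - (\<Sum>k<n. y k))" for n
    using nrm_add_le[of "s - (\<Sum>k<n. x k)" "nrm (s - (\<Sum>k<n. x k)) + nrm (t - (\<Sum>k<n. y k))" "t - (\<Sum>k<n. y k)"]
    by (simp add: sum.distrib nrm_nonneg algebra_simps)
  moreover have "(\<lambda>n. nrm (s - (\<Sum>k<n. x k)) + nrm (t - (\<Sum>k<n. y k))) \<longlonglongrightarrow> 0"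
    using assms unfolding sums_to_def by (rule tendsto_add_zero)
  ultimately show ?thesis unfolding sums_to_def by (rule nrm_tendsto_0)
qed

lemma sums_to_map:
  assumes "sums_to x s" and add: "\<And>v w. T (v + w) = T v + T w" and bdd: "\<And>v. nrm (T v) \<le> K * nrm v"
  shows "sums_to (\<lambda>k. T (x k)) (T s)"
proof -
  have T0: "T 0 = 0" using add[of 0 0] by simp
  have Tsub: "T (x - y) = T x - T y" for x y
    using add[of "x - y" y] by simp
  have Tsum: "T (\<Sum>k<n. x k) = (\<Sum>k<n. T (x k))" for n
    by (induction n) (auto simp: T0 add)
  have "nrm (T s - (\<Sum>k<n. T (x k))) \<le> K * nrm (s - (\<Sum>k<n. x k))" for n
    using bdd[of "s - (\<Sum>k<n. x k)"] by (simp add: Tsub Tsum)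
  moreover have "(\<lambda>n. K * nrm (s - (\<Sum>k<n. x k))) \<longlonglongrightarrow> 0"
    using assms unfolding sums_to_def by (intro tendsto_mult_right_zero)
  ultimately show ?thesis unfolding sums_to_def by (rule nrm_tendsto_0)
qed

lemma sums_to_Suc_iff: "sums_to x (x 0 + s) \<longleftrightarrow> sums_to (\<lambda>k. x (Suc k)) s"
proof -
  have "nrm (x 0 + s - (\<Sum>k<Suc n. x k)) = nrm (s - (\<Sum>k<n. x (Suc k)))" for n
    by (simp only: sum.lessThan_Suc_shift add_diff_add diff_self) simp
  then show ?thesis unfolding sums_to_def
    by (subst filterlim_sequentially_Suc[symmetric]) simp
qed

lemma sums_to_geometric_exists:
  assumes "\<And>k. nrm (x k) \<le> M * q ^ k" "0 \<le> q" "q < 1"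
  shows "\<exists>s. sums_to x s"
proof (rule sums_to_exists)
  have "(\<lambda>k. M * q ^ k) \<longlonglongrightarrow> 0"
    using LIMSEQ_realpow_zero[of q] assms by (intro tendsto_mult_right_zero) auto
  then show "(\<lambda>k. nrm (x k)) \<longlonglongrightarrow> 0"
    by (rule nrm_tendsto_0[OF assms(1)])
qed

end

section \<open>Twisted polynomials\<close>

locale bounded_derivation_field = complete_nonarch_field av
  for av :: "'f::field_char_0 \<Rightarrow> real" +
  fixes \<delta> :: "'f \<Rightarrow> 'f" and r :: real
  assumes \<delta>_add: "\<delta> (x + y) = \<delta> x + \<delta> y"
    and \<delta>_bounded: "av (\<delta> x) \<le> r * av x"
    and r_nonneg: "0 \<le> r"
begin

lemma \<delta>_0 [simp]: "\<delta> 0 = 0"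
  using \<delta>_add[of 0 0] by simp

lemma \<delta>_diff: "\<delta> (x - y) = \<delta> x - \<delta> y"
  using \<delta>_add[of "x - y" y] by simp

lemma \<delta>_le: "av x \<le> M \<Longrightarrow> av (\<delta> x) \<le> r * M"
  using \<delta>_bounded[of x] mult_left_mono[OF _ r_nonneg, of "av x" M] by linarith

text \<open>A sequence \<open>f\<close> stands for the twisted polynomial \<open>\<Sum>i. f i T\<^sup>i\<close> with \<open>T c = c T + \<delta> c\<close>, and
  \<open>twist\<close> is left multiplication by \<open>T\<close>.\<close>

definition twist :: "(nat \<Rightarrow> 'f) \<Rightarrow> nat \<Rightarrow> 'f" where
  "twist f i = \<delta> (f i) + (case i of 0 \<Rightarrow> 0 | Suc j \<Rightarrow> f j)"

text \<open>The Gauss norm of radius \<open>R\<close>, as an upper bound instead of a supremum, so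
  that it makes sense for arbitrary coefficient sequences.\<close>

definition gauss_le :: "real \<Rightarrow> real \<Rightarrow> (nat \<Rightarrow> 'f) \<Rightarrow> bool" where
  "gauss_le R M f \<longleftrightarrow> (\<forall>i. av (f i) * R ^ i \<le> M)"

lemma gauss_leD: "gauss_le R M f \<Longrightarrow> av (f i) * R ^ i \<le> M"
  by (simp add: gauss_le_def)

lemma av_mult_le_iff:
  assumes "0 < R"
  shows "av x * R ^ i \<le> M \<longleftrightarrow> av x \<le> M / R ^ i"
  using assms by (simp add: pos_le_divide_eq)

lemma gauss_le_add:
  assumes "0 < R" "gauss_le R M f" "gauss_le R M g"
  shows "gauss_le R M (\<lambda>i. f i + g i)"
  using assms by (auto simp: gauss_le_def av_mult_le_iff intro: av_add_le)

lemma gauss_le_diff: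
  assumes "0 < R" "gauss_le R M f" "gauss_le R M g"
  shows "gauss_le R M (\<lambda>i. f i - g i)"
  using assms by (auto simp: gauss_le_def av_mult_le_iff intro: av_sub_le)

text \<open>Here \<open>r \<le> R\<close> enters: the derivative of a coefficient is then no larger
  than the effect of the degree shift, so left multiplication by \<open>T\<close> has Gauss norm at
  most \<open>R\<close>, as for commuting polynomials.\<close>

lemma gauss_le_twist:
  assumes R: "r \<le> R" "0 < R" and f: "gauss_le R M f"
  shows "gauss_le R (R * M) (twist f)"
  unfolding gauss_le_def
proof
  fix i
  have M: "0 \<le> M" using gauss_leD[OF f, of 0] av_nonneg[of "f 0"] by simp
  have "av (\<delta> (f i)) * R ^ i \<le> R * M"
  proof -
    have "av (\<delta> (f i)) * R ^ i \<le> (r * av (f i)) * R ^ i"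
      using R \<delta>_bounded by (intro mult_right_mono) auto
    also have "\<dots> \<le> r * M" using gauss_leD[OF f, of i] r_nonneg by (simp add: mult.assoc mult_left_mono)
    also have "\<dots> \<le> R * M" using R M by (intro mult_right_mono)
    finally show ?thesis .
  qed
  moreover have "av (case i of 0 \<Rightarrow> 0 | Suc j \<Rightarrow> f j) * R ^ i \<le> R * M"
    using R M gauss_leD[OF f] by (auto split: nat.split simp: mult.left_commute)
  ultimately show "av (twist f i) * R ^ i \<le> R * M"
    unfolding twist_def av_mult_le_iff[OF R(2)] by (rule av_add_le)
qed

lemma gauss_le_twist_funpow:
  assumes R: "r \<le> R" "0 < R" and f: "gauss_le R M f"
  shows "gauss_le R (R ^ j * M) ((twist ^^ j) f)"
proof (induction j)
  case (Suc j)
  then show ?case using gauss_le_twist[OF R Suc] by (simp add: mult.assoc)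
qed (use f in simp)

lemma twist_diff: "twist (\<lambda>i. f i - g i) = (\<lambda>i. twist f i - twist g i)"
  by (rule ext) (simp add: twist_def \<delta>_diff split: nat.split)

lemma twist_funpow_diff: "(twist ^^ j) (\<lambda>i. f i - g i) = (\<lambda>i. (twist ^^ j) f i - (twist ^^ j) g i)"
  by (induction j) (simp_all add: twist_diff)

lemma twist_funpow_support:
  assumes "\<And>i. i \<ge> k \<Longrightarrow> f i = 0" "i \<ge> k + j"
  shows "(twist ^^ j) f i = 0"
  using assms(2)
proof (induction j arbitrary: i)
  case (Suc j)
  then show ?case by (cases i) (auto simp: twist_def)
qed (use assms(1) in auto)

text \<open>For \<open>x = \<Sum>j. g (j + k) T\<^sup>j\<close> and \<open>y = \<Sum>i<k. h i T\<^sup>i\<close> this is the product \<open>x y\<close>.\<close>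

definition tail_head_product :: "nat \<Rightarrow> nat \<Rightarrow> (nat \<Rightarrow> 'f) \<Rightarrow> (nat \<Rightarrow> 'f) \<Rightarrow> nat \<Rightarrow> 'f" where
  "tail_head_product k n g h i =
     (\<Sum>j\<le>n - k. g (j + k) * (twist ^^ j) (\<lambda>i. if i < k then h i else 0) i)"

text \<open>The product is biadditive, so the difference of two squares splits as (f - g) f + g (f -
  g). This makes the quadratic map contracting on a small ball.\<close>

lemma tail_head_product_diff:
  "tail_head_product k n f f i - tail_head_product k n g g i =
   tail_head_product k n (\<lambda>i. f i - g i) f i + tail_head_product k n g (\<lambda>i. f i - g i) i"
proof -
  have *: "(\<lambda>i. if i < k then f i - g i else 0) =
      (\<lambda>i. (if i < k then f i else 0) - (if i < k then g i else 0))" by auto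
  show ?thesis
    unfolding tail_head_product_def * twist_funpow_diff
    by (simp add: sum_subtractf sum.distrib algebra_simps)
qed

text \<open>Submultiplicativity of the Gauss norm. The left factor is \<open>g\<close> shifted down
  by \<open>k\<close> degrees, which divides its Gauss norm by \<open>R ^ k\<close>.\<close>

lemma gauss_le_tail_head_product:
  assumes R: "r \<le> R" "0 < R" and g: "gauss_le R (M * R ^ k) g" and h: "gauss_le R M' h"
  shows "gauss_le R (M * M') (tail_head_product k n g h)"
  unfolding gauss_le_def
proof
  fix i
  have M': "0 \<le> M'" using gauss_leD[OF h, of 0] av_nonneg[of "h 0"] by simp
  have "0 \<le> M * R ^ k" using gauss_leD[OF g, of 0] av_nonneg[of "g 0"] by simp
  then have M: "0 \<le> M" using mult_neg_pos[of M "R ^ k"] R(2) by force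
  have h': "gauss_le R M' (\<lambda>i. if i < k then h i else 0)"
    using h M' by (auto simp: gauss_le_def)
  show "av (tail_head_product k n g h i) * R ^ i \<le> M * M'"
    unfolding tail_head_product_def av_mult_le_iff[OF R(2)]
  proof (rule av_sum_le)
    fix j
    let ?y = "(twist ^^ j) (\<lambda>i. if i < k then h i else 0) i"
    have "av (g (j + k)) * R ^ j * R ^ k \<le> M * R ^ k"
      using gauss_leD[OF g, of "j + k"] by (simp add: power_add mult.assoc)
    then have gj: "av (g (j + k)) * R ^ j \<le> M" using R by simp
    have "av ?y * R ^ i \<le> R ^ j * M'"
      using gauss_leD[OF gauss_le_twist_funpow[OF R h']] .
    then have "av (g (j + k)) * (av ?y * R ^ i) \<le> av (g (j + k)) * (R ^ j * M')"
      using av_nonneg by (rule mult_left_mono)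
    also have "\<dots> \<le> M * M'"
      using mult_right_mono[OF gj M'] by (simp add: mult.assoc)
    finally show "av (g (j + k) * ?y) \<le> M * M' / R ^ i"
      using R by (simp add: av_mult pos_le_divide_eq mult.assoc)
  qed (use M M' R in simp)
qed

text \<open>The factorization \<open>p = (1 + \<Sum>j. g (j + k) T\<^sup>j) (T\<^sup>k + \<Sum>i<k. g i T\<^sup>i)\<close>: after expanding, both
  factors are read off from the fixed point \<open>g\<close> of a contraction, because \<open>g\<close> itself is the sum
  of the two linear terms.\<close>

lemma weierstrass_factorization:
  assumes R: "r \<le> R" "0 < R" and k: "k \<le> n" and p: "p k = 1" "\<And>i. i > n \<Longrightarrow> p i = 0"
    and pk: "\<And>i. i \<noteq> k \<Longrightarrow> av (p i) * R ^ i \<le> \<theta> * R ^ k" and \<theta>: "0 \<le> \<theta>" "\<theta> < 1"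
  obtains g where "gauss_le R (\<theta> * R ^ k) g" "\<And>i. i > n \<Longrightarrow> g i = 0"
    "\<And>i. p i = (if i = k then 1 else 0) + g i + tail_head_product k n g g i"
proof -
  let ?B = "tail_head_product k n"
  define c where "c i = p i - (if i = k then 1 else 0)" for i
  define x where "x t = ((\<lambda>g i. c i - ?B g g i) ^^ t) (\<lambda>_. 0)" for t
  have x_0: "x 0 = (\<lambda>_. 0)" and x_Suc: "x (Suc t) = (\<lambda>i. c i - ?B (x t) (x t) i)" for t
    by (simp_all add: x_def)
  have c: "gauss_le R (\<theta> * R ^ k) c"
    using pk p(1) \<theta> R by (auto simp: gauss_le_def c_def)
  have B_le: "gauss_le R (\<theta> ^ Suc t * R ^ k) (?B f h)" "gauss_le R (\<theta> ^ Suc t * R ^ k) (?B h f)"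
    if f: "gauss_le R (\<theta> * R ^ k) f" and h: "gauss_le R (\<theta> ^ t * R ^ k) h" for f h t
    using gauss_le_tail_head_product[OF R f h] gauss_le_tail_head_product[OF R h f] by (simp_all add: ac_simps)
  have weaken: "gauss_le R (M * R ^ k) f \<Longrightarrow> M \<le> M' \<Longrightarrow> gauss_le R (M' * R ^ k) f" for M M' f
    using R mult_right_mono[of M M' "R ^ k"] by (auto simp: gauss_le_def intro: order_trans)
  \<comment> \<open>The product of two elements of this ball has size at most
    \<open>\<theta> ^ 2 * R ^ k\<close>, so the iteration stays in the ball.\<close>
  have x_le: "gauss_le R (\<theta> * R ^ k) (x t)" for t
  proof (induction t)
    case (Suc t)
    have "gauss_le R (\<theta> ^ Suc 1 * R ^ k) (?B (x t) (x t))"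
      using B_le(1)[OF Suc, of 1] Suc by simp
    then have "gauss_le R (\<theta> * R ^ k) (?B (x t) (x t))"
      by (rule weaken) (use \<theta> in \<open>simp add: mult_left_le\<close>)
    then show ?case unfolding x_Suc by (rule gauss_le_diff[OF R(2) c])
  qed (use \<theta> R in \<open>simp add: x_0 gauss_le_def\<close>)
  \<comment> \<open>One factor in each of the two products lies in the ball of radius
    \<open>\<theta> * R ^ k\<close>; the quadratic map therefore contracts by
    \<open>\<theta>\<close>.\<close>
  have sub: "gauss_le R (\<theta> ^ Suc t * R ^ k) (\<lambda>i. ?B f f i - ?B h h i)"
    if "gauss_le R (\<theta> * R ^ k) f" "gauss_le R (\<theta> * R ^ k) h" "gauss_le R (\<theta> ^ t * R ^ k) (\<lambda>i. f i - h i)" for f h t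
    unfolding tail_head_product_diff by (intro gauss_le_add[OF R(2)] B_le that)
  have x_diff: "gauss_le R (\<theta> ^ t * R ^ k) (\<lambda>i. x t i - x (Suc t) i)" for t
  proof (induction t)
    case 0
    have "gauss_le R (\<theta> * R ^ k) (\<lambda>i. x 0 i - x (Suc 0) i)"
      by (intro gauss_le_diff[OF R(2)] x_le)
    then show ?case by (rule weaken) (use \<theta> in simp)
  next
    case (Suc t)
    have "(\<lambda>i. x (Suc t) i - x (Suc (Suc t)) i) = (\<lambda>i. ?B (x (Suc t)) (x (Suc t)) i - ?B (x t) (x t) i)"
      by (simp add: x_Suc)
    moreover have "gauss_le R (\<theta> ^ t * R ^ k) (\<lambda>i. x (Suc t) i - x t i)"
      using Suc av_minus[of "x t _ - x (Suc t) _"] by (simp add: gauss_le_def)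
    ultimately show ?case using sub[OF x_le x_le] by simp
  qed
  have "\<exists>l. \<forall>t. av (l - x t i) \<le> \<theta> ^ t * (R ^ k / R ^ i)" for i
  proof (rule av_geometric_limit[OF _ \<theta>])
    fix t
    show "av (x (Suc t) i - x t i) \<le> \<theta> ^ t * (R ^ k / R ^ i)"
      using gauss_leD[OF x_diff, of t i] av_minus[of "x t i - x (Suc t) i"] R by (simp add: av_mult_le_iff)
  qed
  then obtain g where "\<And>i t. av (g i - x t i) \<le> \<theta> ^ t * (R ^ k / R ^ i)" by metis
  then have g: "gauss_le R (\<theta> ^ t * R ^ k) (\<lambda>i. g i - x t i)" for t
    using R by (simp add: gauss_le_def av_mult_le_iff)
  have g_le: "gauss_le R (\<theta> * R ^ k) g"
    using gauss_le_add[OF R(2) x_le[of 1], of "\<lambda>i. g i - x 1 i"] g[of 1] by simp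
  have fix_eq: "g i = c i - ?B g g i" for i
  proof -
    have "av (g i - (c i - ?B g g i)) \<le> \<theta> ^ t * (\<theta> * R ^ k / R ^ i)" for t
    proof -
      have "g i - (c i - ?B g g i) = (g i - x (Suc t) i) + (?B g g i - ?B (x t) (x t) i)"
        by (simp add: x_Suc)
      moreover have "gauss_le R (\<theta> ^ Suc t * R ^ k) (\<lambda>i. (g i - x (Suc t) i) + (?B g g i - ?B (x t) (x t) i))"
        by (intro gauss_le_add[OF R(2)] g sub g_le x_le)
      ultimately have "av (g i - (c i - ?B g g i)) * R ^ i \<le> \<theta> ^ Suc t * R ^ k"
        by (metis (no_types, lifting) gauss_leD)
      then show ?thesis using R by (simp add: pos_le_divide_eq ac_simps)
    qed
    from av_eq_0_if_le_power[OF this \<theta>] show ?thesis by simp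
  qed
  \<comment> \<open>Degree count: the head has degree below \<open>k\<close>, and at most
    \<open>n - k\<close> further powers of \<open>T\<close> are multiplied in.\<close>
  have "g i = 0" if i: "i > n" for i
  proof -
    have "?B g g i = 0" unfolding tail_head_product_def
    proof (rule sum.neutral, intro ballI)
      fix j assume "j \<in> {..n - k}"
      then have "(twist ^^ j) (\<lambda>i. if i < k then g i else 0) i = 0"
        using i k by (intro twist_funpow_support[of k]) auto
      then show "g (j + k) * (twist ^^ j) (\<lambda>i. if i < k then g i else 0) i = 0" by simp
    qed
    then show ?thesis using fix_eq[of i] p(2)[OF i] i k by (simp add: c_def)
  qed
  moreover have "p i = (if i = k then 1 else 0) + g i + ?B g g i" for i
    using fix_eq[of i] by (simp add: c_def)
  ultimately show ?thesis using that g_le by blast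
qed

end

section \<open>Forward and backward growth rates\<close>

locale twisted_operator =
  nonarch_vector_space av smul Basis + bounded_derivation_field av \<delta> r
  for av :: "'f::field_char_0 \<Rightarrow> real" and smul :: "'f \<Rightarrow> 'v::ab_group_add \<Rightarrow> 'v" and Basis
    and \<delta> :: "'f \<Rightarrow> 'f" and r :: real +
  fixes T :: "'v \<Rightarrow> 'v" and K :: real
  assumes T_add: "T (v + w) = T v + T w"
    and T_smul: "T (smul f v) = smul (\<delta> f) v + smul f (T v)"
    and T_bounded: "nrm (T v) \<le> K * nrm v"
begin

lemma T_0 [simp]: "T 0 = 0"
  using T_add[of 0 0] by simp

lemma T_diff: "T (v - w) = T v - T w"
  using T_add[of "v - w" w] by simp

lemma T_sum: "T (sum x I) = (\<Sum>i\<in>I. T (x i))"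
  by (induction I rule: infinite_finite_induct) (simp_all add: T_add)

lemma T_pow_add: "(T ^^ m) (v + w) = (T ^^ m) v + (T ^^ m) w"
  by (induction m) (simp_all add: T_add)

lemma T_pow_0 [simp]: "(T ^^ m) 0 = 0"
  by (induction m) simp_all

lemma T_pow_sum: "(T ^^ m) (sum x I) = (\<Sum>i\<in>I. (T ^^ m) (x i))"
  by (induction I rule: infinite_finite_induct) (simp_all add: T_pow_add)

lemma T_pow_mem: "T ` B \<subseteq> B \<Longrightarrow> v \<in> B \<Longrightarrow> (T ^^ m) v \<in> B"
  by (induction m) auto

lemma T_pow_le: "nrm ((T ^^ m) v) \<le> \<bar>K\<bar> ^ m * nrm v"
proof (induction m)
  case (Suc m)
  have "nrm (T ((T ^^ m) v)) \<le> \<bar>K\<bar> * nrm ((T ^^ m) v)"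
    using T_bounded[of "(T ^^ m) v"] mult_right_mono[OF abs_ge_self[of K] nrm_nonneg[of "(T ^^ m) v"]] by linarith
  also have "\<dots> \<le> \<bar>K\<bar> * (\<bar>K\<bar> ^ m * nrm v)" using Suc by (intro mult_left_mono) auto
  finally show ?case by (simp add: mult.assoc)
qed simp

definition fwd :: "real \<Rightarrow> 'v set" where
  "fwd \<sigma> = {v. \<exists>C. \<forall>m. nrm ((T ^^ m) v) \<le> C * \<sigma> ^ m}"

text \<open>A chosen orbit replaces the powers of an inverse, as \<open>T\<close> need not be
  invertible. Keeping it inside \<open>B\<close> allows a submodule to be split by its own
  vectors.\<close>

definition backward_orbit :: "'v set \<Rightarrow> real \<Rightarrow> real \<Rightarrow> (nat \<Rightarrow> 'v) \<Rightarrow> bool" where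
  "backward_orbit B \<sigma> C z \<longleftrightarrow> (\<forall>m. z m \<in> B \<and> T (z (Suc m)) = z m \<and> nrm (z m) * \<sigma> ^ m \<le> C)"

definition bwd :: "'v set \<Rightarrow> real \<Rightarrow> 'v set" where
  "bwd B \<sigma> = {v. \<exists>z C. backward_orbit B \<sigma> C z \<and> z 0 = v}"

lemma fwdI: "(\<And>m. nrm ((T ^^ m) v) \<le> C * \<sigma> ^ m) \<Longrightarrow> v \<in> fwd \<sigma>"
  by (auto simp: fwd_def)

lemma fwdE:
  assumes "v \<in> fwd \<sigma>"
  obtains C where "0 \<le> C" "\<And>m. nrm ((T ^^ m) v) \<le> C * \<sigma> ^ m"
proof -
  obtain C where C: "\<And>m. nrm ((T ^^ m) v) \<le> C * \<sigma> ^ m" using assms by (auto simp: fwd_def)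
  then have "0 \<le> C" using C[of 0] nrm_nonneg[of v] by simp
  then show ?thesis using that C by blast
qed

lemma fwd_mono:
  assumes "0 \<le> \<sigma>" "\<sigma> \<le> \<tau>"
  shows "fwd \<sigma> \<subseteq> fwd \<tau>"
proof
  fix v assume "v \<in> fwd \<sigma>"
  then obtain C where C: "0 \<le> C" "\<And>m. nrm ((T ^^ m) v) \<le> C * \<sigma> ^ m" by (rule fwdE) blast
  show "v \<in> fwd \<tau>"
    by (rule fwdI, rule order_trans[OF C(2) mult_left_mono[OF power_mono[OF assms(2,1)] C(1)]])
qed

text \<open>By the Leibniz rule every application of \<open>T\<close> either differentiates the
  scalar, costing \<open>r \<le> \<sigma>\<close>, or moves on along the orbit, costing
  \<open>\<sigma>\<close>; the ultrametric inequality ignores the number of terms.\<close>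

lemma fwd_uniform:
  assumes v: "v \<in> fwd \<sigma>" and r: "r \<le> \<sigma>"
  shows "\<exists>C\<ge>0. \<forall>f m. nrm ((T ^^ m) (smul f v)) \<le> C * av f * \<sigma> ^ m"
proof -
  have \<sigma>: "0 \<le> \<sigma>" using r r_nonneg by simp
  obtain C where C: "0 \<le> C" "\<And>m. nrm ((T ^^ m) v) \<le> C * \<sigma> ^ m" using v by (rule fwdE) blast
  \<comment> \<open>The claim is generalized from \<open>v\<close> to \<open>(T ^^ j) v\<close>,
    since the second Leibniz term advances the vector.\<close>
  have "nrm ((T ^^ m) (smul f ((T ^^ j) v))) \<le> C * av f * \<sigma> ^ (m + j)" for m f j
  proof (induction m arbitrary: f j)
    case 0
    show ?case using mult_left_mono[OF C(2)[of j] av_nonneg[of f]] by (simp add: nrm_smul ac_simps)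
  next
    case (Suc m)
    have "(T ^^ Suc m) (smul f ((T ^^ j) v)) =
        (T ^^ m) (smul (\<delta> f) ((T ^^ j) v)) + (T ^^ m) (smul f ((T ^^ Suc j) v))"
      by (simp add: funpow_Suc_right T_smul T_pow_add del: funpow.simps) (simp add: funpow_swap1)
    moreover have "nrm ((T ^^ m) (smul (\<delta> f) ((T ^^ j) v))) \<le> C * av f * \<sigma> ^ (Suc m + j)"
    proof -
      have "av (\<delta> f) \<le> \<sigma> * av f"
        using \<delta>_bounded[of f] r av_nonneg[of f] mult_right_mono[of r \<sigma> "av f"] by linarith
      then have "C * av (\<delta> f) * \<sigma> ^ (m + j) \<le> C * (\<sigma> * av f) * \<sigma> ^ (m + j)"
        using C \<sigma> by (intro mult_right_mono mult_left_mono) auto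
      then show ?thesis using Suc[of "\<delta> f" j] by (simp add: ac_simps)
    qed
    moreover have "nrm ((T ^^ m) (smul f ((T ^^ Suc j) v))) \<le> C * av f * \<sigma> ^ (Suc m + j)"
      using Suc[of f "Suc j"] by simp
    ultimately show ?case by (simp only: nrm_add_le)
  qed
  from this[where j = 0] show ?thesis using C by auto
qed

lemma subspace_fwd:
  assumes r: "r \<le> \<sigma>"
  shows "subspace (fwd \<sigma>)"
proof (rule subspaceI)
  have \<sigma>: "0 \<le> \<sigma>" using r r_nonneg by simp
  show "0 \<in> fwd \<sigma>" by (rule fwdI[of _ 0]) simp
  fix v assume v: "v \<in> fwd \<sigma>"
  obtain C where C: "0 \<le> C" "\<And>m. nrm ((T ^^ m) v) \<le> C * \<sigma> ^ m" using v by (rule fwdE) blast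
  show "smul f v \<in> fwd \<sigma>" for f using fwd_uniform[OF v r] by (auto simp: fwd_def)
  fix w assume w: "w \<in> fwd \<sigma>"
  obtain C' where C': "0 \<le> C'" "\<And>m. nrm ((T ^^ m) w) \<le> C' * \<sigma> ^ m" using w by (rule fwdE) blast
  show "v + w \<in> fwd \<sigma>"
  proof (rule fwdI)
    fix m
    have "C * \<sigma> ^ m \<le> (C + C') * \<sigma> ^ m" "C' * \<sigma> ^ m \<le> (C + C') * \<sigma> ^ m"
      using C C' \<sigma> by (auto intro!: mult_right_mono)
    then show "nrm ((T ^^ m) (v + w)) \<le> (C + C') * \<sigma> ^ m"
      unfolding T_pow_add using C(2)[of m] C'(2)[of m] by (intro nrm_add_le) linarith+
  qed
qed

text \<open>A shift by one step changes only the constant. The backward implication later puts a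
  whole backward orbit into \<open>fwd\<close> as soon as its starting vector is there.\<close>

lemma T_mem_fwd_iff:
  assumes "0 < \<sigma>"
  shows "T v \<in> fwd \<sigma> \<longleftrightarrow> v \<in> fwd \<sigma>"
proof
  assume "v \<in> fwd \<sigma>"
  then obtain C where C: "0 \<le> C" "\<And>m. nrm ((T ^^ m) v) \<le> C * \<sigma> ^ m" by (rule fwdE) blast
  show "T v \<in> fwd \<sigma>"
    by (rule fwdI[of _ "C * \<sigma>"]) (use C(2)[of "Suc _"] in \<open>simp add: funpow_swap1 ac_simps\<close>)
next
  assume "T v \<in> fwd \<sigma>"
  then obtain C where C: "0 \<le> C" "\<And>m. nrm ((T ^^ m) (T v)) \<le> C * \<sigma> ^ m" by (rule fwdE) blast
  show "v \<in> fwd \<sigma>"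
  proof (rule fwdI)
    fix m
    show "nrm ((T ^^ m) v) \<le> (C / \<sigma> + nrm v) * \<sigma> ^ m"
    proof (cases m)
      case (Suc k)
      have "nrm ((T ^^ m) v) \<le> C * \<sigma> ^ k" using C(2)[of k] Suc by (simp add: funpow_swap1)
      also have "\<dots> = C / \<sigma> * \<sigma> ^ m" using assms Suc by simp
      also have "\<dots> \<le> (C / \<sigma> + nrm v) * \<sigma> ^ m"
        using assms nrm_nonneg by (intro mult_right_mono) auto
      finally show ?thesis .
    qed (use assms C in simp)
  qed
qed

lemma T_pow_mem_fwd_iff: "0 < \<sigma> \<Longrightarrow> (T ^^ m) v \<in> fwd \<sigma> \<longleftrightarrow> v \<in> fwd \<sigma>"
  by (induction m) (simp_all add: T_mem_fwd_iff)

lemma commuting_fwd: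
  assumes comm: "\<And>v. S (T v) = T (S v)" and bdd: "\<And>v. nrm (S v) \<le> L * nrm v" and v: "v \<in> fwd \<sigma>"
  shows "S v \<in> fwd \<sigma>"
proof -
  obtain C where C: "\<And>m. nrm ((T ^^ m) v) \<le> C * \<sigma> ^ m" using v by (rule fwdE) blast
  have pow: "(T ^^ m) (S v) = S ((T ^^ m) v)" for m by (induction m) (simp_all add: comm)
  show ?thesis
  proof (rule fwdI)
    fix m
    have "nrm ((T ^^ m) (S v)) \<le> \<bar>L\<bar> * nrm ((T ^^ m) v)"
      unfolding pow by (rule order_trans[OF bdd]) (simp add: mult_right_mono nrm_nonneg)
    also have "\<dots> \<le> \<bar>L\<bar> * (C * \<sigma> ^ m)" using C by (intro mult_left_mono) auto
    finally show "nrm ((T ^^ m) (S v)) \<le> \<bar>L\<bar> * C * \<sigma> ^ m" by (simp add: mult.assoc)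
  qed
qed

text \<open>Only finitely many constants occur, one for each vector of a basis of \<open>W\<close>,
  and \<open>coord_bound\<close> controls the coefficients.\<close>

lemma fwd_uniform_on:
  assumes W: "subspace W" "W \<subseteq> fwd \<sigma>" and r: "r \<le> \<sigma>"
  shows "\<exists>C\<ge>0. \<forall>v\<in>W. \<forall>m. nrm ((T ^^ m) v) \<le> C * \<sigma> ^ m * nrm v"
proof -
  have \<sigma>: "0 \<le> \<sigma>" using r r_nonneg by simp
  obtain X where X: "finite X" "X \<subseteq> W" "independent X" "span X = W" using subspace_basis[OF W(1)] .
  have "\<forall>x\<in>X. \<exists>C\<ge>0. \<forall>f m. nrm ((T ^^ m) (smul f x)) \<le> C * av f * \<sigma> ^ m"
    using fwd_uniform[OF _ r] W X by blast
  then obtain c where c: "\<And>x. x \<in> X \<Longrightarrow> 0 \<le> c x"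
      "\<And>x f m. x \<in> X \<Longrightarrow> nrm ((T ^^ m) (smul f x)) \<le> c x * av f * \<sigma> ^ m"
    by metis
  obtain C' where C': "0 \<le> C'" "\<And>v x. v \<in> W \<Longrightarrow> x \<in> X \<Longrightarrow> av (representation X v x) \<le> C' * nrm v"
    using coord_bound[OF X(3)] X(4) by blast
  have "nrm ((T ^^ m) v) \<le> (sum c X * C') * \<sigma> ^ m * nrm v" if v: "v \<in> W" for v m
  proof -
    have "v = (\<Sum>x\<in>X. smul (representation X v x) x)"
      using sum_representation_eq[OF X(3) _ X(1) order_refl, of v] v X(4) by simp
    then have "(T ^^ m) v = (\<Sum>x\<in>X. (T ^^ m) (smul (representation X v x) x))"
      by (metis T_pow_sum)
    also have "nrm \<dots> \<le> (sum c X * C') * \<sigma> ^ m * nrm v"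
    proof (rule nrm_sum_le)
      show "0 \<le> sum c X * C' * \<sigma> ^ m * nrm v"
        using c C' \<sigma> nrm_nonneg by (auto intro!: mult_nonneg_nonneg sum_nonneg)
      fix x assume x: "x \<in> X"
      have "c x \<le> sum c X" using x c X by (intro member_le_sum) auto
      then have "c x * av (representation X v x) * \<sigma> ^ m \<le> sum c X * (C' * nrm v) * \<sigma> ^ m"
        using c(1) x \<sigma> C' v av_nonneg by (intro mult_right_mono mult_mono) (auto intro: sum_nonneg)
      then show "nrm ((T ^^ m) (smul (representation X v x) x)) \<le> (sum c X * C') * \<sigma> ^ m * nrm v"
        using c(2)[OF x, of m "representation X v x"] by (simp add: ac_simps)
    qed
    finally show ?thesis .
  qed
  moreover have "0 \<le> sum c X * C'" using c C' by (auto intro!: mult_nonneg_nonneg sum_nonneg)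
  ultimately show ?thesis by blast
qed

section \<open>Backward orbits and their multiples\<close>

lemma backward_orbitD:
  assumes "backward_orbit B \<sigma> C z"
  shows "z m \<in> B" "T (z (Suc m)) = z m" "nrm (z m) * \<sigma> ^ m \<le> C" "0 \<le> C"
  using assms nrm_nonneg[of "z 0"] unfolding backward_orbit_def
  by (blast, blast, blast, metis mult.right_neutral order_trans power_0)

lemma backward_orbit_pow: "backward_orbit B \<sigma> C z \<Longrightarrow> (T ^^ m) (z m) = z 0"
  by (induction m) (simp_all add: funpow_swap1 backward_orbitD(2))

lemma bwdE:
  assumes "v \<in> bwd B \<sigma>"
  obtains z C where "backward_orbit B \<sigma> C z" "z 0 = v" "0 \<le> C"
  using assms backward_orbitD(4) unfolding bwd_def by blast

lemma bwdI: "backward_orbit B \<sigma> C z \<Longrightarrow> z 0 = v \<Longrightarrow> v \<in> bwd B \<sigma>"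
  by (auto simp: bwd_def)

lemma bwd_subset: "bwd B \<sigma> \<subseteq> B"
  by (auto elim!: bwdE dest: backward_orbitD(1))

lemma bwd_mono:
  assumes "0 \<le> \<sigma>" "\<sigma> \<le> \<tau>" "B \<subseteq> B'"
  shows "bwd B \<tau> \<subseteq> bwd B' \<sigma>"
proof
  fix v assume "v \<in> bwd B \<tau>"
  then obtain z C where z: "backward_orbit B \<tau> C z" "z 0 = v" by (rule bwdE) blast
  have "nrm (z m) * \<sigma> ^ m \<le> C" for m
    using backward_orbitD(3)[OF z(1), of m] mult_left_mono[OF power_mono[OF assms(2,1), of m] nrm_nonneg[of "z m"]]
    by linarith
  then have "backward_orbit B' \<sigma> C z"
    using backward_orbitD[OF z(1)] assms(3) by (auto simp: backward_orbit_def)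
  then show "v \<in> bwd B' \<sigma>" using z(2) by (rule bwdI)
qed

lemma commuting_bwd:
  assumes comm: "\<And>v. S (T v) = T (S v)" and bdd: "\<And>v. nrm (S v) \<le> L * nrm v"
    and B: "S ` B \<subseteq> B" and \<sigma>: "0 \<le> \<sigma>" and v: "v \<in> bwd B \<sigma>"
  shows "S v \<in> bwd B \<sigma>"
proof -
  obtain z C where z: "backward_orbit B \<sigma> C z" "z 0 = v" using v by (rule bwdE) blast
  have "nrm (S (z m)) * \<sigma> ^ m \<le> \<bar>L\<bar> * C" for m
  proof -
    have "nrm (S (z m)) \<le> \<bar>L\<bar> * nrm (z m)"
      by (rule order_trans[OF bdd]) (simp add: mult_right_mono nrm_nonneg)
    then have "nrm (S (z m)) * \<sigma> ^ m \<le> \<bar>L\<bar> * nrm (z m) * \<sigma> ^ m" using \<sigma> by (intro mult_right_mono) auto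
    also have "\<dots> \<le> \<bar>L\<bar> * C"
      using mult_left_mono[OF backward_orbitD(3)[OF z(1), of m], of "\<bar>L\<bar>"] by (simp add: mult.assoc)
    finally show ?thesis .
  qed
  then have "backward_orbit B \<sigma> (\<bar>L\<bar> * C) (\<lambda>m. S (z m))"
    using backward_orbitD[OF z(1)] B by (auto simp: backward_orbit_def simp flip: comm)
  then show ?thesis using z(2) by (auto intro: bwdI)
qed

text \<open>Coefficients of \<open>T\<^sup>-\<^sup>m f = \<Sum>k. inverse_coeff f m k T\<^sup>-\<^sup>m\<^sup>-\<^sup>k\<close>.\<close>

fun inverse_coeff :: "'f \<Rightarrow> nat \<Rightarrow> nat \<Rightarrow> 'f" where
  "inverse_coeff f 0 k = (if k = 0 then f else 0)"
| "inverse_coeff f (Suc m) 0 = inverse_coeff f m 0"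
| "inverse_coeff f (Suc m) (Suc k) = inverse_coeff f m (Suc k) - \<delta> (inverse_coeff f (Suc m) k)"

text \<open>Each step in \<open>k\<close> differentiates once. The number of terms accumulated along
  \<open>m\<close> does not matter in an ultrametric, so the bound is independent of
  \<open>m\<close>.\<close>

lemma av_inverse_coeff_le: "av (inverse_coeff f m k) \<le> r ^ k * av f"
proof (induction f m k rule: inverse_coeff.induct)
  case (3 f m k)
  then show ?case using \<delta>_le by (auto intro!: av_sub_le simp: mult.assoc)
qed (use r_nonneg av_nonneg in \<open>auto\<close>)

text \<open>Multiplying an orbit termwise by \<open>f\<close> does not give an orbit, because of the
  derivative of \<open>f\<close>. The correct one is T^-m (f u), expanded as a series in the later
  members of the orbit of \<open>u\<close>; it converges because
  \<open>r < \<sigma>\<close>.\<close>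

lemma bwd_uniform:
  assumes u: "u \<in> bwd B \<sigma>" and \<sigma>: "r < \<sigma>" and B: "subspace B"
  shows "\<exists>C\<ge>0. \<exists>y. \<forall>f. backward_orbit B \<sigma> (C * av f) (y f) \<and> y f 0 = smul f u"
proof -
  obtain z C where z: "backward_orbit B \<sigma> C z" "z 0 = u" and C: "0 \<le> C" using u by (rule bwdE) blast
  have \<sigma>0: "0 < \<sigma>" using \<sigma> r_nonneg by simp
  define x where "x f m k = smul (inverse_coeff f m k) (z (m + k))" for f m k
  have x_le: "nrm (x f m k) \<le> (C * av f / \<sigma> ^ m) * (r / \<sigma>) ^ k" for f m k
  proof -
    have "nrm (z (m + k)) \<le> C / \<sigma> ^ (m + k)"
      using backward_orbitD(3)[OF z(1), of "m + k"] \<sigma>0 by (simp add: pos_le_divide_eq)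
    then have "av (inverse_coeff f m k) * nrm (z (m + k)) \<le> (r ^ k * av f) * (C / \<sigma> ^ (m + k))"
      using r_nonneg by (intro mult_mono av_inverse_coeff_le) (auto simp: av_nonneg nrm_nonneg)
    then show ?thesis by (simp add: x_def nrm_smul power_divide power_add ac_simps)
  qed
  have q: "0 \<le> r / \<sigma>" "r / \<sigma> < 1" using \<sigma> \<sigma>0 r_nonneg by auto
  have "\<forall>f m. \<exists>s. sums_to (x f m) s" using sums_to_geometric_exists[OF x_le q] by blast
  then obtain y where y: "\<And>f m. sums_to (x f m) (y f m)" by metis
  have "backward_orbit B \<sigma> (C * av f) (y f)" for f
    unfolding backward_orbit_def
  proof (intro allI conjI)
    fix m
    show "y f m \<in> B"
      using y by (rule sums_to_mem[OF _ B]) (use B backward_orbitD(1)[OF z(1)] in \<open>auto simp: x_def subspace_scale\<close>)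
    have "nrm (y f m) \<le> C * av f / \<sigma> ^ m"
    proof (rule sums_to_nrm_le[OF y])
      fix k
      have "(r / \<sigma>) ^ k \<le> 1" using q by (simp add: power_le_one)
      then have "(C * av f / \<sigma> ^ m) * (r / \<sigma>) ^ k \<le> (C * av f / \<sigma> ^ m) * 1"
        using C av_nonneg \<sigma>0 by (intro mult_left_mono) auto
      then show "nrm (x f m k) \<le> C * av f / \<sigma> ^ m" using x_le[of f m k] by simp
    qed
    then show "nrm (y f m) * \<sigma> ^ m \<le> C * av f" using \<sigma>0 by (simp add: pos_le_divide_eq)
    \<comment> \<open>By Leibniz, \<open>T\<close> maps the series for \<open>Suc m\<close> to
      \<open>a + b\<close>. Moving \<open>a\<close> one index up, to \<open>a'\<close>, aligns both
      with the same \<open>z (m + k)\<close>, and the recursion for \<open>inverse_coeff\<close>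
      turns the sum into the series for \<open>m\<close>.\<close>
    define a where "a k = smul (\<delta> (inverse_coeff f (Suc m) k)) (z (Suc (m + k)))" for k
    define a' where "a' k = (case k of 0 \<Rightarrow> 0 | Suc k \<Rightarrow> a k)" for k
    define b where "b k = smul (inverse_coeff f (Suc m) k) (z (m + k))" for k
    have Tx: "T (x f (Suc m) k) = a k + b k" for k
      by (simp add: x_def a_def b_def T_smul backward_orbitD(2)[OF z(1)])
    have nb: "nrm (b k) \<le> (C * av f / \<sigma> ^ m) * (r / \<sigma>) ^ k" for k
    proof -
      have "nrm (z (m + k)) \<le> C / \<sigma> ^ (m + k)"
        using backward_orbitD(3)[OF z(1), of "m + k"] \<sigma>0 by (simp add: pos_le_divide_eq)
      then have "av (inverse_coeff f (Suc m) k) * nrm (z (m + k)) \<le> (r ^ k * av f) * (C / \<sigma> ^ (m + k))"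
        using r_nonneg by (intro mult_mono av_inverse_coeff_le) (auto simp: av_nonneg nrm_nonneg)
      then show ?thesis by (simp add: b_def nrm_smul power_divide power_add ac_simps)
    qed
    obtain s where s: "sums_to b s" using sums_to_geometric_exists[OF nb q] by blast
    have Ty: "sums_to (\<lambda>k. a k + b k) (T (y f (Suc m)))"
      using sums_to_map[OF y[of f "Suc m"] T_add T_bounded] by (simp add: Tx)
    have "sums_to (\<lambda>k. - b k) (- s)"
      using s unfolding sums_to_def by (simp add: sum_negf nrm_minus[of "s - _", symmetric] del: nrm_minus)
    from sums_to_add[OF Ty this] have "sums_to a (T (y f (Suc m)) - s)" by simp
    then have "sums_to a' (T (y f (Suc m)) - s)"
      using sums_to_Suc_iff[of a' "T (y f (Suc m)) - s"] by (simp add: a'_def)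
    from sums_to_add[OF this s] have "sums_to (\<lambda>k. a' k + b k) (T (y f (Suc m)))" by simp
    moreover have "a' k + b k = x f m k" for k
      by (cases k) (auto simp: a'_def a_def b_def x_def simp flip: scale_left_distrib)
    ultimately show "T (y f (Suc m)) = y f m" using sums_to_unique y by simp
  qed
  moreover have "y f 0 = smul f u" for f
  proof (rule sums_to_unique[OF y])
    have "(\<lambda>k. x f 0 (Suc k)) = (\<lambda>_. 0)" by (simp add: x_def)
    then have "sums_to (\<lambda>k. x f 0 (Suc k)) 0" by (simp add: sums_to_def)
    then show "sums_to (x f 0) (smul f u)"
      using sums_to_Suc_iff[of "x f 0" 0] by (simp add: x_def z(2))
  qed
  ultimately show ?thesis using C by blast
qed

lemma subspace_bwd:
  assumes B: "subspace B" and \<sigma>: "r < \<sigma>"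
  shows "subspace (bwd B \<sigma>)"
proof (rule subspaceI)
  have \<sigma>0: "0 < \<sigma>" using \<sigma> r_nonneg by simp
  show "0 \<in> bwd B \<sigma>"
    by (rule bwdI[of _ _ 0 "\<lambda>_. 0"]) (use B in \<open>auto simp: backward_orbit_def subspace_0\<close>)
  fix v assume v: "v \<in> bwd B \<sigma>"
  show "smul f v \<in> bwd B \<sigma>" for f using bwd_uniform[OF v \<sigma> B] by (auto intro: bwdI)
  fix w assume w: "w \<in> bwd B \<sigma>"
  obtain z C where z: "backward_orbit B \<sigma> C z" "z 0 = v" "0 \<le> C" using v by (rule bwdE) blast
  obtain z' C' where z': "backward_orbit B \<sigma> C' z'" "z' 0 = w" "0 \<le> C'" using w by (rule bwdE) blast
  have "nrm (z m + z' m) * \<sigma> ^ m \<le> C + C'" for m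
  proof -
    have "nrm (z m + z' m) \<le> nrm (z m) + nrm (z' m)" using nrm_nonneg by (intro nrm_add_le) auto
    then have "nrm (z m + z' m) * \<sigma> ^ m \<le> (nrm (z m) + nrm (z' m)) * \<sigma> ^ m"
      using \<sigma>0 by (intro mult_right_mono) auto
    then show ?thesis using backward_orbitD(3)[OF z(1), of m] backward_orbitD(3)[OF z'(1), of m]
      by (simp add: algebra_simps)
  qed
  then have "backward_orbit B \<sigma> (C + C') (\<lambda>m. z m + z' m)"
    using backward_orbitD[OF z(1)] backward_orbitD[OF z'(1)] B
    by (auto simp: backward_orbit_def T_add subspace_add)
  then show "v + w \<in> bwd B \<sigma>" using z z' by (auto intro: bwdI)
qed

text \<open>All of the backward orbit lies in \<open>fwd \<sigma>\<close>, where one constant serves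
  every vector. Writing \<open>v\<close> as \<open>(T ^^ m) (z m)\<close> then bounds it by a
  multiple of \<open>(\<sigma> / \<tau>) ^ m\<close>.\<close>

lemma fwd_bwd_disjoint:
  assumes \<sigma>: "r \<le> \<sigma>" "\<sigma> < \<tau>" "0 < \<sigma>" and v: "v \<in> fwd \<sigma>" "v \<in> bwd B \<tau>"
  shows "v = 0"
proof -
  obtain z C where z: "backward_orbit B \<tau> C z" "z 0 = v" "0 \<le> C" using v(2) by (rule bwdE) blast
  have \<tau>0: "0 < \<tau>" "0 \<le> \<sigma>" using \<sigma> by auto
  have zf: "z m \<in> fwd \<sigma>" for m
    using T_pow_mem_fwd_iff[OF \<sigma>(3), of m "z m"] backward_orbit_pow[OF z(1), of m] z(2) v(1) by simp
  obtain c where c: "0 \<le> c" "\<And>w m. w \<in> fwd \<sigma> \<Longrightarrow> nrm ((T ^^ m) w) \<le> c * \<sigma> ^ m * nrm w"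
    using fwd_uniform_on[OF subspace_fwd[OF \<sigma>(1)] order_refl \<sigma>(1)] by blast
  have "nrm v \<le> (\<sigma> / \<tau>) ^ m * (c * C)" for m
  proof -
    have "nrm v \<le> c * \<sigma> ^ m * nrm (z m)"
      using c(2)[OF zf[of m], of m] backward_orbit_pow[OF z(1), of m] z(2) by simp
    also have "\<dots> \<le> c * \<sigma> ^ m * (C / \<tau> ^ m)"
      using backward_orbitD(3)[OF z(1), of m] c \<tau>0 by (intro mult_left_mono) (auto simp: pos_le_divide_eq)
    finally show ?thesis by (simp add: power_divide ac_simps)
  qed
  from le_zero_if_le_power[OF this] have "nrm v \<le> 0" using \<sigma> \<tau>0 by simp
  then show ?thesis using nrm_nonneg nrm_eq_0_iff by (metis order_antisym)
qed

text \<open>Turns a forward orbit modulo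
  \<open>fwd \<sigma>\<^sub>1 + bwd B \<sigma>\<^sub>2\<close> into a true one. Errors along
  \<open>u\<^sub>1\<close> grow no faster than the orbit and may stay; errors along
  \<open>u\<^sub>2\<close> are absorbed by a convergent series of backward images, at the price of
  changing the starting vector by an element of \<open>bwd B \<sigma>\<^sub>2\<close>.\<close>

lemma fwd_lift:
  assumes \<sigma>: "r \<le> \<sigma>\<^sub>1" "\<sigma>\<^sub>1 \<le> R" "0 < R" "R < \<sigma>\<^sub>2" and B: "subspace B"
    and u\<^sub>1: "u\<^sub>1 \<in> fwd \<sigma>\<^sub>1" and u\<^sub>2: "u\<^sub>2 \<in> bwd B \<sigma>\<^sub>2"
    and Tz: "\<And>m. T (z m) = z (Suc m) + smul (f m) (u\<^sub>1 + u\<^sub>2)"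
    and f: "\<And>m. av (f m) \<le> M * R ^ m" and z: "\<And>m. nrm (z m) \<le> C * R ^ m"
  shows "\<exists>x\<in>bwd B \<sigma>\<^sub>2. z 0 - x \<in> fwd R"
proof -
  have \<sigma>\<^sub>2: "0 < \<sigma>\<^sub>2" "r < \<sigma>\<^sub>2" using \<sigma> by auto
  have M: "0 \<le> M" using f[of 0] av_nonneg[of "f 0"] by simp
  obtain c where c: "0 \<le> c" "\<And>f m. nrm ((T ^^ m) (smul f u\<^sub>1)) \<le> c * av f * \<sigma>\<^sub>1 ^ m"
    using fwd_uniform[OF u\<^sub>1 \<sigma>(1)] by blast
  obtain C\<^sub>2 y where C\<^sub>2: "0 \<le> C\<^sub>2" and y: "\<And>f. backward_orbit B \<sigma>\<^sub>2 (C\<^sub>2 * av f) (y f)" "\<And>f. y f 0 = smul f u\<^sub>2"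
    using bwd_uniform[OF u\<^sub>2 \<sigma>\<^sub>2(2) B] by blast
  have q: "0 \<le> R / \<sigma>\<^sub>2" "R / \<sigma>\<^sub>2 < 1" using \<sigma> by auto
  define D where "D a m = C\<^sub>2 * M * R ^ m / \<sigma>\<^sub>2 ^ Suc a" for a m :: nat
  have D: "0 \<le> D a m" for a m using C\<^sub>2 M \<sigma> \<sigma>\<^sub>2 by (simp add: D_def)
  have y_le: "nrm (y (f (m + k)) (Suc k + a)) \<le> D a m * (R / \<sigma>\<^sub>2) ^ k" for a m k
  proof -
    have "nrm (y (f (m + k)) (Suc k + a)) \<le> C\<^sub>2 * av (f (m + k)) / \<sigma>\<^sub>2 ^ (Suc k + a)"
      using backward_orbitD(3)[OF y(1)] \<sigma>\<^sub>2 by (simp only: pos_le_divide_eq zero_less_power)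
    also have "\<dots> \<le> C\<^sub>2 * (M * R ^ (m + k)) / \<sigma>\<^sub>2 ^ (Suc k + a)"
      using f C\<^sub>2 \<sigma>\<^sub>2 by (intro divide_right_mono mult_left_mono) auto
    finally show ?thesis by (simp add: D_def power_add power_divide ac_simps)
  qed
  have "\<forall>a m. \<exists>s. sums_to (\<lambda>k. y (f (m + k)) (Suc k + a)) s"
    using sums_to_geometric_exists[OF y_le q] by blast
  \<comment> \<open>\<open>X 0 m\<close> collects the backward images of all errors from time
    \<open>m\<close> on. The index \<open>a\<close> takes further steps back, so that
    \<open>X 0 0\<close> comes with its own backward orbit.\<close>
  then obtain X where X: "\<And>a m. sums_to (\<lambda>k. y (f (m + k)) (Suc k + a)) (X a m)" by metis
  have X_le: "nrm (X a m) \<le> D a m" for a m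
  proof (rule sums_to_nrm_le[OF X])
    fix k
    have "D a m * (R / \<sigma>\<^sub>2) ^ k \<le> D a m * 1" using q D by (intro mult_left_mono power_le_one) auto
    then show "nrm (y (f (m + k)) (Suc k + a)) \<le> D a m" using y_le[of m k a] by simp
  qed
  have TX: "sums_to (\<lambda>k. y (f (m + k)) (k + a)) (T (X a m))" for a m
    using sums_to_map[OF X[of m a] T_add T_bounded] backward_orbitD(2)[OF y(1)] by simp
  have TX_Suc: "T (X (Suc a) m) = X a m" for a m
    using sums_to_unique[OF X[of m a]] TX[of m "Suc a"] by simp
  have TX_0: "T (X 0 m) = smul (f m) u\<^sub>2 + X 0 (Suc m)" for m
  proof (rule sums_to_unique[OF TX])
    show "sums_to (\<lambda>k. y (f (m + k)) (k + 0)) (smul (f m) u\<^sub>2 + X 0 (Suc m))"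
      using sums_to_Suc_iff[of "\<lambda>k. y (f (m + k)) k" "X 0 (Suc m)"] X[of "Suc m" 0] y(2) by simp
  qed
  have "backward_orbit B \<sigma>\<^sub>2 (C\<^sub>2 * M / \<sigma>\<^sub>2) (\<lambda>a. X a 0)"
    unfolding backward_orbit_def
  proof (intro allI conjI)
    fix a
    show "X a 0 \<in> B" by (rule sums_to_mem[OF X B]) (rule backward_orbitD(1)[OF y(1)])
    show "nrm (X a 0) * \<sigma>\<^sub>2 ^ a \<le> C\<^sub>2 * M / \<sigma>\<^sub>2"
      using X_le[of a 0] \<sigma>\<^sub>2 by (simp add: D_def field_simps)
  qed (rule TX_Suc)
  then have X0: "X 0 0 \<in> bwd B \<sigma>\<^sub>2" by (auto intro: bwdI)
  \<comment> \<open>Subtracting \<open>X 0 m\<close> cancels the errors along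
    \<open>u\<^sub>2\<close> and leaves a recursion driven by \<open>u\<^sub>1\<close>
    alone.\<close>
  define t where "t m = z m - X 0 m" for m
  have Tt: "T (t m) = t (Suc m) + smul (f m) u\<^sub>1" for m
    by (simp add: t_def T_diff Tz TX_0 scale_right_distrib algebra_simps)
  have t_le: "nrm (t m) \<le> (C + C\<^sub>2 * M / \<sigma>\<^sub>2 + c * M / R) * R ^ m" for m
  proof -
    have "0 \<le> C * R ^ m" "0 \<le> c * M / R * R ^ m" "0 \<le> D 0 m"
      using z[of m] nrm_nonneg[of "z m"] c M \<sigma> D by auto
    moreover have "(C + C\<^sub>2 * M / \<sigma>\<^sub>2 + c * M / R) * R ^ m = C * R ^ m + D 0 m + c * M / R * R ^ m"
      by (simp add: D_def algebra_simps)
    ultimately show ?thesis using z[of m] X_le[of 0 m] unfolding t_def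
      by (intro nrm_diff_le) linarith+
  qed
  \<comment> \<open>Variation of constants: each error is carried forward by the remaining
    steps.\<close>
  have pow: "(T ^^ m) (t 0) = t m + (\<Sum>j<m. (T ^^ (m - Suc j)) (smul (f j) u\<^sub>1))" for m
  proof (induction m)
    case (Suc m)
    have "T (\<Sum>j<m. (T ^^ (m - Suc j)) (smul (f j) u\<^sub>1)) = (\<Sum>j<m. (T ^^ (Suc m - Suc j)) (smul (f j) u\<^sub>1))"
      unfolding T_sum by (intro sum.cong refl) (simp add: Suc_diff_Suc flip: funpow.simps(2)[unfolded o_def, THEN fun_cong])
    then show ?case by (simp add: Suc T_add Tt)
  qed simp
  have "t 0 \<in> fwd R"
  proof (rule fwdI)
    fix m
    have "nrm (\<Sum>j<m. (T ^^ (m - Suc j)) (smul (f j) u\<^sub>1)) \<le> c * M / R * R ^ m"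
    proof (rule nrm_sum_le)
      fix j assume j: "j \<in> {..<m}"
      have "nrm ((T ^^ (m - Suc j)) (smul (f j) u\<^sub>1)) \<le> c * av (f j) * \<sigma>\<^sub>1 ^ (m - Suc j)" by (rule c(2))
      also have "\<dots> \<le> c * (M * R ^ j) * R ^ (m - Suc j)"
        using c f \<sigma> r_nonneg M by (intro mult_mono mult_left_mono power_mono) auto
      also have "\<dots> = c * M / R * R ^ m"
      proof -
        have "R ^ m = R ^ j * R ^ (m - Suc j) * R"
          using j by (simp flip: power_add power_Suc2)
        then show ?thesis using \<sigma> by simp
      qed
      finally show "nrm ((T ^^ (m - Suc j)) (smul (f j) u\<^sub>1)) \<le> c * M / R * R ^ m" .
    qed (use c M \<sigma> in auto)
    also have "\<dots> \<le> (C + C\<^sub>2 * M / \<sigma>\<^sub>2 + c * M / R) * R ^ m"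
      using z[of 0] nrm_nonneg[of "z 0"] C\<^sub>2 M \<sigma> \<sigma>\<^sub>2 by (intro mult_right_mono) auto
    finally show "nrm ((T ^^ m) (t 0)) \<le> (C + C\<^sub>2 * M / \<sigma>\<^sub>2 + c * M / R) * R ^ m"
      unfolding pow using t_le by (intro nrm_add_le)
  qed
  then show ?thesis using X0 by (auto simp: t_def)
qed

text \<open>Dual to \<open>fwd_lift\<close>: now the errors along \<open>u\<^sub>1\<close> are
  summed by an infinite series, convergent since \<open>\<sigma>\<^sub>1 < R\<close>, while those
  along \<open>u\<^sub>2\<close> are pulled back in finite sums.\<close>

lemma bwd_lift:
  assumes \<sigma>: "r \<le> \<sigma>\<^sub>1" "\<sigma>\<^sub>1 < R" "R \<le> \<sigma>\<^sub>2" and B: "subspace B" "T ` B \<subseteq> B"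
    and u\<^sub>1: "u\<^sub>1 \<in> B" "u\<^sub>1 \<in> fwd \<sigma>\<^sub>1" and u\<^sub>2: "u\<^sub>2 \<in> bwd B \<sigma>\<^sub>2"
    and zB: "\<And>m. z m \<in> B" and Tz: "\<And>m. T (z (Suc m)) = z m + smul (f m) (u\<^sub>1 + u\<^sub>2)"
    and f: "\<And>m. av (f m) * R ^ m \<le> M" and z: "\<And>m. nrm (z m) * R ^ m \<le> C"
  shows "\<exists>x\<in>B \<inter> fwd \<sigma>\<^sub>1. z 0 + x \<in> bwd B R"
proof -
  have \<sigma>1: "0 \<le> \<sigma>\<^sub>1" using \<sigma> r_nonneg by simp
  have R: "0 < R" "0 < \<sigma>\<^sub>2" "r < \<sigma>\<^sub>2" using \<sigma> \<sigma>1 by auto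
  have M: "0 \<le> M" using f[of 0] av_nonneg[of "f 0"] by simp
  have f': "av (f m) \<le> M / R ^ m" for m using f R by (simp add: pos_le_divide_eq)
  obtain c where c: "0 \<le> c" "\<And>f m. nrm ((T ^^ m) (smul f u\<^sub>1)) \<le> c * av f * \<sigma>\<^sub>1 ^ m"
    using fwd_uniform[OF u\<^sub>1(2) \<sigma>(1)] by blast
  obtain C\<^sub>2 y where C\<^sub>2: "0 \<le> C\<^sub>2" and y: "\<And>f. backward_orbit B \<sigma>\<^sub>2 (C\<^sub>2 * av f) (y f)" "\<And>f. y f 0 = smul f u\<^sub>2"
    using bwd_uniform[OF u\<^sub>2 R(3) B(1)] by blast
  have q: "0 \<le> \<sigma>\<^sub>1 / R" "\<sigma>\<^sub>1 / R < 1" using \<sigma> \<sigma>1 R by auto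
  have a_le: "nrm ((T ^^ (j + k)) (smul (f (m + k)) u\<^sub>1)) \<le> (c * M / R ^ m * \<sigma>\<^sub>1 ^ j) * (\<sigma>\<^sub>1 / R) ^ k" for j m k
  proof -
    have "nrm ((T ^^ (j + k)) (smul (f (m + k)) u\<^sub>1)) \<le> c * av (f (m + k)) * \<sigma>\<^sub>1 ^ (j + k)" by (rule c(2))
    also have "\<dots> \<le> c * (M / R ^ (m + k)) * \<sigma>\<^sub>1 ^ (j + k)"
      using c f' \<sigma>1 by (intro mult_right_mono mult_left_mono) auto
    finally show ?thesis by (simp add: power_add power_divide ac_simps)
  qed
  have a_le': "nrm ((T ^^ (j + k)) (smul (f (m + k)) u\<^sub>1)) \<le> c * M / R ^ m * \<sigma>\<^sub>1 ^ j" for j m k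
  proof -
    have "(c * M / R ^ m * \<sigma>\<^sub>1 ^ j) * (\<sigma>\<^sub>1 / R) ^ k \<le> (c * M / R ^ m * \<sigma>\<^sub>1 ^ j) * 1"
      using q c M R \<sigma>1 by (intro mult_left_mono power_le_one) auto
    then show ?thesis using a_le[of j k m] by simp
  qed
  have "\<forall>m. \<exists>s. sums_to (\<lambda>k. (T ^^ k) (smul (f (m + k)) u\<^sub>1)) s"
    using sums_to_geometric_exists[OF a_le[of 0] q] by simp
  \<comment> \<open>\<open>x m\<close> pushes all later errors along \<open>u\<^sub>1\<close>
    forward to time \<open>m\<close>; adding it cancels them and changes the starting vector by
    \<open>x 0\<close>.\<close>
  then obtain x where x: "\<And>m. sums_to (\<lambda>k. (T ^^ k) (smul (f (m + k)) u\<^sub>1)) (x m)" by metis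
  have xB: "x m \<in> B" for m
    by (rule sums_to_mem[OF x B(1)], rule T_pow_mem[OF B(2)]) (use B u\<^sub>1 in \<open>simp add: subspace_scale\<close>)
  have x_le: "nrm (x m) * R ^ m \<le> c * M" for m
    using sums_to_nrm_le[OF x, of m "c * M / R ^ m"] a_le'[of 0] R by (simp add: pos_le_divide_eq)
  have Tx: "x m = smul (f m) u\<^sub>1 + T (x (Suc m))" for m
  proof (rule sums_to_unique[OF x])
    show "sums_to (\<lambda>k. (T ^^ k) (smul (f (m + k)) u\<^sub>1)) (smul (f m) u\<^sub>1 + T (x (Suc m)))"
      using sums_to_Suc_iff[of "\<lambda>k. (T ^^ k) (smul (f (m + k)) u\<^sub>1)" "T (x (Suc m))"]
        sums_to_map[OF x[of "Suc m"] T_add T_bounded] by simp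
  qed
  have x0: "x 0 \<in> fwd \<sigma>\<^sub>1"
  proof (rule fwdI)
    fix j
    from sums_to_nrm_le[OF sums_to_map[OF x[of 0] T_pow_add T_pow_le[of j]], of "c * M * \<sigma>\<^sub>1 ^ j"]
    show "nrm ((T ^^ j) (x 0)) \<le> c * M * \<sigma>\<^sub>1 ^ j"
      using a_le'[of j _ 0] by (simp add: funpow_add)
  qed
  \<comment> \<open>Pulls the earlier errors back to time \<open>m\<close>. The sum is empty at
    \<open>m = 0\<close>, so the starting vector is not affected.\<close>
  define s where "s m = (\<Sum>j<m. y (f j) (m - j))" for m
  have sB: "s m \<in> B" for m
    unfolding s_def using B backward_orbitD(1)[OF y(1)] by (intro subspace_sum) auto
  have Ts: "T (s (Suc m)) = s m + smul (f m) u\<^sub>2" for m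
  proof -
    have "T (s (Suc m)) = (\<Sum>j<Suc m. T (y (f j) (Suc m - j)))" by (simp only: s_def T_sum)
    also have "\<dots> = (\<Sum>j<Suc m. y (f j) (m - j))"
      by (intro sum.cong refl) (simp add: Suc_diff_le backward_orbitD(2)[OF y(1)])
    finally show ?thesis by (simp add: s_def y(2))
  qed
  have s_le: "nrm (s m) * R ^ m \<le> C\<^sub>2 * M" for m
  proof -
    have "nrm (s m) \<le> C\<^sub>2 * M / R ^ m" unfolding s_def
    proof (rule nrm_sum_le)
      fix j assume j: "j \<in> {..<m}"
      have "nrm (y (f j) (m - j)) \<le> C\<^sub>2 * av (f j) / \<sigma>\<^sub>2 ^ (m - j)"
        using backward_orbitD(3)[OF y(1)] R by (simp add: pos_le_divide_eq)
      also have "\<dots> \<le> C\<^sub>2 * (M / R ^ j) / R ^ (m - j)"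
        using C\<^sub>2 M R \<sigma> f' by (intro frac_le mult_left_mono power_mono) auto
      also have "\<dots> = C\<^sub>2 * M / R ^ m" using j by (simp flip: power_add)
      finally show "nrm (y (f j) (m - j)) \<le> C\<^sub>2 * M / R ^ m" .
    qed (use C\<^sub>2 M R in auto)
    then show ?thesis using R by (simp add: pos_le_divide_eq)
  qed
  have "backward_orbit B R (C + c * M + C\<^sub>2 * M) (\<lambda>m. z m + x m - s m)"
    unfolding backward_orbit_def
  proof (intro allI conjI)
    fix m
    show "z m + x m - s m \<in> B" using B zB xB sB by (simp add: subspace_add subspace_diff)
    show "T (z (Suc m) + x (Suc m) - s (Suc m)) = z m + x m - s m"
      by (simp add: T_diff T_add Tz Ts Tx[of m] scale_right_distrib)
    have "nrm (z m + x m - s m) \<le> nrm (z m) + nrm (x m) + nrm (s m)"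
      using nrm_nonneg[of "z m"] nrm_nonneg[of "x m"] nrm_nonneg[of "s m"]
      by (intro nrm_diff_le nrm_add_le) auto
    then have "nrm (z m + x m - s m) * R ^ m \<le> (nrm (z m) + nrm (x m) + nrm (s m)) * R ^ m"
      using R by (intro mult_right_mono) auto
    then show "nrm (z m + x m - s m) * R ^ m \<le> C + c * M + C\<^sub>2 * M"
      using z[of m] x_le[of m] s_le[of m] by (simp add: distrib_right)
  qed
  then have "z 0 + x 0 \<in> bwd B R" by (rule bwdI) (simp add: s_def)
  then show ?thesis using xB x0 by blast
qed

text \<open>The overflow into \<open>(T ^^ n) v\<close> is kept apart because a relation of degree
  \<open>n\<close> will replace it.\<close>

lemma T_eval:
  assumes "0 < n"
  shows "T (\<Sum>i<n. smul (f i) ((T ^^ i) v)) =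
    (\<Sum>i<n. smul (twist f i) ((T ^^ i) v)) + smul (f (n - 1)) ((T ^^ n) v)"
proof -
  obtain m where n: "n = Suc m" using assms by (cases n) auto
  have "T (\<Sum>i<n. smul (f i) ((T ^^ i) v)) =
      (\<Sum>i<n. smul (\<delta> (f i)) ((T ^^ i) v)) + (\<Sum>i<n. smul (f i) ((T ^^ Suc i) v))"
    by (simp add: T_sum T_smul sum.distrib)
  also have "(\<Sum>i<n. smul (f i) ((T ^^ Suc i) v)) =
      (\<Sum>i<m. smul (f i) ((T ^^ Suc i) v)) + smul (f (n - 1)) ((T ^^ n) v)"
    by (simp add: n)
  also have "(\<Sum>i<m. smul (f i) ((T ^^ Suc i) v)) =
      (\<Sum>i<n. smul (case i of 0 \<Rightarrow> 0 | Suc j \<Rightarrow> f j) ((T ^^ i) v))"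
    unfolding n by (subst sum.lessThan_Suc_shift) simp
  finally show ?thesis
    by (simp add: twist_def scale_left_distrib sum.distrib add.assoc)
qed

text \<open>Evaluation at \<open>v\<close> turns left multiplication by \<open>T\<close> into the
  action of \<open>T\<close>. A product of twisted polynomials thus acts as a composition, with
  \<open>w\<close> the value of the right factor.\<close>

lemma weierstrass_eval:
  fixes v :: 'v
  assumes k: "k < n" and g: "\<And>i. i > n \<Longrightarrow> g i = 0"
    and p: "\<And>i. p i = (if i = k then 1 else 0) + g i + tail_head_product k n g g i"
  defines "w \<equiv> (T ^^ k) v + (\<Sum>i<k. smul (g i) ((T ^^ i) v))"
  shows "(\<Sum>i\<le>n. smul (p i) ((T ^^ i) v)) = w + (\<Sum>j\<le>n - k. smul (g (j + k)) ((T ^^ j) w))"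
proof -
  define ev where "ev f = (\<Sum>i<Suc n. smul (f i) ((T ^^ i) v))" for f
  define y where "y i = (if i < k then g i else 0)" for i
  have ev_twist: "T (ev f) = ev (twist f)" if "f n = 0" for f
    unfolding ev_def using T_eval[of "Suc n" f v] that by simp
  \<comment> \<open>\<open>ev\<close> truncates above degree \<open>n\<close>; nothing is lost,
    since the degrees stay below \<open>k + j \<le> n\<close>.\<close>
  have ev_pow: "(T ^^ j) (ev y) = ev ((twist ^^ j) y)" if "j \<le> n - k" for j
    using that
  proof (induction j)
    case (Suc j)
    then have "(twist ^^ j) y n = 0" by (intro twist_funpow_support[of k]) (auto simp: y_def)
    then show ?case using Suc by (simp add: ev_twist)
  qed simp
  have ev_y: "ev y = (\<Sum>i<k. smul (g i) ((T ^^ i) v))"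
    unfolding ev_def by (rule sum.mono_neutral_cong_right) (use k in \<open>auto simp: y_def\<close>)
  have ev_add: "ev (\<lambda>i. f i + h i) = ev f + ev h" for f h
    by (simp add: ev_def scale_left_distrib sum.distrib del: sum.lessThan_Suc)
  have ev_one: "ev (\<lambda>i. if i = k then 1 else 0) = (T ^^ k) v"
    unfolding ev_def using k
    by (subst sum.mono_neutral_right[of _ "{k}"]) auto
  have "ev (tail_head_product k n g g) =
      (\<Sum>i<Suc n. \<Sum>j\<le>n - k. smul (g (j + k)) (smul ((twist ^^ j) y i) ((T ^^ i) v)))"
    unfolding ev_def tail_head_product_def y_def
    by (simp add: scale_sum_left del: sum.lessThan_Suc)
  also have "\<dots> = (\<Sum>j\<le>n - k. smul (g (j + k)) (ev ((twist ^^ j) y)))"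
    unfolding ev_def by (subst sum.swap) (simp add: scale_sum_right del: sum.lessThan_Suc)
  finally have ev_prod: "ev (tail_head_product k n g g) = (\<Sum>j\<le>n - k. smul (g (j + k)) ((T ^^ j) (ev y)))"
    using ev_pow by simp
  have "ev g = ev y + (\<Sum>j\<le>n - k. smul (g (j + k)) ((T ^^ (j + k)) v))"
  proof -
    have "ev g = (\<Sum>i<k. smul (g i) ((T ^^ i) v)) + (\<Sum>i=k..n. smul (g i) ((T ^^ i) v))"
      unfolding ev_def lessThan_Suc_atMost using k
      by (subst sum.union_disjoint[symmetric]) (auto intro: sum.cong)
    also have "(\<Sum>i=k..n. smul (g i) ((T ^^ i) v)) = (\<Sum>j\<le>n - k. smul (g (j + k)) ((T ^^ (j + k)) v))"
      by (rule sum.reindex_bij_witness[of _ "\<lambda>j. j + k" "\<lambda>i. i - k"]) (use k in auto)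
    finally show ?thesis by (simp add: ev_y)
  qed
  moreover have "(\<Sum>i\<le>n. smul (p i) ((T ^^ i) v)) = (T ^^ k) v + ev g + ev (tail_head_product k n g g)"
  proof -
    have "p = (\<lambda>i. (if i = k then 1 else 0) + g i + tail_head_product k n g g i)" using p by blast
    then have "ev p = (T ^^ k) v + ev g + ev (tail_head_product k n g g)" by (metis ev_add ev_one)
    then show ?thesis by (simp only: ev_def lessThan_Suc_atMost)
  qed
  moreover have "w = (T ^^ k) v + ev y" by (simp add: w_def ev_y)
  ultimately show ?thesis
    by (simp add: ev_prod T_pow_add scale_right_distrib sum.distrib funpow_add)
qed

end

section \<open>Generic radii and relations modulo a subspace\<close>

lemma generic_radius:
  fixes c :: "nat \<Rightarrow> real"
  assumes "0 \<le> a" "a < b" "finite I" "\<And>i. i \<in> I \<Longrightarrow> 0 < c i"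
  shows "\<exists>R. a < R \<and> R < b \<and> (\<forall>i\<in>I. \<forall>j\<in>I. i \<noteq> j \<longrightarrow> c i * R ^ i \<noteq> c j * R ^ j)"
proof -
  define Z where "Z i j = {R. 0 < R \<and> c i * R ^ i = c j * R ^ j}" for i j
  \<comment> \<open>Equality of two different monomials fixes \<open>R ^ (j - i)\<close>, hence at
    most one positive \<open>R\<close>. Finitely many pairs cannot exhaust an open interval.\<close>
  have "finite (Z i j)" if ij: "i < j" "i \<in> I" "j \<in> I" for i j
  proof -
    have *: "R ^ (j - i) = c i / c j" if "R \<in> Z i j" for R
    proof -
      have "c i * R ^ i = c j * (R ^ i * R ^ (j - i))" "0 < R"
        using that ij by (auto simp: Z_def simp flip: power_add)
      then show ?thesis using assms(4)[OF ij(3)] by (simp add: field_simps)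
    qed
    have "R = R'" if "R \<in> Z i j" "R' \<in> Z i j" for R R'
      using *[OF that(1)] *[OF that(2)] that ij
      by (intro power_eq_imp_eq_base[of R "j - i" R']) (auto simp: Z_def)
    then have "Z i j \<subseteq> {SOME R. R \<in> Z i j}" by (auto intro: someI2)
    then show ?thesis by (rule finite_subset) simp
  qed
  moreover have "Z i j = Z j i" for i j by (auto simp: Z_def)
  ultimately have "finite (Z i j)" if "i \<noteq> j" "i \<in> I" "j \<in> I" for i j
    using that by (metis nat_neq_iff)
  then have "finite (\<Union>i\<in>I. \<Union>j\<in>I - {i}. Z i j)" using assms(3) by auto
  then have "infinite ({a<..<b} - (\<Union>i\<in>I. \<Union>j\<in>I - {i}. Z i j))"
    using assms(2) by (intro Diff_infinite_finite) auto
  from infinite_imp_nonempty[OF this]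
  obtain R where "R \<in> {a<..<b} - (\<Union>i\<in>I. \<Union>j\<in>I - {i}. Z i j)" by (meson all_not_in_conv)
  then show ?thesis using assms(1) by (intro exI[of _ R]) (auto simp: Z_def)
qed

context finite_dimensional_vector_space
begin

lemma span_Un_image_lessThan:
  fixes n :: nat
  assumes "subspace U" "x \<in> span (U \<union> g ` {..<n})"
  shows "\<exists>a. x - (\<Sum>i<n. scale (a i) (g i)) \<in> U"
  using assms(2)
proof (induction n arbitrary: x)
  case 0
  then show ?case using span_minimal[of U U] assms(1) by auto
next
  case (Suc n)
  have "U \<union> g ` {..<Suc n} = insert (g n) (U \<union> g ` {..<n})" by (auto simp: lessThan_Suc)
  then obtain k where "x - scale k (g n) \<in> span (U \<union> g ` {..<n})"
    using Suc.prems by (auto simp: span_breakdown_eq)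
  then obtain a where "x - scale k (g n) - (\<Sum>i<n. scale (a i) (g i)) \<in> U" using Suc.IH by blast
  then show ?case by (intro exI[of _ "a(n := k)"]) (simp add: diff_diff_add add.commute)
qed

text \<open>Otherwise each \<open>g n\<close> would raise the dimension of the span with
  \<open>U\<close>. Applied to the iterates of a vector, this replaces the annihilating polynomial
  of its class modulo \<open>U\<close>.\<close>

lemma exists_linear_relation_mod:
  fixes g :: "nat \<Rightarrow> 'b"
  assumes "subspace U"
  shows "\<exists>n a. g n - (\<Sum>i<n. scale (a i) (g i)) \<in> U"
proof (rule ccontr)
  assume *: "\<nexists>n a. g n - (\<Sum>i<n. scale (a i) (g i)) \<in> U"
  have "n \<le> dim (U \<union> g ` {..<n})" for n
  proof (induction n)
    case (Suc n)
    have "g n \<notin> span (U \<union> g ` {..<n})" using span_Un_image_lessThan[OF assms] * by blast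
    moreover have "U \<union> g ` {..<Suc n} = insert (g n) (U \<union> g ` {..<n})" by (auto simp: lessThan_Suc)
    ultimately show ?case using Suc by (simp add: dim_insert)
  qed simp
  from this[of "Suc dimension"] show False
    using dim_subset_UNIV[of "U \<union> g ` {..<Suc dimension}"] by simp
qed

end

section \<open>Division by \<open>T\<close> and splitting on an interval without jumps\<close>

context twisted_operator
begin

text \<open>One step of inverting \<open>T\<close> on combinations of the \<open>T\<^sup>i w\<close>, where \<open>w + (\<Sum>j. x j T\<^sup>j w)\<close> is killed up
  to the error term \<open>u\<close>. Comparing coefficients from the top determines all of \<open>c'\<close> from the multiple
  \<open>\<mu>\<close> of the relation that has to be added; the lowest coefficient then gives a contraction for \<open>\<mu>\<close>.\<close>

lemma division_by_T:
  assumes R: "r \<le> R" "0 < R" and N: "0 < N"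
    and x: "\<And>j. av (x j) * R ^ j \<le> \<theta>" and \<theta>: "0 \<le> \<theta>" "\<theta> < 1"
    and u: "w + (\<Sum>j\<le>N. smul (x j) ((T ^^ j) w)) = u" and c: "gauss_le R M c"
  shows "\<exists>c' \<mu>. T (\<Sum>i<N. smul (c' i) ((T ^^ i) w)) = (\<Sum>i<N. smul (c i) ((T ^^ i) w)) + smul \<mu> u \<and>
    av \<mu> \<le> M \<and> gauss_le R (M / R) c'"
proof -
  have M: "0 \<le> M" using gauss_leD[OF c, of 0] av_nonneg[of "c 0"] by simp
  \<comment> \<open>\<open>e c \<mu> l\<close> is the coefficient of T^(N-1-l) in the solution,
    computed downwards from the top, where only \<open>\<mu> * x N\<close> has to be
    matched.\<close>
  define e where "e c \<mu> = rec_nat (\<mu> * x N) (\<lambda>l y. c (N - Suc l) + \<mu> * x (N - Suc l) - \<delta> y)" for c \<mu>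
  have e_0: "e c \<mu> 0 = \<mu> * x N" and e_Suc: "e c \<mu> (Suc l) = c (N - Suc l) + \<mu> * x (N - Suc l) - \<delta> (e c \<mu> l)"
    for c \<mu> l by (simp_all add: e_def)
  \<comment> \<open>Joint additivity separates the contribution of \<open>c\<close> from that of
    \<open>\<mu>\<close>; the latter becomes the map \<open>S\<close>.\<close>
  have e_add: "e (\<lambda>i. c i + c' i) (\<mu> + \<mu>') l = e c \<mu> l + e c' \<mu>' l" for c c' \<mu> \<mu>' l
    by (induction l) (simp_all add: e_0 e_Suc \<delta>_add algebra_simps)
  have mx: "av (\<mu> * x j) * R ^ j \<le> L" if "av \<mu> \<le> L" for \<mu> j L
  proof -
    have "av \<mu> * (av (x j) * R ^ j) \<le> L * 1"
      using that x[of j] \<theta> R av_nonneg order_trans[OF av_nonneg that] by (intro mult_mono) auto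
    then show ?thesis by (simp add: av_mult mult.assoc)
  qed
  have e_le: "av (e c \<mu> l) * R ^ (N - l) \<le> L"
    if c: "gauss_le R L c" and \<mu>: "\<And>j. av (\<mu> * x j) * R ^ j \<le> L" and l: "l \<le> N" for c \<mu> l L
    using l
  proof (induction l)
    case (Suc l)
    then have IH: "av (e c \<mu> l) * R ^ (N - l) \<le> L" by simp
    have "N - l = Suc (N - Suc l)" using Suc.prems by simp
    then have IH: "av (e c \<mu> l) * R ^ (N - Suc l) * R \<le> L" using IH by (simp add: ac_simps)
    have "av (\<delta> (e c \<mu> l)) \<le> R * av (e c \<mu> l)"
      using \<delta>_bounded R(1) av_nonneg mult_right_mono order_trans by blast
    then have "av (\<delta> (e c \<mu> l)) * R ^ (N - Suc l) \<le> R * av (e c \<mu> l) * R ^ (N - Suc l)"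
      using R by (intro mult_right_mono) auto
    then have "av (\<delta> (e c \<mu> l)) * R ^ (N - Suc l) \<le> L" using IH by (simp add: ac_simps)
    then show ?case unfolding e_Suc using gauss_leD[OF c, of "N - Suc l"] \<mu>[of "N - Suc l"]
      unfolding av_mult_le_iff[OF R(2)] by (intro av_sub_le av_add_le)
  qed (use \<mu> in \<open>simp add: e_0\<close>)
  \<comment> \<open>What remains is the equation in degree 0, of the form
    \<open>\<mu> + S \<mu> = b\<close>. The bound \<open>\<theta>\<close> on all \<open>x j\<close>
    makes \<open>S\<close> a contraction.\<close>
  define S where "S \<mu> = \<mu> * x 0 - \<delta> (e (\<lambda>_. 0) \<mu> (N - 1))" for \<mu>
  have e_le1: "av (\<delta> (e c \<mu> (N - 1))) \<le> L" if "gauss_le R L c" "\<And>j. av (\<mu> * x j) * R ^ j \<le> L" for c \<mu> L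
  proof -
    have "av (e c \<mu> (N - 1)) * R \<le> L" using e_le[OF that, of "N - 1"] N by simp
    then show ?thesis
      using \<delta>_bounded[of "e c \<mu> (N - 1)"] mult_right_mono[OF R(1) av_nonneg[of "e c \<mu> (N - 1)"]]
      by (simp add: mult.commute)
  qed
  have S_add: "S (\<mu> + \<mu>') = S \<mu> + S \<mu>'" for \<mu> \<mu>'
    using e_add[of "\<lambda>_. 0" "\<lambda>_. 0" \<mu> \<mu>'] by (simp add: S_def \<delta>_add algebra_simps)
  have S_le: "av (S \<mu>) \<le> \<theta> * av \<mu>" for \<mu>
  proof -
    have x\<theta>: "av (\<mu> * x j) * R ^ j \<le> \<theta> * av \<mu>" for j
      using mult_left_mono[OF x[of j] av_nonneg[of \<mu>]] by (simp add: av_mult ac_simps)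
    moreover have "gauss_le R (\<theta> * av \<mu>) (\<lambda>_. 0)" using \<theta> av_nonneg by (simp add: gauss_le_def)
    ultimately show ?thesis unfolding S_def
      using x\<theta>[of 0] e_le1 by (intro av_sub_le) auto
  qed
  define b where "b = \<delta> (e c 0 (N - 1)) - c 0"
  have "av b \<le> M" unfolding b_def
    using e_le1[OF c, of 0] gauss_leD[OF c, of 0] M by (intro av_sub_le) auto
  then obtain \<mu> where \<mu>: "\<mu> + S \<mu> = b" "av \<mu> \<le> M"
    using contraction_surj[of S \<theta> b, OF S_add S_le \<theta>] by (metis order_trans)
  define c' where "c' i = (if i < N then e c \<mu> (N - Suc i) else 0)" for i
  have "e c \<mu> (N - 1) = e c 0 (N - 1) + e (\<lambda>_. 0) \<mu> (N - 1)"
    using e_add[of c "\<lambda>_. 0" 0 \<mu> "N - 1"] by simp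
  then have low: "\<delta> (c' 0) = c 0 + \<mu> * x 0 + \<mu>"
    using \<mu>(1) N by (simp add: c'_def S_def b_def \<delta>_add algebra_simps)
  have tw: "twist c' i = c i + \<mu> * x i + (if i = 0 then \<mu> else 0)" if i: "i < N" for i
  proof (cases i)
    case (Suc l)
    then have "e c \<mu> (N - Suc l) = c i + \<mu> * x i - \<delta> (e c \<mu> (N - Suc i))"
      using e_Suc[of c \<mu> "N - Suc i"] i by (simp add: Suc_diff_Suc)
    then show ?thesis using Suc i by (simp add: twist_def c'_def)
  qed (simp add: twist_def low)
  have "T (\<Sum>i<N. smul (c' i) ((T ^^ i) w)) =
      (\<Sum>i<N. smul (c i + \<mu> * x i + (if i = 0 then \<mu> else 0)) ((T ^^ i) w)) + smul (\<mu> * x N) ((T ^^ N) w)"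
    using T_eval[OF N, of c' w] tw N by (simp add: c'_def e_0)
  also have "(\<Sum>i<N. smul (c i + \<mu> * x i + (if i = 0 then \<mu> else 0)) ((T ^^ i) w)) =
      (\<Sum>i<N. smul (c i) ((T ^^ i) w)) + smul \<mu> (\<Sum>i<N. smul (x i) ((T ^^ i) w)) +
      (\<Sum>i<N. smul (if i = 0 then \<mu> else 0) ((T ^^ i) w))"
    by (simp add: scale_left_distrib sum.distrib scale_sum_right)
  also have "(\<Sum>i<N. smul (if i = 0 then \<mu> else 0) ((T ^^ i) w)) = smul \<mu> w"
    by (subst sum.mono_neutral_right[of _ "{0}"]) (use N in auto)
  finally have "T (\<Sum>i<N. smul (c' i) ((T ^^ i) w)) = (\<Sum>i<N. smul (c i) ((T ^^ i) w)) + smul \<mu> u"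
    by (simp add: u[symmetric] scale_right_distrib lessThan_Suc_atMost[symmetric] add.assoc)
  moreover have "gauss_le R (M / R) c'"
    unfolding gauss_le_def
  proof
    fix i
    show "av (c' i) * R ^ i \<le> M / R"
    proof (cases "i < N")
      case True
      then have "N - (N - Suc i) = Suc i" by simp
      then have "av (c' i) * R ^ Suc i \<le> M"
        using e_le[OF c, of \<mu> "N - Suc i"] mx[OF \<mu>(2)] True by (simp add: c'_def)
      then show ?thesis using R by (simp add: pos_le_divide_eq ac_simps)
    qed (use M R in \<open>simp add: c'_def\<close>)
  qed
  ultimately show ?thesis using \<mu>(2) by blast
qed

text \<open>Each no-jump hypothesis serves one case: the first lowers a forward rate
  \<open>R < \<sigma>\<^sub>2\<close> to \<open>\<sigma>\<^sub>1\<close>, the second raises a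
  backward rate \<open>R > \<sigma>\<^sub>1\<close> to \<open>\<sigma>\<^sub>2\<close>. Hence the
  radius is taken strictly inside the interval.\<close>

lemma splitting_if_constant_rates:
  assumes \<sigma>: "r \<le> \<sigma>\<^sub>1" "\<sigma>\<^sub>1 < \<sigma>\<^sub>2" and B: "subspace B" "T ` B \<subseteq> B"
    and fwd: "B \<inter> fwd \<sigma>\<^sub>2 \<subseteq> fwd \<sigma>\<^sub>1" and bwd: "bwd B \<sigma>\<^sub>1 \<subseteq> bwd B \<sigma>\<^sub>2"
    and v: "v \<in> B"
  shows "\<exists>x\<in>B \<inter> fwd \<sigma>\<^sub>1. \<exists>y\<in>bwd B \<sigma>\<^sub>2. v = x + y"
proof (rule ccontr)
  define U where "U = {x + y |x y. x \<in> B \<inter> fwd \<sigma>\<^sub>1 \<and> y \<in> bwd B \<sigma>\<^sub>2}"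
  assume "\<not> ?thesis"
  then have vU: "v \<notin> U" by (auto simp: U_def)
  have \<sigma>1: "0 \<le> \<sigma>\<^sub>1" "r < \<sigma>\<^sub>2" using \<sigma> r_nonneg by auto
  have L: "subspace (B \<inter> fwd \<sigma>\<^sub>1)" by (intro subspace_inter B subspace_fwd \<sigma>)
  have G: "subspace (bwd B \<sigma>\<^sub>2)" by (intro subspace_bwd B \<sigma>1)
  have U: "subspace U" unfolding U_def using subspace_sums[OF L G] .
  have LU: "x \<in> U" if "x \<in> B" "x \<in> fwd \<sigma>\<^sub>1" for x
    unfolding U_def using that subspace_0[OF G] by (intro CollectI exI[of _ x] exI[of _ 0]) auto
  have GU: "y \<in> U" if "y \<in> bwd B \<sigma>\<^sub>2" for y
    unfolding U_def using that subspace_0[OF L] by (intro CollectI exI[of _ 0] exI[of _ y]) auto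
  define rel where "rel n a \<longleftrightarrow> (T ^^ n) v - (\<Sum>i<n. smul (a i) ((T ^^ i) v)) \<in> U" for n and a :: "nat \<Rightarrow> 'f"
  define n where "n = (LEAST n. \<exists>a. rel n a)"
  have "\<exists>n a. rel n a" unfolding rel_def by (rule exists_linear_relation_mod[OF U])
  then have "\<exists>a. rel n a" unfolding n_def by (rule LeastI_ex)
  then obtain a where a: "rel n a" by blast
  have n_min: "\<not> rel k a" if "k < n" for k a
    using not_less_Least[of k "\<lambda>n. \<exists>a. rel n a"] that by (auto simp: n_def)
  have n: "0 < n" using a vU by (intro gr0I) (auto simp: rel_def)
  define u where "u = (T ^^ n) v - (\<Sum>i<n. smul (a i) ((T ^^ i) v))"
  have "u \<in> U" using a by (simp add: rel_def u_def)
  then obtain u\<^sub>1 u\<^sub>2 where u: "u = u\<^sub>1 + u\<^sub>2" "u\<^sub>1 \<in> B" "u\<^sub>1 \<in> fwd \<sigma>\<^sub>1" "u\<^sub>2 \<in> bwd B \<sigma>\<^sub>2"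
    by (auto simp: U_def)
  define p where "p i = (if i < n then - a i else if i = n then 1 else 0)" for i
  have p_eval: "(\<Sum>i\<le>n. smul (p i) ((T ^^ i) v)) = u"
    by (simp add: p_def u_def lessThan_Suc_atMost[symmetric] sum_negf)
  define I where "I = {i. i \<le> n \<and> p i \<noteq> 0}"
  have I: "finite I" "n \<in> I" by (auto simp: I_def p_def)
  have pos: "0 < av (p i)" if "i \<in> I" for i
    using that av_nonneg[of "p i"] av_eq_0_iff[of "p i"] by (simp add: I_def)
  obtain R where
    R: "\<sigma>\<^sub>1 < R" "R < \<sigma>\<^sub>2" and R_gen: "\<And>i j. i \<in> I \<Longrightarrow> j \<in> I \<Longrightarrow> i \<noteq> j \<Longrightarrow> av (p i) * R ^ i \<noteq> av (p j) * R ^ j"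
    using generic_radius[OF \<sigma>1(1) \<sigma>(2) I(1), of "\<lambda>i. av (p i)"] pos by blast
  have R0: "0 < R" "r \<le> R" using R \<sigma> \<sigma>1 by auto
  define s where "s i = av (p i) * R ^ i" for i
  obtain k where k: "k \<in> I" "\<And>i. i \<in> I \<Longrightarrow> s i \<le> s k"
    using I Max_in[of "s ` I"] Max_ge[of "s ` I"] by (metis empty_iff finite_imageI image_iff image_is_empty)
  have sk: "0 < s k" using k(1) av_nonneg[of "p k"] av_eq_0_iff[of "p k"] R0 by (simp add: I_def s_def)
  \<comment> \<open>Genericity excludes ties, so the maximal term is strictly maximal.\<close>
  have s_less: "s i < s k" if "i \<noteq> k" for i
  proof (cases "i \<in> I")
    case True
    then show ?thesis using k(2)[OF True] R_gen[OF True k(1) that] by (simp add: s_def)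
  next
    case False
    then have "p i = 0" by (auto simp: I_def p_def)
    then show ?thesis using sk by (simp add: s_def)
  qed
  have "k \<le> n" using k(1) by (simp add: I_def)
  then consider "k = n" | "k < n" by linarith
  then show False
  proof cases
    case 1
    define a' where "a' i = (if i < n then a i else 0)" for i
    have a': "av (a' i) * R ^ i \<le> R ^ n" for i
      using s_less[of i] 1 R0 by (auto simp: a'_def s_def p_def)
    \<comment> \<open>\<open>c m\<close> is the remainder of T^m on right division by the monic
      polynomial \<open>p\<close>. The vector \<open>z m\<close> follows the orbit of
      \<open>v\<close>, with a multiple of \<open>u\<close> as the error of each step.\<close>
    define c where "c = rec_nat (\<lambda>i. if i = 0 then 1 else 0) (\<lambda>_ c i. twist c i + c (n - 1) * a' i)"
    have c_0: "c 0 = (\<lambda>i. if i = 0 then 1 else 0)"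
      and c_Suc: "c (Suc m) = (\<lambda>i. twist (c m) i + c m (n - 1) * a' i)" for m
      by (simp_all add: c_def)
    have Rn: "R ^ n = R ^ (n - 1) * R" using n by (simp flip: power_Suc2)
    \<comment> \<open>Reducing T^n does not increase the Gauss norm, since the leading term of
      \<open>p\<close> dominates.\<close>
    have c_le: "gauss_le R (R ^ m) (c m)" for m
    proof (induction m)
      case (Suc m)
      show ?case unfolding c_Suc
      proof (rule gauss_le_add[OF R0(1)])
        show "gauss_le R (R ^ Suc m) (twist (c m))"
          using gauss_le_twist[OF R0(2,1) Suc] by simp
        show "gauss_le R (R ^ Suc m) (\<lambda>i. c m (n - 1) * a' i)"
          unfolding gauss_le_def
        proof
          fix i
          have "(av (c m (n - 1)) * R ^ (n - 1)) * (av (a' i) * R ^ i) \<le> R ^ m * R ^ n"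
            using gauss_leD[OF Suc] a' R0 av_nonneg by (intro mult_mono) auto
          then have "R ^ (n - 1) * (av (c m (n - 1) * a' i) * R ^ i) \<le> R ^ (n - 1) * R ^ Suc m"
            by (simp add: Rn av_mult ac_simps)
          then show "av (c m (n - 1) * a' i) * R ^ i \<le> R ^ Suc m" using R0 by simp
        qed
      qed
    qed (auto simp: gauss_le_def c_0)
    define z where "z m = (\<Sum>i<n. smul (c m i) ((T ^^ i) v))" for m
    have Tz: "T (z m) = z (Suc m) + smul (c m (n - 1)) (u\<^sub>1 + u\<^sub>2)" for m
    proof -
      have "(T ^^ n) v = (\<Sum>i<n. smul (a' i) ((T ^^ i) v)) + (u\<^sub>1 + u\<^sub>2)"
        by (simp add: a'_def u(1)[symmetric] u_def)
      then show ?thesis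
        unfolding z_def T_eval[OF n] by (simp add: c_Suc scale_left_distrib scale_right_distrib sum.distrib scale_sum_right)
    qed
    have f_le: "av (c m (n - 1)) \<le> 1 / R ^ (n - 1) * R ^ m" for m
      using gauss_leD[OF c_le, of m "n - 1"] R0 by (simp add: pos_le_divide_eq)
    have z_le: "nrm (z m) \<le> (\<Sum>i<n. nrm ((T ^^ i) v) / R ^ i) * R ^ m" for m
      unfolding z_def
    proof (rule nrm_sum_le)
      show "0 \<le> (\<Sum>i<n. nrm ((T ^^ i) v) / R ^ i) * R ^ m"
        using R0 nrm_nonneg by (auto intro!: mult_nonneg_nonneg sum_nonneg divide_nonneg_nonneg)
      fix i assume i: "i \<in> {..<n}"
      have "nrm (smul (c m i) ((T ^^ i) v)) \<le> R ^ m / R ^ i * nrm ((T ^^ i) v)"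
        unfolding nrm_smul using gauss_leD[OF c_le, of m i] R0 nrm_nonneg
        by (intro mult_right_mono) (auto simp: pos_le_divide_eq)
      also have "\<dots> = nrm ((T ^^ i) v) / R ^ i * R ^ m" by simp
      also have "\<dots> \<le> (\<Sum>i<n. nrm ((T ^^ i) v) / R ^ i) * R ^ m"
        using i R0 nrm_nonneg
        by (intro mult_right_mono member_le_sum[of i "{..<n}" "\<lambda>i. nrm ((T ^^ i) v) / R ^ i"]) auto
      finally show "nrm (smul (c m i) ((T ^^ i) v)) \<le> (\<Sum>i<n. nrm ((T ^^ i) v) / R ^ i) * R ^ m" .
    qed
    have z0: "z 0 = v"
      unfolding z_def c_0 by (subst sum.mono_neutral_right[of _ "{0}"]) (use n in auto)
    obtain y where y: "y \<in> bwd B \<sigma>\<^sub>2" "v - y \<in> fwd R"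
      using fwd_lift[OF \<sigma>(1) _ R0(1) R(2) B(1) u(3,4) Tz f_le z_le] R z0 by auto
    have "v - y \<in> B" using v y(1) bwd_subset B by (auto intro: subspace_diff)
    moreover have "v - y \<in> fwd \<sigma>\<^sub>2" using y(2) fwd_mono[of R \<sigma>\<^sub>2] R R0 by auto
    ultimately have "v - y \<in> U" using fwd LU by blast
    then have "(v - y) + y \<in> U" using GU[OF y(1)] U by (intro subspace_add)
    then show False using vU by simp
  next
    case 2
    define p' where "p' i = p i / p k" for i
    have pk: "p k \<noteq> 0" using k(1) by (simp add: I_def)
    define \<theta> where "\<theta> = Max (insert 0 ((\<lambda>i. s i / s k) ` ({..n} - {k})))"
    have \<theta>: "0 \<le> \<theta>" "\<theta> < 1" unfolding \<theta>_def using s_less sk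
      by (auto intro: Max_ge)
    have \<theta>_ge: "s i / s k \<le> \<theta>" if "i \<noteq> k" "i \<le> n" for i
      unfolding \<theta>_def using that by (intro Max_ge) auto
    have p'_le: "av (p' i) * R ^ i \<le> \<theta> * R ^ k" if "i \<noteq> k" for i
    proof (cases "i \<le> n")
      case True
      have "av (p' i) * R ^ i = s i / s k * R ^ k"
        using R0 pk av_eq_0_iff[of "p k"] by (simp add: p'_def av_divide s_def)
      also have "\<dots> \<le> \<theta> * R ^ k" using \<theta>_ge[OF that True] R0 by (intro mult_right_mono) auto
      finally show ?thesis .
    qed (use \<theta> R0 in \<open>auto simp: p'_def p_def\<close>)
    obtain g where g: "gauss_le R (\<theta> * R ^ k) g" "\<And>i. i > n \<Longrightarrow> g i = 0"
      "\<And>i. p' i = (if i = k then 1 else 0) + g i + tail_head_product k n g g i"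
      using weierstrass_factorization[OF R0(2,1) \<open>k \<le> n\<close> _ _ p'_le \<theta>] pk
      by (auto simp: p'_def p_def)
    define w where "w = (T ^^ k) v + (\<Sum>i<k. smul (g i) ((T ^^ i) v))"
    define N where "N = n - k"
    have N: "0 < N" using 2 by (simp add: N_def)
    \<comment> \<open>\<open>w\<close> is the value of the right factor, of degree
      \<open>k < n\<close>; membership in \<open>U\<close> would be a shorter relation for
      \<open>v\<close>.\<close>
    have "rel k (\<lambda>i. - g i) \<longleftrightarrow> w \<in> U" by (simp add: rel_def w_def sum_negf)
    then have wU: "w \<notin> U" using n_min[OF 2] by blast
    have wB: "w \<in> B" unfolding w_def
      using v B by (intro subspace_add subspace_sum subspace_scale T_pow_mem) auto
    define \<kappa> where "\<kappa> = inverse (p k)"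
    have "(\<Sum>i\<le>n. smul (p' i) ((T ^^ i) v)) = smul \<kappa> u"
      unfolding p_eval[symmetric] by (simp add: p'_def \<kappa>_def scale_sum_right divide_inverse mult.commute)
    \<comment> \<open>The left factor sends \<open>w\<close> to a multiple of \<open>u\<close>.
      Apart from the summand 1 its coefficients have Gauss norm at most \<open>\<theta> < 1\<close>,
      so \<open>T\<close> can be inverted on combinations of the iterates of \<open>w\<close>, up to
      multiples of \<open>u\<close>.\<close>
    then have w_rel: "w + (\<Sum>j\<le>N. smul (g (j + k)) ((T ^^ j) w)) = smul \<kappa> u"
      using weierstrass_eval[OF 2 g(2,3), of v] by (simp add: w_def N_def)
    have x_le: "av (g (j + k)) * R ^ j \<le> \<theta>" for j
      using gauss_leD[OF g(1), of "j + k"] R0 by (simp add: power_add)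
    define step where "step m c c' \<longleftrightarrow> (\<exists>\<mu>. T (\<Sum>i<N. smul (c' i) ((T ^^ i) w)) =
        (\<Sum>i<N. smul (c i) ((T ^^ i) w)) + smul \<mu> (smul \<kappa> u) \<and> av \<mu> \<le> 1 / R ^ m)" for m :: nat and c c'
    \<comment> \<open>Starting from the constant polynomial 1 gives \<open>z 0 = w\<close>; each
      division by \<open>T\<close> gains a factor \<open>1 / R\<close>.\<close>
    have "\<exists>c. \<forall>m. gauss_le R (1 / R ^ m) (c m) \<and> step m (c m) (c (Suc m)) \<and> (m = 0 \<longrightarrow> c m = (\<lambda>i. if i = 0 then 1 else 0))"
    proof -
      have "\<exists>c. \<forall>m. (gauss_le R (1 / R ^ m) (c m) \<and> (m = 0 \<longrightarrow> c m = (\<lambda>i. if i = 0 then 1 else 0)))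
          \<and> step m (c m) (c (Suc m))"
      proof (rule dependent_nat_choice)
        show "\<exists>c. gauss_le R (1 / R ^ 0) c \<and> (0 = 0 \<longrightarrow> c = (\<lambda>i. if i = 0 then 1 else 0))"
          by (auto simp: gauss_le_def)
        fix c m assume "gauss_le R (1 / R ^ m) c \<and> (m = 0 \<longrightarrow> c = (\<lambda>i. if i = 0 then 1 else 0))"
        then have "gauss_le R (1 / R ^ m) c" by blast
        from division_by_T[OF R0(2,1) N x_le \<theta> w_rel this]
        show "\<exists>c'. (gauss_le R (1 / R ^ Suc m) c' \<and> (Suc m = 0 \<longrightarrow> c' = (\<lambda>i. if i = 0 then 1 else 0))) \<and> step m c c'"
          by (auto simp: step_def mult.commute)
      qed
      then show ?thesis by blast
    qed
    then obtain c where c: "\<And>m. gauss_le R (1 / R ^ m) (c m)" "\<And>m. step m (c m) (c (Suc m))"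
      "c 0 = (\<lambda>i. if i = 0 then 1 else 0)"
      by blast
    have "\<forall>m. \<exists>\<mu>. T (\<Sum>i<N. smul (c (Suc m) i) ((T ^^ i) w)) =
        (\<Sum>i<N. smul (c m i) ((T ^^ i) w)) + smul \<mu> (smul \<kappa> u) \<and> av \<mu> \<le> 1 / R ^ m"
      using c(2) by (simp only: step_def) simp
    from choice[OF this] obtain \<mu> where \<mu>: "\<And>m. T (\<Sum>i<N. smul (c (Suc m) i) ((T ^^ i) w)) =
        (\<Sum>i<N. smul (c m i) ((T ^^ i) w)) + smul (\<mu> m) (smul \<kappa> u)" "\<And>m. av (\<mu> m) \<le> 1 / R ^ m"
      by blast
    define z where "z m = (\<Sum>i<N. smul (c m i) ((T ^^ i) w))" for m
    have z0: "z 0 = w"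
      unfolding z_def c(3) by (subst sum.mono_neutral_right[of _ "{0}"]) (use N in auto)
    have zB: "z m \<in> B" for m unfolding z_def
      using wB B by (intro subspace_sum subspace_scale T_pow_mem) auto
    have Tz: "T (z (Suc m)) = z m + smul (\<mu> m * \<kappa>) (u\<^sub>1 + u\<^sub>2)" for m
      using \<mu>(1) by (simp add: z_def u(1)[symmetric])
    have f_le: "av (\<mu> m * \<kappa>) * R ^ m \<le> av \<kappa>" for m
    proof -
      have "av (\<mu> m) * R ^ m \<le> 1" using \<mu>(2)[of m] R0 by (simp add: pos_le_divide_eq)
      from mult_left_mono[OF this av_nonneg[of \<kappa>]] show ?thesis by (simp add: av_mult ac_simps)
    qed
    have z_le: "nrm (z m) * R ^ m \<le> (\<Sum>i<N. nrm ((T ^^ i) w) / R ^ i)" for m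
    proof -
      have "nrm (z m) \<le> (\<Sum>i<N. nrm ((T ^^ i) w) / R ^ i) / R ^ m"
        unfolding z_def
      proof (rule nrm_sum_le)
        show "0 \<le> (\<Sum>i<N. nrm ((T ^^ i) w) / R ^ i) / R ^ m"
          using R0 nrm_nonneg by (auto intro!: divide_nonneg_nonneg sum_nonneg)
        fix i assume i: "i \<in> {..<N}"
        have "nrm (smul (c m i) ((T ^^ i) w)) \<le> (1 / R ^ m) / R ^ i * nrm ((T ^^ i) w)"
          unfolding nrm_smul using gauss_leD[OF c(1), of m i] R0 nrm_nonneg
          by (intro mult_right_mono) (simp_all add: av_mult_le_iff)
        also have "\<dots> = nrm ((T ^^ i) w) / R ^ i / R ^ m" by simp
        also have "\<dots> \<le> (\<Sum>i<N. nrm ((T ^^ i) w) / R ^ i) / R ^ m"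
          using i R0 nrm_nonneg
          by (intro divide_right_mono member_le_sum[of i "{..<N}" "\<lambda>i. nrm ((T ^^ i) w) / R ^ i"]) auto
        finally show "nrm (smul (c m i) ((T ^^ i) w)) \<le> (\<Sum>i<N. nrm ((T ^^ i) w) / R ^ i) / R ^ m" .
      qed
      then show ?thesis using R0 by (simp add: pos_le_divide_eq)
    qed
    obtain x where x: "x \<in> B" "x \<in> fwd \<sigma>\<^sub>1" "w + x \<in> bwd B R"
      using bwd_lift[OF \<sigma>(1) R(1) less_imp_le[OF R(2)] B u(2,3,4) zB Tz f_le z_le] z0 by auto
    have "w + x \<in> bwd B \<sigma>\<^sub>2" using x(3) bwd_mono[OF \<sigma>1(1) less_imp_le[OF R(1)] order_refl] bwd by blast
    then have "(w + x) - x \<in> U" using GU LU x U by (intro subspace_diff) auto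
    then show False using wU by simp
  qed
qed

end

section \<open>Splitting at a given rate\<close>

context twisted_operator
begin

text \<open>Admitting every rate above \<open>\<rho>\<close> allows subexponential factors, as a
  spectral norm does, and makes the family continuous from the right.\<close>

definition slow :: "real \<Rightarrow> 'v set" where
  "slow \<rho> = (\<Inter>\<sigma>\<in>{\<rho><..}. fwd \<sigma>)"

text \<open>Only rates strictly above \<open>\<rho>\<close> occur, so the series for scalar
  multiples converge even when \<open>\<rho> = r\<close>.\<close>

definition fast :: "'v set \<Rightarrow> real \<Rightarrow> 'v set" where
  "fast B \<rho> = (\<Union>\<sigma>\<in>{\<rho><..}. bwd B \<sigma>)"

lemma subspace_slow: "r \<le> \<rho> \<Longrightarrow> subspace (slow \<rho>)"
  unfolding slow_def by (intro subspace_Int subspace_fwd) auto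

lemma subspace_fast:
  assumes "r \<le> \<rho>" "subspace B"
  shows "subspace (fast B \<rho>)"
proof (rule subspaceI)
  have sub: "subspace (bwd B \<sigma>)" if "\<rho> < \<sigma>" for \<sigma> using that assms by (intro subspace_bwd) auto
  show "0 \<in> fast B \<rho>" unfolding fast_def using subspace_0[OF sub[of "\<rho> + 1"]] by force
  fix x assume "x \<in> fast B \<rho>"
  then obtain \<sigma> where x: "\<rho> < \<sigma>" "x \<in> bwd B \<sigma>" by (auto simp: fast_def)
  show "smul c x \<in> fast B \<rho>" for c
    unfolding fast_def using x subspace_scale[OF sub[OF x(1)] x(2)] by auto
  fix y assume "y \<in> fast B \<rho>"
  then obtain \<tau> where y: "\<rho> < \<tau>" "y \<in> bwd B \<tau>" by (auto simp: fast_def)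
  have pos: "0 \<le> min \<sigma> \<tau>" using x y assms r_nonneg by auto
  have "x \<in> bwd B (min \<sigma> \<tau>)" "y \<in> bwd B (min \<sigma> \<tau>)"
    using bwd_mono[OF pos, of \<sigma> B B] bwd_mono[OF pos, of \<tau> B B] x y by auto
  then have "x + y \<in> bwd B (min \<sigma> \<tau>)" using sub[of "min \<sigma> \<tau>"] x y by (intro subspace_add) auto
  then show "x + y \<in> fast B \<rho>" unfolding fast_def using x y by (intro UN_I[of "min \<sigma> \<tau>"]) auto
qed

lemma fast_subset: "fast B \<rho> \<subseteq> B"
  using bwd_subset by (auto simp: fast_def)

lemma fast_mono: "0 \<le> \<rho> \<Longrightarrow> B \<subseteq> B' \<Longrightarrow> fast B \<rho> \<subseteq> fast B' \<rho>"
  unfolding fast_def by (intro UN_mono bwd_mono order_refl) auto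

lemma slow_mono: "\<rho> \<le> \<rho>' \<Longrightarrow> slow \<rho> \<subseteq> slow \<rho>'"
  unfolding slow_def by auto

lemma commuting_slow:
  assumes "\<And>v. S (T v) = T (S v)" "\<And>v. nrm (S v) \<le> L * nrm v" "v \<in> slow \<rho>"
  shows "S v \<in> slow \<rho>"
  unfolding slow_def
proof
  fix \<sigma> assume "\<sigma> \<in> {\<rho><..}"
  then have "v \<in> fwd \<sigma>" using assms(3) by (simp add: slow_def)
  then show "S v \<in> fwd \<sigma>" by (rule commuting_fwd[OF assms(1,2)])
qed

lemma commuting_fast:
  assumes "\<And>v. S (T v) = T (S v)" "\<And>v. nrm (S v) \<le> L * nrm v" "S ` B \<subseteq> B" "0 \<le> \<rho>" "v \<in> fast B \<rho>"
  shows "S v \<in> fast B \<rho>"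
proof -
  obtain \<sigma> where \<sigma>: "\<rho> < \<sigma>" "v \<in> bwd B \<sigma>" using assms(5) by (auto simp: fast_def)
  then have "S v \<in> bwd B \<sigma>" using assms(4) by (intro commuting_bwd[OF assms(1-3)]) auto
  then show ?thesis using \<sigma>(1) by (auto simp: fast_def)
qed

lemma slow_fast_disjoint:
  assumes "r \<le> \<rho>" "v \<in> slow \<rho>" "v \<in> fast B \<rho>"
  shows "v = 0"
proof -
  obtain \<tau> where \<tau>: "\<rho> < \<tau>" "v \<in> bwd B \<tau>" using assms(3) by (auto simp: fast_def)
  obtain \<sigma> where \<sigma>: "\<rho> < \<sigma>" "\<sigma> < \<tau>" using dense[OF \<tau>(1)] by blast
  have "v \<in> fwd \<sigma>" using assms(2) \<sigma>(1) by (simp add: slow_def)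
  then show ?thesis using fwd_bwd_disjoint[of \<sigma> \<tau> v B] \<sigma> \<tau> assms(1) r_nonneg by auto
qed

text \<open>By finite dimension, \<open>fwd\<close> and \<open>bwd\<close> are constant just above \<open>\<rho>\<close>.\<close>

lemma slow_fast_splitting:
  assumes \<rho>: "r \<le> \<rho>" and B: "subspace B" "T ` B \<subseteq> B" and v: "v \<in> B"
  shows "\<exists>x\<in>B \<inter> slow \<rho>. \<exists>y\<in>fast B \<rho>. v = x + y"
proof -
  have fs: "subspace (B \<inter> fwd \<sigma>)" if "\<rho> < \<sigma>" for \<sigma> using that \<rho> B by (intro subspace_inter subspace_fwd) auto
  have bs: "subspace (bwd B \<sigma>)" if "\<rho> < \<sigma>" for \<sigma> using that \<rho> B by (intro subspace_bwd) auto
  \<comment> \<open>As the rate decreases to \<open>\<rho>\<close> the forward spaces shrink and the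
    backward spaces grow, so a minimal and a maximal dimension mark where they become
    constant.\<close>
  obtain \<sigma>\<^sub>a where a: "\<rho> < \<sigma>\<^sub>a" "\<And>\<sigma>. \<rho> < \<sigma> \<Longrightarrow> dim (B \<inter> fwd \<sigma>\<^sub>a) \<le> dim (B \<inter> fwd \<sigma>)"
    using ex_has_least_nat[of "\<lambda>\<sigma>. \<rho> < \<sigma>" "\<rho> + 1" "\<lambda>\<sigma>. dim (B \<inter> fwd \<sigma>)"] by auto
  obtain \<sigma>\<^sub>b where b: "\<rho> < \<sigma>\<^sub>b" "\<And>\<sigma>. \<rho> < \<sigma> \<Longrightarrow> dim (bwd B \<sigma>) \<le> dim (bwd B \<sigma>\<^sub>b)"
    using ex_has_greatest_nat[of "\<lambda>\<sigma>. \<rho> < \<sigma>" "\<rho> + 1" "\<lambda>\<sigma>. dim (bwd B \<sigma>)" "Suc dimension"] dim_subset_UNIV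
    by (auto simp: less_Suc_eq_le)
  have fa: "B \<inter> fwd \<sigma> = B \<inter> fwd \<sigma>\<^sub>a" if "\<rho> < \<sigma>" "\<sigma> \<le> \<sigma>\<^sub>a" for \<sigma>
  proof (rule subspace_dim_equal)
    show "B \<inter> fwd \<sigma> \<subseteq> B \<inter> fwd \<sigma>\<^sub>a" using fwd_mono[of \<sigma> \<sigma>\<^sub>a] that \<rho> r_nonneg by auto
  qed (use fs a that in auto)
  have fb: "bwd B \<sigma>\<^sub>b = bwd B \<sigma>" if "\<rho> < \<sigma>" "\<sigma> \<le> \<sigma>\<^sub>b" for \<sigma>
  proof (rule subspace_dim_equal)
    show "bwd B \<sigma>\<^sub>b \<subseteq> bwd B \<sigma>" using bwd_mono[of \<sigma> \<sigma>\<^sub>b B B] that \<rho> r_nonneg by auto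
  qed (use bs b that in auto)
  define \<sigma>\<^sub>2 where "\<sigma>\<^sub>2 = min \<sigma>\<^sub>a \<sigma>\<^sub>b"
  have \<sigma>2: "\<rho> < \<sigma>\<^sub>2" "\<sigma>\<^sub>2 \<le> \<sigma>\<^sub>a" "\<sigma>\<^sub>2 \<le> \<sigma>\<^sub>b" using a b by (auto simp: \<sigma>\<^sub>2_def)
  obtain \<sigma>\<^sub>1 where \<sigma>1: "\<rho> < \<sigma>\<^sub>1" "\<sigma>\<^sub>1 < \<sigma>\<^sub>2" using dense[OF \<sigma>2(1)] by blast
  have "\<exists>x\<in>B \<inter> fwd \<sigma>\<^sub>1. \<exists>y\<in>bwd B \<sigma>\<^sub>2. v = x + y"
  proof (rule splitting_if_constant_rates[OF _ \<sigma>1(2) B _ _ v])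
    show "B \<inter> fwd \<sigma>\<^sub>2 \<subseteq> fwd \<sigma>\<^sub>1" using fa[of \<sigma>\<^sub>1] fa[of \<sigma>\<^sub>2] \<sigma>1 \<sigma>2 by auto
    show "bwd B \<sigma>\<^sub>1 \<subseteq> bwd B \<sigma>\<^sub>2" using fb[of \<sigma>\<^sub>1] fb[of \<sigma>\<^sub>2] \<sigma>1 \<sigma>2 by auto
  qed (use \<rho> \<sigma>1 in auto)
  moreover have "B \<inter> fwd \<sigma>\<^sub>1 \<subseteq> slow \<rho>"
  proof -
    have "B \<inter> fwd \<sigma>\<^sub>1 \<subseteq> fwd \<sigma>" if \<sigma>: "\<rho> < \<sigma>" for \<sigma>
    proof -
      have "B \<inter> fwd \<sigma>\<^sub>1 = B \<inter> fwd (min \<sigma> \<sigma>\<^sub>a)"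
        using fa[of \<sigma>\<^sub>1] fa[of "min \<sigma> \<sigma>\<^sub>a"] \<sigma>1 \<sigma>2 \<sigma> a by auto
      also have "\<dots> \<subseteq> fwd \<sigma>" using fwd_mono[of "min \<sigma> \<sigma>\<^sub>a" \<sigma>] \<sigma> a \<rho> r_nonneg by auto
      finally show ?thesis .
    qed
    then show ?thesis unfolding slow_def by blast
  qed
  moreover have "bwd B \<sigma>\<^sub>2 \<subseteq> fast B \<rho>" using \<sigma>2 by (auto simp: fast_def)
  ultimately show ?thesis by blast
qed

lemma slow_right_continuous:
  assumes "\<And>\<rho>'. \<rho> < \<rho>' \<Longrightarrow> v \<in> slow \<rho>'"
  shows "v \<in> slow \<rho>"
  unfolding slow_def
proof
  fix \<sigma> assume "\<sigma> \<in> {\<rho><..}"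
  then obtain \<rho>' where "\<rho> < \<rho>'" "\<rho>' < \<sigma>" using dense by blast
  then show "v \<in> fwd \<sigma>" using assms by (auto simp: slow_def)
qed

text \<open>Every vector grows at most like the powers of an operator bound; this supplies the top
  of the filtration.\<close>

lemma mem_slow_if_bounded:
  assumes "\<bar>K\<bar> \<le> \<rho>"
  shows "v \<in> slow \<rho>"
proof -
  have "nrm ((T ^^ m) v) \<le> nrm v * \<rho> ^ m" for m
    using T_pow_le[of m v] mult_right_mono[OF power_mono[OF assms abs_ge_zero, of m] nrm_nonneg[of v]] by (simp add: mult.commute)
  then have "v \<in> fwd \<rho>" by (rule fwdI)
  moreover have "fwd \<rho> \<subseteq> fwd \<sigma>" if "\<rho> < \<sigma>" for \<sigma>
    using that assms by (intro fwd_mono) auto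
  ultimately show ?thesis by (auto simp: slow_def)
qed

end

section \<open>Several commuting operators\<close>

locale twisted_operators = nonarch_vector_space av smul Basis
  for av :: "'f::field_char_0 \<Rightarrow> real" and smul :: "'f \<Rightarrow> 'v::ab_group_add \<Rightarrow> 'v" and Basis +
  fixes d :: "'i::finite \<Rightarrow> 'f \<Rightarrow> 'f" and r :: "'i \<Rightarrow> real"
    and D :: "'i \<Rightarrow> 'v \<Rightarrow> 'v" and K :: "'i \<Rightarrow> real"
  assumes twisted: "twisted_operator av smul Basis (d i) (r i) (D i) (K i)"
    and D_commute: "D i (D j v) = D j (D i v)"
begin

sublocale op: twisted_operator av smul Basis "d i" "r i" "D i" "K i" for i
  by (rule twisted)

lemma diff_submoduleD:
  assumes "diff_submodule smul D W"
  shows "subspace W" "D i ` W \<subseteq> W"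
  using assms by (auto simp: diff_submodule_def)

lemma diff_submodule_inter:
  assumes "diff_submodule smul D A" "diff_submodule smul D B"
  shows "diff_submodule smul D (A \<inter> B)"
  unfolding diff_submodule_def
proof (intro conjI allI image_subsetI)
  show "subspace (A \<inter> B)" by (intro subspace_inter diff_submoduleD(1) assms)
  show "D i x \<in> A \<inter> B" if "x \<in> A \<inter> B" for i x
    using that diff_submoduleD(2)[OF assms(1)] diff_submoduleD(2)[OF assms(2)] by blast
qed

lemma diff_submodule_slow:
  assumes "r i \<le> \<rho>"
  shows "diff_submodule smul D (op.slow i \<rho>)"
  unfolding diff_submodule_def
proof (intro conjI allI op.subspace_slow[OF assms] image_subsetI)
  show "D j v \<in> op.slow i \<rho>" if "v \<in> op.slow i \<rho>" for j v
    by (rule op.commuting_slow[OF D_commute op.T_bounded that])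
qed

lemma diff_submodule_fast:
  assumes "r i \<le> \<rho>" "diff_submodule smul D B"
  shows "diff_submodule smul D (op.fast i B \<rho>)"
  unfolding diff_submodule_def
proof (intro conjI allI image_subsetI)
  show "subspace (op.fast i B \<rho>)"
    by (rule op.subspace_fast[OF assms(1) diff_submoduleD(1)[OF assms(2)]])
  show "D j v \<in> op.fast i B \<rho>" if "v \<in> op.fast i B \<rho>" for j v
    by (rule op.commuting_fast[OF D_commute op.T_bounded diff_submoduleD(2)[OF assms(2)]
          order_trans[OF op.r_nonneg assms(1)] that])
qed

lemma diff_submodule_span:
  assumes "\<And>i. D i ` X \<subseteq> span X"
  shows "diff_submodule smul D (span X)"
  unfolding diff_submodule_def
proof (intro conjI allI subspace_span image_subsetI)
  fix i v assume "v \<in> span X"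
  then show "D i v \<in> span X"
  proof (induction rule: span_induct_alt)
    case base
    then show ?case by (simp add: span_zero)
  next
    case (step c x y)
    have "D i x \<in> span X" using assms step.hyps(1) by blast
    then show ?case unfolding op.T_add op.T_smul
      using step span_base by (intro span_add span_scale) auto
  qed
qed

definition slows :: "'i set \<Rightarrow> ('i \<Rightarrow> real) \<Rightarrow> 'v set" where
  "slows J \<rho> = (\<Inter>i\<in>J. op.slow i (\<rho> i))"

text \<open>The scale is a maximum over the directions: small scale means slow in all of them, so
  the complement must gather the vectors that are fast in some direction.\<close>

definition fasts :: "'i set \<Rightarrow> 'v set \<Rightarrow> ('i \<Rightarrow> real) \<Rightarrow> 'v set" where
  "fasts J B \<rho> = span (\<Union>i\<in>J. op.fast i B (\<rho> i))"

lemma diff_submodule_UNIV: "diff_submodule smul D UNIV"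
  by (simp add: diff_submodule_def)

lemma diff_submodule_slows:
  assumes "\<And>i. r i \<le> \<rho> i"
  shows "diff_submodule smul D (slows J \<rho>)"
  unfolding diff_submodule_def slows_def
proof (intro conjI allI image_subsetI INT_I)
  show "subspace (\<Inter>i\<in>J. op.slow i (\<rho> i))"
    by (intro subspace_Int diff_submoduleD(1)[OF diff_submodule_slow[OF assms]])
  show "D j x \<in> op.slow i (\<rho> i)" if "x \<in> (\<Inter>i\<in>J. op.slow i (\<rho> i))" "i \<in> J" for i j x
    using that diff_submoduleD(2)[OF diff_submodule_slow[OF assms], of j i] by blast
qed

lemma diff_submodule_fasts:
  assumes "\<And>i. r i \<le> \<rho> i" "diff_submodule smul D B"
  shows "diff_submodule smul D (fasts J B \<rho>)"
  unfolding fasts_def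
proof (rule diff_submodule_span, rule image_subsetI)
  fix j x assume "x \<in> (\<Union>i\<in>J. op.fast i B (\<rho> i))"
  then have "D j x \<in> (\<Union>i\<in>J. op.fast i B (\<rho> i))"
    using diff_submoduleD(2)[OF diff_submodule_fast[OF assms]] by blast
  then show "D j x \<in> span (\<Union>i\<in>J. op.fast i B (\<rho> i))" by (rule span_base)
qed

lemma fasts_subset:
  assumes "subspace B"
  shows "fasts J B \<rho> \<subseteq> B"
  unfolding fasts_def using op.fast_subset by (intro span_minimal assms) auto

lemma fasts_mono:
  assumes "\<And>i. r i \<le> \<rho> i" "J \<subseteq> J'" "B \<subseteq> B'"
  shows "fasts J B \<rho> \<subseteq> fasts J' B' \<rho>"
  unfolding fasts_def
proof (rule span_mono, rule UN_mono[OF assms(2)])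
  show "op.fast i B (\<rho> i) \<subseteq> op.fast i B' (\<rho> i)" for i
    using order_trans[OF op.r_nonneg assms(1)] assms(3) by (rule op.fast_mono)
qed

text \<open>One direction at a time: by commutation the part of \<open>B\<close> that is slow along
  \<open>j\<close> is again a differential submodule, to be split along the rest. The induction
  therefore ranges over all \<open>B\<close>.\<close>

lemma slows_fasts_splitting:
  assumes \<rho>: "\<And>i. r i \<le> \<rho> i" and B: "diff_submodule smul D B" and v: "v \<in> B"
  shows "\<exists>x\<in>B \<inter> slows J \<rho>. \<exists>y\<in>fasts J B \<rho>. v = x + y"
  using finite[of J] B v
proof (induction J arbitrary: B v)
  case empty
  then show ?case by (auto simp: slows_def fasts_def)
next
  case (insert j J)
  note sub = diff_submoduleD[OF insert.prems(1)]
  obtain x y where xy: "x \<in> B" "x \<in> op.slow j (\<rho> j)" "y \<in> op.fast j B (\<rho> j)" "v = x + y"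
    using op.slow_fast_splitting[OF \<rho> sub insert.prems(2)] by blast
  have "diff_submodule smul D (B \<inter> op.slow j (\<rho> j))"
    by (rule diff_submodule_inter[OF insert.prems(1) diff_submodule_slow[OF \<rho>]])
  from insert.IH[OF this, of x] xy obtain x' y' where x'y':
    "x' \<in> B" "x' \<in> op.slow j (\<rho> j)" "x' \<in> slows J \<rho>" "y' \<in> fasts J (B \<inter> op.slow j (\<rho> j)) \<rho>" "x = x' + y'"
    by blast
  have "y' \<in> fasts (insert j J) B \<rho>"
    using x'y'(4) fasts_mono[OF \<rho> subset_insertI Int_lower1] by blast
  moreover have "y \<in> fasts (insert j J) B \<rho>" using xy(3) unfolding fasts_def by (intro span_base) simp
  ultimately have "y' + y \<in> fasts (insert j J) B \<rho>" unfolding fasts_def by (intro span_add)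
  moreover have "x' \<in> slows (insert j J) \<rho>" using x'y' by (simp add: slows_def)
  moreover have "v = x' + (y' + y)" using x'y' xy by (simp add: add.assoc)
  ultimately show ?case using x'y'(1) by blast
qed

text \<open>Write \<open>x = g + h\<close> with \<open>g\<close> fast along \<open>j\<close> and
  \<open>h\<close> fast in the other directions, and split \<open>h = a + b\<close> along
  \<open>j\<close> inside the latter submodule. Then \<open>x - a\<close> is both slow and fast
  along \<open>j\<close>, so \<open>x = a\<close> and the induction applies.\<close>

lemma slows_fasts_disjoint:
  assumes \<rho>: "\<And>i. r i \<le> \<rho> i" and x: "x \<in> slows J \<rho>" "x \<in> fasts J UNIV \<rho>"
  shows "x = 0"
  using finite[of J] x
proof (induction J)
  case empty
  then show ?case by (simp add: fasts_def)
next
  case (insert j J)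
  let ?F = "op.fast j UNIV (\<rho> j)"
  have F: "subspace ?F" by (rule op.subspace_fast[OF \<rho> subspace_UNIV])
  have "x \<in> span (?F \<union> (\<Union>i\<in>J. op.fast i UNIV (\<rho> i)))" using insert.prems(2) by (simp add: fasts_def)
  then obtain g h where gh: "x = g + h" "g \<in> ?F" "h \<in> fasts J UNIV \<rho>"
    using F by (auto simp: span_Un fasts_def span_eq_iff[THEN iffD2, OF F])
  note H = diff_submoduleD[OF diff_submodule_fasts[OF \<rho> diff_submodule_UNIV, of J]]
  obtain a b where ab: "a \<in> fasts J UNIV \<rho>" "a \<in> op.slow j (\<rho> j)" "b \<in> op.fast j (fasts J UNIV \<rho>) (\<rho> j)" "h = a + b"
    using op.slow_fast_splitting[OF \<rho> H gh(3)] by blast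
  have "b \<in> ?F" using ab(3) op.fast_mono[of "\<rho> j" _ UNIV j] order_trans[OF op.r_nonneg \<rho>] by blast
  then have "g + b \<in> ?F" using gh(2) F by (intro subspace_add)
  moreover have "x - a = g + b" using gh ab by simp
  moreover have "x \<in> op.slow j (\<rho> j)" using insert.prems(1) by (simp add: slows_def)
  then have "x - a \<in> op.slow j (\<rho> j)" using ab(2) op.subspace_slow[OF \<rho>] by (intro subspace_diff)
  ultimately have "x - a = 0" using op.slow_fast_disjoint[OF \<rho>, of "x - a" j UNIV] by simp
  then have "x \<in> fasts J UNIV \<rho>" using ab(1) by simp
  moreover have "x \<in> slows J \<rho>" using insert.prems(1) by (simp add: slows_def)
  ultimately show ?case using insert.IH by blast
qed

end

section \<open>Spectral norms of subquotients\<close>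

context nonarch_vector_space
begin

abbreviation (input) quot_norm :: "'v set \<Rightarrow> 'v set \<Rightarrow> 'v \<Rightarrow> real" where
  "quot_norm A X \<equiv> sup_norm av smul A X"

lemma representation_lincomb:
  assumes Z: "independent Z" and X: "finite X" "X \<subseteq> Z" and x: "x \<in> X"
  shows "representation Z (\<Sum>y\<in>X. smul (u y) y) x = u x"
proof -
  have sp: "y \<in> span Z" if "y \<in> X" for y using that X(2) span_base by blast
  have "representation Z (\<Sum>y\<in>X. smul (u y) y) x = (\<Sum>y\<in>X. representation Z (smul (u y) y) x)"
    by (subst representation_sum[OF Z]) (use sp span_scale in auto)
  also have "\<dots> = (\<Sum>y\<in>X. if y = x then u y else 0)"
  proof (rule sum.cong[OF refl])
    fix y assume "y \<in> X"
    then show "representation Z (smul (u y) y) x = (if y = x then u y else 0)"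
      using X(2) sp representation_scale[OF Z, of y "u y"] representation_basis[OF Z, of y] by auto
  qed
  finally show ?thesis using x X(1) by simp
qed

text \<open>The vectors completing a basis of \<open>A\<close> to one of \<open>B\<close> represent
  a basis of the quotient.\<close>

lemma quot_basis_exists:
  assumes A: "subspace A" and B: "subspace B" and AB: "A \<subseteq> B"
  shows "\<exists>X. quot_basis smul A B X"
proof -
  obtain X\<^sub>A where XA: "finite X\<^sub>A" "X\<^sub>A \<subseteq> A" "independent X\<^sub>A" "span X\<^sub>A = A" using subspace_basis[OF A] .
  obtain Y where Y: "X\<^sub>A \<subseteq> Y" "Y \<subseteq> B" "independent Y" "B \<subseteq> span Y"
    using maximal_independent_subset_extend[of X\<^sub>A B] XA AB by blast
  have finY: "finite Y" using Y(3) finiteI_independent by blast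
  define X where "X = Y - X\<^sub>A"
  have "\<exists>!c. is_coords smul A X v c" if v: "v \<in> B" for v
  proof (rule ex_ex1I)
    have "v = (\<Sum>y\<in>Y. smul (representation Y v y) y)"
      using sum_representation_eq[OF Y(3) _ finY order_refl, of v] v Y(4) by auto
    also have "\<dots> = (\<Sum>x\<in>X. smul (representation Y v x) x) + (\<Sum>x\<in>X\<^sub>A. smul (representation Y v x) x)"
      unfolding X_def using sum.subset_diff[OF Y(1) finY] .
    finally have "v - (\<Sum>x\<in>X. smul (representation Y v x) x) = (\<Sum>x\<in>X\<^sub>A. smul (representation Y v x) x)"
      by (simp add: diff_eq_eq add.commute)
    also have "\<dots> \<in> A"
      using XA(2) A by (intro subspace_sum subspace_scale) auto
    finally show "\<exists>c. is_coords smul A X v c"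
      by (intro exI[of _ "\<lambda>x. if x \<in> X then representation Y v x else 0"]) (simp add: is_coords_def)
    fix c c' assume c: "is_coords smul A X v c" and c': "is_coords smul A X v c'"
    define e where "e x = c x - c' x" for x
    have "(v - (\<Sum>x\<in>X. smul (c' x) x)) - (v - (\<Sum>x\<in>X. smul (c x) x)) \<in> A"
      by (rule subspace_diff[OF A]) (use c c' in \<open>simp_all add: is_coords_def\<close>)
    then have "(\<Sum>x\<in>X. smul (e x) x) \<in> span X\<^sub>A"
      by (simp add: XA(4) e_def scale_left_diff_distrib sum_subtractf)
    moreover have "e x = representation Y (\<Sum>x\<in>X. smul (e x) x) x" if "x \<in> X" for x
      by (rule representation_lincomb[OF Y(3), symmetric]) (use that finY in \<open>auto simp: X_def\<close>)
    ultimately have "e x = 0" if "x \<in> X" for x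
      using that representation_extend[OF Y(3) _ Y(1)] representation_ne_zero[of X\<^sub>A _ x]
      by (metis DiffE X_def)
    then have "c x = c' x" for x
      using c c' by (cases "x \<in> X") (auto simp: e_def is_coords_def)
    then show "c = c'" by blast
  qed
  then have "quot_basis smul A B X" using finY Y(2) by (auto simp: quot_basis_def X_def)
  then show ?thesis by blast
qed

context
  fixes A B X assumes A: "subspace A" and B: "subspace B" and AB: "A \<subseteq> B" and X: "quot_basis smul A B X"
begin

definition coords :: "'v \<Rightarrow> 'v \<Rightarrow> 'f" where
  "coords v = (THE c. is_coords smul A X v c)"

lemma finite_X: "finite X" and X_subset: "X \<subseteq> B"
  using X by (auto simp: quot_basis_def)

lemma ex1_coords: "v \<in> B \<Longrightarrow> \<exists>!c. is_coords smul A X v c"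
  using X by (simp add: quot_basis_def)

lemma is_coords_coords: "v \<in> B \<Longrightarrow> is_coords smul A X v (coords v)"
  unfolding coords_def by (rule theI'[OF ex1_coords])

lemma coords_eqI: "v \<in> B \<Longrightarrow> is_coords smul A X v c \<Longrightarrow> coords v = c"
  unfolding coords_def by (rule the1_equality[OF ex1_coords])

lemma quot_norm_eq: "quot_norm A X v = Max (insert 0 ((\<lambda>x. av (coords v x)) ` X))"
  by (simp add: sup_norm_def coords_def)

lemma av_coords_le: "x \<in> X \<Longrightarrow> av (coords v x) \<le> quot_norm A X v"
  unfolding quot_norm_eq using finite_X by (intro Max_ge) auto

lemma quot_norm_nonneg: "0 \<le> quot_norm A X v"
  unfolding quot_norm_eq using finite_X by (intro Max_ge) auto

lemma quot_norm_le: "0 \<le> M \<Longrightarrow> (\<And>x. x \<in> X \<Longrightarrow> av (coords v x) \<le> M) \<Longrightarrow> quot_norm A X v \<le> M"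
  unfolding quot_norm_eq using finite_X by (subst Max_le_iff) auto

lemma quot_norm_cong:
  assumes "v \<in> B" "w \<in> B" "v - w \<in> A"
  shows "quot_norm A X v = quot_norm A X w"
proof -
  have "(v - (\<Sum>x\<in>X. smul (coords v x) x)) - (v - w) \<in> A"
    by (rule subspace_diff[OF A _ assms(3)]) (use is_coords_coords[OF assms(1)] in \<open>simp add: is_coords_def\<close>)
  then have "is_coords smul A X w (coords v)"
    using is_coords_coords[OF assms(1)] by (simp add: is_coords_def)
  then have "coords w = coords v" by (rule coords_eqI[OF assms(2)])
  then show ?thesis by (simp add: quot_norm_eq)
qed

lemma quot_norm_eq_0:
  assumes "v \<in> B" "quot_norm A X v = 0"
  shows "v \<in> A"
proof -
  have "coords v x = 0" if "x \<in> X" for x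
    using av_coords_le[OF that, of v] av_nonneg[of "coords v x"] av_eq_0_iff[of "coords v x"] assms(2) by simp
  then show ?thesis using is_coords_coords[OF assms(1)] by (simp add: is_coords_def)
qed

text \<open>Together with a basis of \<open>A\<close>, the representatives form an independent set,
  and quotient coordinates are among its coordinates; \<open>coord_bound\<close> applies.\<close>

lemma quot_norm_le_nrm: "\<exists>C\<ge>0. \<forall>v\<in>B. quot_norm A X v \<le> C * nrm v"
proof -
  obtain X\<^sub>A where XA: "finite X\<^sub>A" "X\<^sub>A \<subseteq> A" "independent X\<^sub>A" "span X\<^sub>A = A" using subspace_basis[OF A] .
  have zero: "c = (\<lambda>_. 0)" if "is_coords smul A X 0 c" for c
    using coords_eqI[OF subspace_0[OF B] that] coords_eqI[of 0 "\<lambda>_. 0"] subspace_0[OF A] subspace_0[OF B]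
    by (simp add: is_coords_def)
  have coeff0: "u x = 0" if u: "(\<Sum>x\<in>X. smul (u x) x) \<in> A" and x: "x \<in> X" for u x
  proof -
    have "- (\<Sum>x\<in>X. smul (u x) x) \<in> A" using u A by (intro subspace_neg)
    then have "is_coords smul A X 0 (\<lambda>x. if x \<in> X then u x else 0)" by (simp add: is_coords_def)
    from fun_cong[OF zero[OF this], of x] show ?thesis using x by simp
  qed
  have disj: "X \<inter> X\<^sub>A = {}"
  proof (rule ccontr)
    assume "X \<inter> X\<^sub>A \<noteq> {}"
    then obtain x where x: "x \<in> X" "x \<in> A" using XA by blast
    have "(\<Sum>y\<in>X. smul (if y = x then 1 else 0) y) = x"
      by (subst sum.mono_neutral_right[of _ "{x}"]) (use x finite_X in auto)
    then show False using coeff0[of "\<lambda>y. if y = x then 1 else 0" x] x by simp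
  qed
  define Z where "Z = X \<union> X\<^sub>A"
  have finZ: "finite Z" using finite_X XA by (simp add: Z_def)
  have Z: "independent Z"
  proof (rule independent_if_scalars_zero[OF finZ])
    fix u z assume u: "(\<Sum>x\<in>Z. smul (u x) x) = 0" and z: "z \<in> Z"
    have split: "(\<Sum>x\<in>Z. smul (u x) x) = (\<Sum>x\<in>X. smul (u x) x) + (\<Sum>x\<in>X\<^sub>A. smul (u x) x)"
      unfolding Z_def by (rule sum.union_disjoint[OF finite_X XA(1) disj])
    have "(\<Sum>x\<in>X\<^sub>A. smul (u x) x) \<in> A" using XA(2) A by (intro subspace_sum subspace_scale) auto
    then have "- (\<Sum>x\<in>X\<^sub>A. smul (u x) x) \<in> A" using A by (intro subspace_neg)
    then have "(\<Sum>x\<in>X. smul (u x) x) \<in> A" using u split by (metis add_eq_0_iff2)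
    then have uX: "u x = 0" if "x \<in> X" for x using coeff0 that by blast
    then have "(\<Sum>x\<in>X\<^sub>A. smul (u x) x) = 0" using u split by simp
    then have "u x = 0" if "x \<in> X\<^sub>A" for x
      using independentD[OF XA(3) XA(1) order_refl] that by blast
    then show "u z = 0" using uX z by (auto simp: Z_def)
  qed
  obtain C where C: "C \<ge> 0" "\<And>v x. v \<in> span Z \<Longrightarrow> x \<in> Z \<Longrightarrow> av (representation Z v x) \<le> C * nrm v"
    using coord_bound[OF Z] by blast
  have "quot_norm A X v \<le> C * nrm v" if v: "v \<in> B" for v
  proof (rule quot_norm_le)
    fix x assume x: "x \<in> X"
    let ?s = "\<Sum>x\<in>X. smul (coords v x) x"
    have a: "v - ?s \<in> span X\<^sub>A" using is_coords_coords[OF v] by (simp add: is_coords_def XA(4))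
    have sZ: "?s \<in> span Z" by (intro span_sum span_scale span_base) (simp add: Z_def)
    have aZ: "v - ?s \<in> span Z" using a span_mono[of X\<^sub>A Z] by (auto simp: Z_def)
    then have vZ: "v \<in> span Z" using span_add[OF aZ sZ] by simp
    have "representation Z (v - ?s) x = 0"
      using representation_extend[OF Z a] representation_ne_zero[of X\<^sub>A "v - ?s" x] disj x by (auto simp: Z_def)
    moreover have "representation Z ?s x = coords v x"
      by (rule representation_lincomb[OF Z finite_X _ x]) (simp add: Z_def)
    ultimately have "representation Z v x = coords v x"
      using representation_add[OF Z aZ sZ] by simp
    then show "av (coords v x) \<le> C * nrm v" using C(2)[OF vZ, of x] x by (simp add: Z_def)
  qed (use C nrm_nonneg in simp)
  then show ?thesis using C(1) by blast
qed

lemma diff_lift_mem: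
  assumes v: "v \<in> B" and p: "\<And>x. x \<in> X \<Longrightarrow> x - p x \<in> A"
  shows "v - (\<Sum>x\<in>X. smul (coords v x) (p x)) \<in> A"
proof -
  have "(\<Sum>x\<in>X. smul (coords v x) (x - p x)) \<in> A" using p A by (intro subspace_sum subspace_scale) auto
  then have "(v - (\<Sum>x\<in>X. smul (coords v x) x)) + (\<Sum>x\<in>X. smul (coords v x) (x - p x)) \<in> A"
    using is_coords_coords[OF v] A by (intro subspace_add) (auto simp: is_coords_def)
  then show ?thesis by (simp add: scale_right_diff_distrib sum_subtractf)
qed

end

end

section \<open>Growth rates and spectral norms of quotients\<close>

context twisted_operator
begin

context
  fixes A B X assumes A: "subspace A" "T ` A \<subseteq> A" and B: "subspace B" "T ` B \<subseteq> B" and AB: "A \<subseteq> B"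
    and X: "quot_basis smul A B X"
begin

lemmas quot = A(1) B(1) AB X

lemma T_pow_diff: "(T ^^ m) (v - w) = (T ^^ m) v - (T ^^ m) w"
  by (induction m) (simp_all add: T_diff)

text \<open>Lifting a basis of the quotient into \<open>B\<close> bounds \<open>T\<^sup>m\<close> on the quotient by its size on multiples of
  the lifts.\<close>

lemma quot_norm_T_pow_le:
  assumes p: "\<And>x. x \<in> X \<Longrightarrow> p x \<in> B \<and> x - p x \<in> A"
    and bound: "\<And>x f m. x \<in> X \<Longrightarrow> nrm ((T ^^ m) (smul f (p x))) \<le> C * av f * s m"
    and C: "0 \<le> C" and s: "\<And>m. 0 \<le> s m"
  shows "\<exists>C'\<ge>0. \<forall>m. \<forall>v\<in>B. quot_norm A X ((T ^^ m) v) \<le> C' * s m * quot_norm A X v"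
proof -
  obtain C\<^sub>1 where C1: "0 \<le> C\<^sub>1" "\<And>v. v \<in> B \<Longrightarrow> quot_norm A X v \<le> C\<^sub>1 * nrm v"
    using quot_norm_le_nrm[OF quot] by blast
  have "quot_norm A X ((T ^^ m) v) \<le> (C\<^sub>1 * C) * s m * quot_norm A X v" if v: "v \<in> B" for m v
  proof -
    define w where "w = (\<Sum>x\<in>X. smul (coords A X v x) (p x))"
    have w: "w \<in> B" unfolding w_def using p B by (intro subspace_sum subspace_scale) auto
    have "v - w \<in> A" unfolding w_def using p by (intro diff_lift_mem[OF quot v]) auto
    then have "(T ^^ m) v - (T ^^ m) w \<in> A" using T_pow_mem[OF A(2)] by (simp flip: T_pow_diff)
    then have "quot_norm A X ((T ^^ m) v) = quot_norm A X ((T ^^ m) w)"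
      using T_pow_mem[OF B(2)] v w by (intro quot_norm_cong[OF quot])
    also have "\<dots> \<le> C\<^sub>1 * nrm ((T ^^ m) w)" using C1(2) T_pow_mem[OF B(2) w] by blast
    also have "nrm ((T ^^ m) w) \<le> C * quot_norm A X v * s m"
      unfolding w_def T_pow_sum
    proof (rule nrm_sum_le)
      fix x assume x: "x \<in> X"
      show "nrm ((T ^^ m) (smul (coords A X v x) (p x))) \<le> C * quot_norm A X v * s m"
        using av_coords_le[OF quot x] C s
        by (intro order_trans[OF bound[OF x]] mult_right_mono mult_left_mono)
    qed (use C s quot_norm_nonneg[OF quot] in auto)
    then have "C\<^sub>1 * nrm ((T ^^ m) w) \<le> C\<^sub>1 * (C * quot_norm A X v * s m)" using C1(1) by (rule mult_left_mono)
    finally show ?thesis by (simp add: ac_simps)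
  qed
  then show ?thesis using C1 C by (intro exI[of _ "C\<^sub>1 * C"]) auto
qed

lemma bounded_endo_quot: "\<exists>K'. bounded_endo (quot_norm A X) B T K'"
proof -
  define M where "M = (\<Sum>x\<in>X. nrm x)"
  have fX: "finite X" using finite_X[OF quot] .
  have "\<exists>C'\<ge>0. \<forall>m. \<forall>v\<in>B. quot_norm A X ((T ^^ m) v) \<le> C' * (\<lambda>m. \<bar>K\<bar> ^ m) m * quot_norm A X v"
  proof (rule quot_norm_T_pow_le[of id M])
    show "id x \<in> B \<and> x - id x \<in> A" if "x \<in> X" for x
      using that X_subset[OF quot] subspace_0[OF A(1)] by auto
    show "0 \<le> M" unfolding M_def by (intro sum_nonneg nrm_nonneg)
    fix x f m assume x: "x \<in> X"
    have "nrm x \<le> M" unfolding M_def using x fX nrm_nonneg by (intro member_le_sum) auto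
    then have "\<bar>K\<bar> ^ m * (av f * nrm x) \<le> \<bar>K\<bar> ^ m * (av f * M)"
      using av_nonneg by (intro mult_left_mono) auto
    then show "nrm ((T ^^ m) (smul f (id x))) \<le> M * av f * \<bar>K\<bar> ^ m"
      using T_pow_le[of m "smul f x"] by (simp add: nrm_smul ac_simps)
  qed simp
  then obtain C' where C': "0 \<le> C'" "\<And>v. v \<in> B \<Longrightarrow> quot_norm A X ((T ^^ 1) v) \<le> C' * \<bar>K\<bar> ^ 1 * quot_norm A X v"
    by blast
  have "bounded_endo (quot_norm A X) B T (C' * \<bar>K\<bar>)"
    using C' quot_norm_nonneg[OF quot] subspace_0[OF B(1)] B(2)
    by unfold_locales auto
  then show ?thesis by blast
qed

text \<open>For each \<open>\<sigma> > \<rho>\<close> the basis of the quotient has representatives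
  in \<open>fwd \<sigma>\<close>, where scalar multiples are controlled uniformly. The constant
  depends on \<open>\<sigma>\<close>, but the spectral norm ignores it.\<close>

lemma quot_spectral_le:
  assumes \<rho>: "r \<le> \<rho>" and sl: "\<And>v. v \<in> B \<Longrightarrow> \<exists>a\<in>A. v - a \<in> slow \<rho>"
  shows "spectral_norm (quot_norm A X) B T \<le> \<rho>"
proof (rule dense_ge)
  fix \<sigma> assume \<sigma>: "\<rho> < \<sigma>"
  have \<sigma>0: "0 \<le> \<sigma>" "r \<le> \<sigma>" using \<sigma> \<rho> r_nonneg by auto
  have fX: "finite X" and XB: "X \<subseteq> B" using finite_X[OF quot] X_subset[OF quot] .
  obtain K' where "bounded_endo (quot_norm A X) B T K'" using bounded_endo_quot by blast
  then interpret q: bounded_endo "quot_norm A X" B T K' .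
  have "\<forall>x\<in>X. \<exists>a\<in>A. x - a \<in> fwd \<sigma>" using sl XB \<sigma> by (force simp: slow_def)
  then obtain a where a: "\<And>x. x \<in> X \<Longrightarrow> a x \<in> A" "\<And>x. x \<in> X \<Longrightarrow> x - a x \<in> fwd \<sigma>" by metis
  have "\<forall>x\<in>X. \<exists>C\<ge>0. \<forall>f m. nrm ((T ^^ m) (smul f (x - a x))) \<le> C * av f * \<sigma> ^ m"
    using fwd_uniform[OF a(2) \<sigma>0(2)] by blast
  then obtain c where c: "\<And>x. x \<in> X \<Longrightarrow> 0 \<le> c x"
      "\<And>x f m. x \<in> X \<Longrightarrow> nrm ((T ^^ m) (smul f (x - a x))) \<le> c x * av f * \<sigma> ^ m"
    by metis
  have "\<exists>C'\<ge>0. \<forall>m. \<forall>v\<in>B. quot_norm A X ((T ^^ m) v) \<le> C' * (\<lambda>m. \<sigma> ^ m) m * quot_norm A X v"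
  proof (rule quot_norm_T_pow_le[of "\<lambda>x. x - a x" "sum c X"])
    show "x - a x \<in> B \<and> x - (x - a x) \<in> A" if "x \<in> X" for x
      using that XB a(1)[OF that] AB B(1) by (auto intro: subspace_diff)
    show "0 \<le> sum c X" using c by (intro sum_nonneg)
    fix x f m assume x: "x \<in> X"
    have "c x \<le> sum c X" using x c fX by (intro member_le_sum) auto
    then have "c x * av f * \<sigma> ^ m \<le> sum c X * av f * \<sigma> ^ m"
      using \<sigma>0 av_nonneg by (intro mult_right_mono) auto
    then show "nrm ((T ^^ m) (smul f (x - a x))) \<le> sum c X * av f * \<sigma> ^ m" using c(2)[OF x, of m f] by linarith
  qed (use \<sigma>0 in auto)
  then obtain C' where "\<And>m v. v \<in> B \<Longrightarrow> quot_norm A X ((T ^^ m) v) \<le> C' * \<sigma> ^ m * quot_norm A X v" by blast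
  then show "spectral_norm (quot_norm A X) B T \<le> \<sigma>" using \<sigma>0 by (intro q.spectral_norm_le)
qed

text \<open>\<open>T ^^ m\<close> carries \<open>z m\<close>, of size O(\<sigma>^-m), to the fixed
  nonzero class of \<open>b\<close>, which forces its operator norm to be at least a constant times
  \<open>\<sigma> ^ m\<close>.\<close>

lemma quot_spectral_gt:
  assumes \<rho>: "r \<le> \<rho>" and b: "b \<in> fast B \<rho>" "b \<notin> A"
  shows "\<rho> < spectral_norm (quot_norm A X) B T"
proof -
  obtain K' where "bounded_endo (quot_norm A X) B T K'" using bounded_endo_quot by blast
  then interpret q: bounded_endo "quot_norm A X" B T K' .
  obtain \<sigma> where \<sigma>: "\<rho> < \<sigma>" "b \<in> bwd B \<sigma>" using b(1) by (auto simp: fast_def)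
  have \<sigma>0: "0 < \<sigma>" using \<sigma> \<rho> r_nonneg by auto
  obtain z C where z: "backward_orbit B \<sigma> C z" "z 0 = b" "0 \<le> C" using \<sigma>(2) by (rule bwdE) blast
  have bB: "b \<in> B" using b(1) fast_subset by blast
  have Nb: "0 < quot_norm A X b"
    using quot_norm_eq_0[OF quot bB] quot_norm_nonneg[OF quot, of b] b(2) by force
  obtain C\<^sub>1 where C1: "0 \<le> C\<^sub>1" "\<And>v. v \<in> B \<Longrightarrow> quot_norm A X v \<le> C\<^sub>1 * nrm v"
    using quot_norm_le_nrm[OF quot] by blast
  \<comment> \<open>The summand 1 only secures positivity for division.\<close>
  define E where "E = C\<^sub>1 * C + 1"
  have E: "0 < E" using C1 z(3) by (simp add: E_def add_nonneg_pos)
  have "quot_norm A X b / E * \<sigma> ^ m \<le> op_norm (quot_norm A X) B (T ^^ m)" for m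
  proof -
    have zB: "z m \<in> B" using backward_orbitD(1)[OF z(1)] .
    have "quot_norm A X (z m) \<le> E / \<sigma> ^ m"
    proof -
      have "quot_norm A X (z m) \<le> C\<^sub>1 * (C / \<sigma> ^ m)"
        using backward_orbitD(3)[OF z(1), of m] \<sigma>0 C1
        by (intro order_trans[OF C1(2)[OF zB]] mult_left_mono) (auto simp: pos_le_divide_eq)
      also have "\<dots> \<le> E / \<sigma> ^ m" using \<sigma>0 by (simp add: E_def divide_right_mono)
      finally show ?thesis .
    qed
    moreover have "quot_norm A X b \<le> op_norm (quot_norm A X) B (T ^^ m) * quot_norm A X (z m)"
      using bounded_endo.le_op_norm[OF q.bounded_endo_funpow zB, of m] backward_orbit_pow[OF z(1), of m] z(2) by simp
    ultimately have "quot_norm A X b \<le> op_norm (quot_norm A X) B (T ^^ m) * (E / \<sigma> ^ m)"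
      using bounded_endo.op_norm_nonneg[OF q.bounded_endo_funpow, of m]
      by (elim order_trans) (rule mult_left_mono)
    then show ?thesis using E \<sigma>0 by (simp add: field_simps)
  qed
  then have "\<sigma> \<le> spectral_norm (quot_norm A X) B T"
    using Nb E \<sigma>0 by (intro q.spectral_norm_ge[of "quot_norm A X b / E"]) auto
  then show ?thesis using \<sigma>(1) by linarith
qed

end

text \<open>The estimates hold for any basis of the quotient, in particular for the one selected by
  \<open>SOME\<close>. The lower one is used contrapositively: a small spectral norm kills the fast
  vectors of \<open>B\<close> modulo \<open>A\<close>.\<close>

lemma quot_spectral_norm_bounds:
  assumes "r \<le> \<rho>" "subspace A" "T ` A \<subseteq> A" "subspace B" "T ` B \<subseteq> B" "A \<subseteq> B"
  shows "(\<And>v. v \<in> B \<Longrightarrow> \<exists>a\<in>A. v - a \<in> slow \<rho>) \<Longrightarrow> quot_spectral_norm av smul A B T \<le> \<rho>"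
    and "quot_spectral_norm av smul A B T \<le> \<rho> \<Longrightarrow> fast B \<rho> \<subseteq> A"
proof -
  have X: "quot_basis smul A B (SOME X. quot_basis smul A B X)"
    by (rule someI_ex[OF quot_basis_exists[OF assms(2,4,6)]])
  show "quot_spectral_norm av smul A B T \<le> \<rho>" if "\<And>v. v \<in> B \<Longrightarrow> \<exists>a\<in>A. v - a \<in> slow \<rho>"
    unfolding quot_spectral_norm_def using that by (rule quot_spectral_le[OF assms(2-6) X assms(1)])
  show "fast B \<rho> \<subseteq> A" if "quot_spectral_norm av smul A B T \<le> \<rho>"
    using quot_spectral_gt[OF assms(2-6) X assms(1)] that unfolding quot_spectral_norm_def by force
qed

end

section \<open>From a filtration by scale to the decomposition\<close>

lemma irreducible_quotD:
  assumes "irreducible_quot smul D A B"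
  shows "diff_submodule smul D A" "diff_submodule smul D B" "A \<subset> B"
    "\<And>C. diff_submodule smul D C \<Longrightarrow> A \<subseteq> C \<Longrightarrow> C \<subseteq> B \<Longrightarrow> C = A \<or> C = B"
  using assms unfolding irreducible_quot_def by blast+

lemma composition_series_mono:
  assumes "composition_series smul D W Ws" "i \<le> j" "j < length Ws"
  shows "Ws ! i \<subseteq> Ws ! j"
  using assms(2,3)
proof (induction j)
  case (Suc j)
  have "irreducible_quot smul D (Ws ! j) (Ws ! Suc j)"
    using assms(1) Suc.prems by (simp add: composition_series_def)
  then have "Ws ! j \<subset> Ws ! Suc j" by (rule irreducible_quotD(3))
  then show ?case using Suc by (cases "i = Suc j") auto
qed simp

lemma JH_factorD:
  assumes "JH_factor smul D W A B"
  shows "irreducible_quot smul D A B" "B \<subseteq> W"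
proof -
  obtain Ws k where Ws: "composition_series smul D W Ws" "Suc k < length Ws" "A = Ws ! k" "B = Ws ! Suc k"
    using assms by (auto simp: JH_factor_def)
  then show "irreducible_quot smul D A B" by (simp add: composition_series_def)
  have "Ws ! Suc k \<subseteq> Ws ! (length Ws - 1)" using Ws by (intro composition_series_mono[OF Ws(1)]) auto
  moreover have "W = Ws ! (length Ws - 1)"
    using Ws(1) by (auto simp: composition_series_def last_conv_nth)
  ultimately show "B \<subseteq> W" using Ws(4) by simp
qed

section \<open>Composition series\<close>

context finite_dimensional_vector_space
begin

text \<open>A submodule of least dimension strictly above \<open>A\<close> gives an irreducible
  first step; the codimension then drops.\<close>

lemma diff_submodule_chain:
  assumes "diff_submodule scale D A" "diff_submodule scale D B" "A \<subseteq> B"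
  shows "\<exists>Ws. Ws \<noteq> [] \<and> hd Ws = A \<and> last Ws = B \<and>
    (\<forall>k. Suc k < length Ws \<longrightarrow> irreducible_quot scale D (Ws ! k) (Ws ! Suc k))"
  using assms
proof (induction "dim B - dim A" arbitrary: A rule: less_induct)
  case less
  show ?case
  proof (cases "A = B")
    case True
    then show ?thesis by (intro exI[of _ "[A]"]) simp
  next
    case False
    then have "A \<subset> B" using less.prems by blast
    then obtain C where C: "diff_submodule scale D C" "A \<subset> C" "C \<subseteq> B"
      and C_min: "\<And>C'. diff_submodule scale D C' \<Longrightarrow> A \<subset> C' \<Longrightarrow> C' \<subseteq> B \<Longrightarrow> dim C \<le> dim C'"
      using ex_has_least_nat[of "\<lambda>C. diff_submodule scale D C \<and> A \<subset> C \<and> C \<subseteq> B" B dim] less.prems(2)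
      by blast
    have sub: "subspace W" if "diff_submodule scale D W" for W using that by (simp add: diff_submodule_def)
    have AC: "irreducible_quot scale D A C"
      unfolding irreducible_quot_def
    proof (intro conjI allI impI less.prems C)
      fix C' assume C': "diff_submodule scale D C' \<and> A \<subseteq> C' \<and> C' \<subseteq> C"
      show "C' = A \<or> C' = C"
      proof (cases "C' = A")
        case False
        then have "dim C \<le> dim C'" using C' C by (intro C_min) auto
        then have "C' = C" using C' C sub by (intro subspace_dim_equal) auto
        then show ?thesis ..
      qed simp
    qed
    have "dim A < dim C"
      using C subspace_dim_equal[of A C] sub less.prems(1) by (metis leI order_less_imp_le psubset_eq)
    moreover have "dim C \<le> dim B" using C(3) by (rule dim_subset)
    ultimately have "dim B - dim C < dim B - dim A" by simp
    from less.hyps[OF this C(1) less.prems(2) C(3)] obtain Ws where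
      Ws: "Ws \<noteq> []" "hd Ws = C" "last Ws = B"
        "\<And>k. Suc k < length Ws \<Longrightarrow> irreducible_quot scale D (Ws ! k) (Ws ! Suc k)" by blast
    have "irreducible_quot scale D ((A # Ws) ! k) ((A # Ws) ! Suc k)" if "Suc k < length (A # Ws)" for k
      using that Ws AC by (cases k) (auto simp: hd_conv_nth)
    then show ?thesis using Ws by (intro exI[of _ "A # Ws"]) auto
  qed
qed

text \<open>Climbs a composition series of \<open>W\<close>, so that information on the factors
  becomes information on \<open>W\<close>.\<close>

lemma JH_induct:
  assumes W: "diff_submodule scale D W" and 0: "diff_submodule scale D {0}" "R {0}"
    and step: "\<And>A B. JH_factor scale D W A B \<Longrightarrow> irreducible_quot scale D A B \<Longrightarrow> R A \<Longrightarrow> R B"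
  shows "R W"
proof -
  have "{0} \<subseteq> W" using W subspace_0 by (auto simp: diff_submodule_def)
  from diff_submodule_chain[OF 0(1) W this] obtain Ws where Ws: "composition_series scale D W Ws"
    unfolding composition_series_def by blast
  have "R (Ws ! k)" if "k < length Ws" for k
    using that
  proof (induction k)
    case 0
    then show ?case using Ws \<open>R {0}\<close> by (metis composition_series_def hd_conv_nth)
  next
    case (Suc k)
    then have "JH_factor scale D W (Ws ! k) (Ws ! Suc k)" using Ws by (auto simp: JH_factor_def)
    then show ?case using step JH_factorD(1) Suc by (metis Suc_lessD)
  qed
  from this[of "length Ws - 1"] show ?thesis
    using Ws by (auto simp: composition_series_def last_conv_nth)
qed

end

text \<open>\<open>P t\<close> and \<open>Q t\<close> are the parts of scale \<open>\<le> t\<close> and \<open>> t\<close>.\<close>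

locale scale_filtration = finite_dimensional_vector_space smul Basis
  for smul :: "'f::field \<Rightarrow> 'v::ab_group_add \<Rightarrow> 'v" and Basis +
  fixes av :: "'f \<Rightarrow> real" and d :: "'i::finite \<Rightarrow> 'f \<Rightarrow> 'f" and D :: "'i \<Rightarrow> 'v \<Rightarrow> 'v" and s0 :: real
    and P Q :: "real \<Rightarrow> 'v set"
  assumes D_add: "D i (v + w) = D i v + D i w"
    and P_sub: "s0 \<le> t \<Longrightarrow> diff_submodule smul D (P t)"
    and Q_sub: "s0 \<le> t \<Longrightarrow> diff_submodule smul D (Q t)"
    and split: "s0 \<le> t \<Longrightarrow> diff_submodule smul D B \<Longrightarrow> v \<in> B \<Longrightarrow> \<exists>x\<in>B \<inter> P t. \<exists>y\<in>B \<inter> Q t. v = x + y"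
    and disjoint: "s0 \<le> t \<Longrightarrow> v \<in> P t \<Longrightarrow> v \<in> Q t \<Longrightarrow> v = 0"
    and P_mono: "s0 \<le> s \<Longrightarrow> s \<le> t \<Longrightarrow> P s \<subseteq> P t"
    and P_right_continuous: "s0 \<le> s \<Longrightarrow> (\<And>t. s < t \<Longrightarrow> v \<in> P t) \<Longrightarrow> v \<in> P s"
    and P_top: "\<exists>t\<ge>s0. P t = UNIV"
    and quot_scale_le_iff: "s0 \<le> t \<Longrightarrow> diff_submodule smul D A \<Longrightarrow> diff_submodule smul D B \<Longrightarrow> A \<subset> B \<Longrightarrow>
      quot_scale av d smul D A B \<le> t \<longleftrightarrow> (\<forall>v\<in>B. \<exists>a\<in>A. v - a \<in> P t)"
begin

lemma sub_subspace: "diff_submodule smul D W \<Longrightarrow> subspace W"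
  by (simp add: diff_submodule_def)

lemma sub_zero: "diff_submodule smul D {0}"
  using D_add[of _ 0 0] by (simp add: diff_submodule_def)

lemma sub_Inter:
  assumes "\<And>W. W \<in> \<W> \<Longrightarrow> diff_submodule smul D W"
  shows "diff_submodule smul D (\<Inter>\<W>)"
  using assms unfolding diff_submodule_def by (auto intro!: subspace_Inter) blast

lemma sub_inter: "diff_submodule smul D A \<Longrightarrow> diff_submodule smul D B \<Longrightarrow> diff_submodule smul D (A \<inter> B)"
  using sub_Inter[of "{A, B}"] by auto

text \<open>The component in \<open>P s\<close> of a vector of \<open>Q t\<close> lies in both
  \<open>P t\<close> and \<open>Q t\<close>, hence vanishes.\<close>

lemma Q_antimono:
  assumes "s0 \<le> s" "s \<le> t"
  shows "Q t \<subseteq> Q s"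
proof
  fix v assume v: "v \<in> Q t"
  have t: "s0 \<le> t" using assms by simp
  obtain x y where xy: "x \<in> Q t" "x \<in> P s" "y \<in> Q s" "v = x + y"
    using split[OF assms(1) Q_sub[OF t] v] by blast
  have "x = 0" using disjoint[OF t] xy P_mono[OF assms] by blast
  then show "v \<in> Q s" using xy by simp
qed

text \<open>Scale at most \<open>t\<close> means that \<open>B\<close> is contained in
  \<open>A + P t\<close>, so inclusion in \<open>P t\<close> passes from \<open>A\<close> to
  \<open>B\<close>. Conversely, inside \<open>P t\<close> the representative \<open>a = 0\<close>
  works.\<close>

lemma JH_scale_le_iff:
  assumes W: "diff_submodule smul D W" and t: "s0 \<le> t"
  shows "(\<forall>A B. JH_factor smul D W A B \<longrightarrow> quot_scale av d smul D A B \<le> t) \<longleftrightarrow> W \<subseteq> P t"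
proof
  assume *: "\<forall>A B. JH_factor smul D W A B \<longrightarrow> quot_scale av d smul D A B \<le> t"
  show "W \<subseteq> P t"
  proof (rule JH_induct[OF W sub_zero])
    show "{0} \<subseteq> P t" using subspace_0[OF sub_subspace[OF P_sub[OF t]]] by simp
    fix A B assume AB: "JH_factor smul D W A B" "irreducible_quot smul D A B" "A \<subseteq> P t"
    have *: "\<forall>v\<in>B. \<exists>a\<in>A. v - a \<in> P t"
      using * AB(1) quot_scale_le_iff[OF t, of A B] irreducible_quotD[OF AB(2)] by auto
    show "B \<subseteq> P t"
    proof
      fix v assume "v \<in> B"
      then obtain a where "a \<in> A" "v - a \<in> P t" using * by blast
      then have "(v - a) + a \<in> P t" using AB(3) sub_subspace[OF P_sub[OF t]] by (intro subspace_add) auto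
      then show "v \<in> P t" by simp
    qed
  qed
next
  assume W: "W \<subseteq> P t"
  show "\<forall>A B. JH_factor smul D W A B \<longrightarrow> quot_scale av d smul D A B \<le> t"
  proof (intro allI impI)
    fix A B assume AB: "JH_factor smul D W A B"
    have "0 \<in> A" using subspace_0 sub_subspace irreducible_quotD(1)[OF JH_factorD(1)[OF AB]] by blast
    then have "\<forall>v\<in>B. \<exists>a\<in>A. v - a \<in> P t" using JH_factorD(2)[OF AB] W by (auto intro!: bexI[of _ 0])
    then show "quot_scale av d smul D A B \<le> t"
      using quot_scale_le_iff[OF t, of A B] irreducible_quotD[OF JH_factorD(1)[OF AB]] by auto
  qed
qed

text \<open>Irreducibility forces \<open>A + (B \<inter> P t)\<close> to be \<open>A\<close> or
  \<open>B\<close>, and large scale excludes \<open>B\<close>. Hence \<open>B \<inter> P t\<close>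
  lies in \<open>A\<close>, which is contained in \<open>Q t\<close>, and vanishes; the splitting of
  \<open>B\<close> then puts \<open>B\<close> inside \<open>Q t\<close>.\<close>

lemma JH_scale_gt_iff:
  assumes W: "diff_submodule smul D W" and t: "s0 \<le> t"
  shows "(\<forall>A B. JH_factor smul D W A B \<longrightarrow> t < quot_scale av d smul D A B) \<longleftrightarrow> W \<subseteq> Q t"
proof
  assume *: "\<forall>A B. JH_factor smul D W A B \<longrightarrow> t < quot_scale av d smul D A B"
  show "W \<subseteq> Q t"
  proof (rule JH_induct[OF W sub_zero])
    show "{0} \<subseteq> Q t" using subspace_0[OF sub_subspace[OF Q_sub[OF t]]] by simp
    fix A B assume AB: "JH_factor smul D W A B" "irreducible_quot smul D A B" "A \<subseteq> Q t"
    note irr = irreducible_quotD[OF AB(2)]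
    have "\<not> quot_scale av d smul D A B \<le> t" using *[rule_format, OF AB(1)] by simp
    then obtain v where v: "v \<in> B" "\<And>a. a \<in> A \<Longrightarrow> v - a \<notin> P t"
      using quot_scale_le_iff[OF t irr(1,2)] irr(3) by auto
    define C where "C = {x + y |x y. x \<in> A \<and> y \<in> B \<inter> P t}"
    note BP = sub_inter[OF irr(2) P_sub[OF t]]
    have "diff_submodule smul D C"
      unfolding diff_submodule_def
    proof (intro conjI allI image_subsetI)
      show "subspace C" unfolding C_def
        by (rule subspace_sums[OF sub_subspace[OF irr(1)] sub_subspace[OF BP]])
      fix i z assume "z \<in> C"
      then obtain x y where z: "x \<in> A" "y \<in> B \<inter> P t" "z = x + y" by (auto simp: C_def)
      have "D i z = D i x + D i y" by (simp add: z(3) D_add)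
      moreover have "D i x \<in> A" "D i y \<in> B \<inter> P t"
        using z irr(1) BP unfolding diff_submodule_def by blast+
      ultimately show "D i z \<in> C" unfolding C_def by blast
    qed
    moreover have "A \<subseteq> C" unfolding C_def using subspace_0[OF sub_subspace[OF BP]] by force
    moreover have "C \<subseteq> B" unfolding C_def using irr(3) sub_subspace[OF irr(2)] by (auto intro: subspace_add)
    moreover have "C \<noteq> B"
    proof
      assume "C = B"
      then obtain x y where "x \<in> A" "y \<in> P t" "v = x + y" using v(1) unfolding C_def by blast
      then show False using v(2)[of x] by simp
    qed
    ultimately have CA: "C = A" using irr(4) by blast
    have BP0: "B \<inter> P t \<subseteq> {0}"
    proof
      fix y assume y: "y \<in> B \<inter> P t"
      then have "y \<in> C" unfolding C_def using subspace_0[OF sub_subspace[OF irr(1)]] by force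
      then have "y \<in> Q t" using CA AB(3) by blast
      then show "y \<in> {0}" using disjoint[OF t] y by blast
    qed
    show "B \<subseteq> Q t" using split[OF t irr(2)] BP0 by fastforce
  qed
next
  assume W: "W \<subseteq> Q t"
  show "\<forall>A B. JH_factor smul D W A B \<longrightarrow> t < quot_scale av d smul D A B"
  proof (intro allI impI)
    fix A B assume AB: "JH_factor smul D W A B"
    note irr = irreducible_quotD[OF JH_factorD(1)[OF AB]]
    obtain v where v: "v \<in> B" "v \<notin> A" using irr(3) by blast
    have "v - a \<notin> P t" if "a \<in> A" for a
    proof
      assume "v - a \<in> P t"
      moreover have "v - a \<in> B" using v(1) that irr(3) sub_subspace[OF irr(2)] by (intro subspace_diff) auto
      then have "v - a \<in> Q t" using JH_factorD(2)[OF AB] W by blast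
      ultimately have "v = a" using disjoint[OF t, of "v - a"] by simp
      then show False using v that by simp
    qed
    then have "\<not> quot_scale av d smul D A B \<le> t" using quot_scale_le_iff[OF t irr(1-3)] v(1) by blast
    then show "t < quot_scale av d smul D A B" by simp
  qed
qed

text \<open>Scale at most \<open>s\<close> but above every smaller \<open>t\<close>; a real index
  has no predecessor, hence the intersection. The value \<open>{0}\<close> matches the normalization
  in \<open>scale_decomposition\<close>.\<close>

definition pure :: "real \<Rightarrow> 'v set" where
  "pure s = (if s0 < s then P s \<inter> (\<Inter>t\<in>{s0..<s}. Q t) else {0})"

lemma sub_pure: "diff_submodule smul D (pure s)"
  unfolding pure_def using sub_zero by (auto intro!: sub_inter sub_Inter P_sub Q_sub)

lemma pure_subset:
  assumes "s0 < s"
  shows "pure s \<subseteq> P s" "s0 \<le> t \<Longrightarrow> t < s \<Longrightarrow> pure s \<subseteq> Q t"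
  using assms by (auto simp: pure_def)

text \<open>The spaces \<open>Q t\<close> decrease with \<open>t\<close> and have finite dimension,
  so they stabilize before \<open>s\<close>.\<close>

lemma pure_eq:
  assumes "s0 < s"
  shows "\<exists>t\<ge>s0. t < s \<and> pure s = P s \<inter> Q t"
proof -
  obtain t where t: "s0 \<le> t" "t < s" "\<And>t'. s0 \<le> t' \<Longrightarrow> t' < s \<Longrightarrow> dim (Q t) \<le> dim (Q t')"
    using ex_has_least_nat[of "\<lambda>t. s0 \<le> t \<and> t < s" s0 "\<lambda>t. dim (Q t)"] assms by auto
  have "Q t \<subseteq> Q t'" if t': "s0 \<le> t'" "t' < s" for t'
  proof (cases "t \<le> t'")
    case True
    then have "Q t' = Q t"
      using Q_antimono[OF t(1) True] t(3)[OF t'] sub_subspace[OF Q_sub] t t'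
      by (intro subspace_dim_equal) auto
    then show ?thesis by simp
  qed (use Q_antimono t' in auto)
  then have "(\<Inter>t\<in>{s0..<s}. Q t) = Q t"
    using t by (intro antisym INT_lower INT_greatest) auto
  then show ?thesis using t assms by (auto simp: pure_def)
qed

text \<open>Remove the largest index \<open>b\<close> first: its term lies in \<open>Q t\<close> for
  the next smaller \<open>t\<close>, all other terms lie in \<open>P t\<close>.\<close>

lemma pure_independent:
  assumes "finite S" "\<And>s. s \<in> S \<Longrightarrow> s0 < s \<and> w s \<in> pure s" "p \<in> P s0" "p + (\<Sum>s\<in>S. w s) = 0"
  shows "p = 0 \<and> (\<forall>s\<in>S. w s = 0)"
  using assms
proof (induction S rule: finite_linorder_max_induct)
  case (insert b S)
  define t where "t = Max (insert s0 S)"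
  have t: "s0 \<le> t" "t < b" using insert.hyps insert.prems(1)[of b] by (auto simp: t_def)
  have Pt: "subspace (P t)" by (rule sub_subspace[OF P_sub[OF t(1)]])
  have "w s \<in> P t" if s: "s \<in> S" for s
  proof -
    have "s \<le> t" unfolding t_def using s insert.hyps(1) by (intro Max_ge) auto
    then show ?thesis using pure_subset(1)[of s] insert.prems(1)[of s] s P_mono[of s t] by auto
  qed
  moreover have "p \<in> P t" using insert.prems(2) P_mono[OF order_refl t(1)] by blast
  ultimately have "p + (\<Sum>s\<in>S. w s) \<in> P t" using Pt by (intro subspace_add subspace_sum)
  moreover have bS: "b \<notin> S" using insert.hyps(2) by blast
  then have eq: "(p + (\<Sum>s\<in>S. w s)) + w b = 0" using insert.prems(3) insert.hyps(1) by (simp add: ac_simps)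
  then have "w b = - (p + (\<Sum>s\<in>S. w s))" by (rule minus_unique[symmetric])
  ultimately have "w b \<in> P t" using subspace_neg[OF Pt] by metis
  moreover have "w b \<in> Q t" using insert.prems(1)[of b] pure_subset(2)[of b t] t by auto
  ultimately have wb: "w b = 0" using disjoint[OF t(1)] by blast
  then have "p + (\<Sum>s\<in>S. w s) = 0" using eq by simp
  with insert.IH insert.prems(1,2) have "p = 0 \<and> (\<forall>s\<in>S. w s = 0)" by blast
  then show ?case using wb by simp
qed simp

text \<open>The dimension of \<open>P s\<close> strictly increases along the support, so it is
  injective there.\<close>

lemma finite_support: "finite {s. s0 < s \<and> pure s \<noteq> {0}}"
proof (rule inj_on_finite)
  let ?J = "{s. s0 < s \<and> pure s \<noteq> {0}}"
  have *: "dim (P s) < dim (P s')" if s: "s \<in> ?J" "s' \<in> ?J" "s < s'" for s s'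
  proof (rule ccontr)
    assume "\<not> ?thesis"
    then have "P s = P s'" using P_mono[of s s'] sub_subspace[OF P_sub] s by (intro subspace_dim_equal) auto
    then have "pure s' \<subseteq> P s \<inter> Q s" using pure_subset[of s'] s by auto
    then have "pure s' \<subseteq> {0}" using disjoint[of s] s by auto
    then show False using s(2) subspace_0[OF sub_subspace[OF sub_pure[of s']]] by auto
  qed
  show "inj_on (\<lambda>s. dim (P s)) ?J"
  proof (rule inj_onI)
    fix s s' assume "s \<in> ?J" "s' \<in> ?J" "dim (P s) = dim (P s')"
    then show "s = s'" using *[of s s'] *[of s' s] by (cases s s' rule: linorder_cases) auto
  qed
  show "(\<lambda>s. dim (P s)) ` ?J \<subseteq> {..dimension}" using dim_subset_UNIV by auto
qed simp

text \<open>Real induction on \<open>t\<close>: right continuity makes the infimum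
  \<open>t\<^sub>0\<close> of the bad parameters bad itself. Yet \<open>P t\<^sub>0\<close> splits
  into some \<open>P t\<^sub>2\<close> with \<open>t\<^sub>2 < t\<^sub>0\<close>, which is good, and
  \<open>pure t\<^sub>0\<close>.\<close>

lemma pure_spanning: "\<exists>p\<in>P s0. \<exists>w. (\<forall>s. w s \<in> pure s) \<and> v = p + (\<Sum>s | s0 < s \<and> pure s \<noteq> {0}. w s)"
proof -
  define J where "J = {s. s0 < s \<and> pure s \<noteq> {0}}"
  have J: "finite J" unfolding J_def by (rule finite_support)
  define S where "S = {p + (\<Sum>s\<in>J. w s) |p w. p \<in> P s0 \<and> (\<forall>s. w s \<in> pure s)}"
  note P0 = sub_subspace[OF P_sub[OF order_refl]]
  note pure_sp = sub_subspace[OF sub_pure]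
  have SI: "p + (\<Sum>s\<in>J. w s) \<in> S" if "p \<in> P s0" "\<And>s. w s \<in> pure s" for p w
    unfolding S_def using that by blast
  have S: "subspace S"
  proof (rule subspaceI)
    show "0 \<in> S" using SI[of 0 "\<lambda>_. 0"] subspace_0[OF P0] subspace_0[OF pure_sp] by simp
    fix x assume "x \<in> S"
    then obtain p w where x: "p \<in> P s0" "\<And>s. w s \<in> pure s" "x = p + (\<Sum>s\<in>J. w s)" by (auto simp: S_def)
    show "smul c x \<in> S" for c
      using SI[of "smul c p" "\<lambda>s. smul c (w s)"] x subspace_scale[OF P0] subspace_scale[OF pure_sp]
      by (simp add: scale_right_distrib scale_sum_right)
    fix y assume "y \<in> S"
    then obtain p' w' where y: "p' \<in> P s0" "\<And>s. w' s \<in> pure s" "y = p' + (\<Sum>s\<in>J. w' s)" by (auto simp: S_def)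
    show "x + y \<in> S"
      using SI[of "p + p'" "\<lambda>s. w s + w' s"] x y subspace_add[OF P0] subspace_add[OF pure_sp]
      by (simp add: sum.distrib algebra_simps)
  qed
  have P0S: "P s0 \<subseteq> S"
  proof
    fix p assume "p \<in> P s0"
    then show "p \<in> S" using SI[of p "\<lambda>_. 0"] subspace_0[OF pure_sp] by simp
  qed
  have pureS: "pure s \<subseteq> S" if s: "s0 < s" for s
  proof
    fix x assume x: "x \<in> pure s"
    show "x \<in> S"
    proof (cases "s \<in> J")
      case True
      then show ?thesis using SI[of 0 "\<lambda>s'. if s' = s then x else 0"] J x subspace_0[OF P0] subspace_0[OF pure_sp]
        by simp
    next
      case False
      then show ?thesis using x s subspace_0[OF S] by (auto simp: J_def)
    qed
  qed
  have "P t \<subseteq> S" if "s0 \<le> t" for t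
  proof (rule ccontr)
    define Z where "Z = {t. s0 \<le> t \<and> \<not> P t \<subseteq> S}"
    assume "\<not> P t \<subseteq> S"
    then have Z: "t \<in> Z" using that by (simp add: Z_def)
    have bdd: "bdd_below Z" by (rule bdd_belowI[of _ s0]) (simp add: Z_def)
    define t\<^sub>0 where "t\<^sub>0 = Inf Z"
    have t0: "s0 \<le> t\<^sub>0" unfolding t\<^sub>0_def using Z by (intro cInf_greatest) (auto simp: Z_def)
    obtain t\<^sub>1 where t1: "t\<^sub>0 < t\<^sub>1" "\<And>t. t\<^sub>0 < t \<Longrightarrow> dim (P t\<^sub>1) \<le> dim (P t)"
      using ex_has_least_nat[of "\<lambda>t. t\<^sub>0 < t" "t\<^sub>0 + 1" "\<lambda>t. dim (P t)"] by auto
    have "P t\<^sub>1 \<subseteq> P t\<^sub>0"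
    proof
      fix x assume x: "x \<in> P t\<^sub>1"
      show "x \<in> P t\<^sub>0"
      proof (rule P_right_continuous[OF t0])
        fix t assume t: "t\<^sub>0 < t"
        show "x \<in> P t"
        proof (cases "t \<le> t\<^sub>1")
          case True
          then have "P t = P t\<^sub>1"
            using t t1 t0 sub_subspace[OF P_sub] P_mono[of t t\<^sub>1] by (intro subspace_dim_equal) auto
          then show ?thesis using x by simp
        qed (use x P_mono[of t\<^sub>1 t] t0 t1 in auto)
      qed
    qed
    moreover obtain t' where t': "t' \<in> Z" "t' < t\<^sub>1"
      using cInf_less_iff[of Z t\<^sub>1] Z bdd t1(1) unfolding t\<^sub>0_def by blast
    moreover have "P t' \<subseteq> P t\<^sub>1" using t' by (intro P_mono) (auto simp: Z_def)
    ultimately have nS: "\<not> P t\<^sub>0 \<subseteq> S" by (auto simp: Z_def)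
    then have "t\<^sub>0 \<noteq> s0" using P0S by blast
    then have "s0 < t\<^sub>0" using t0 by simp
    from pure_eq[OF this] obtain t\<^sub>2 where t2: "s0 \<le> t\<^sub>2" "t\<^sub>2 < t\<^sub>0" "pure t\<^sub>0 = P t\<^sub>0 \<inter> Q t\<^sub>2" by blast
    have "t\<^sub>2 \<notin> Z" using t2(2) cInf_lower[OF _ bdd, of t\<^sub>2] unfolding t\<^sub>0_def by auto
    then have P2: "P t\<^sub>2 \<subseteq> S" using t2(1) by (simp add: Z_def)
    have "P t\<^sub>0 \<subseteq> S"
    proof
      fix x assume "x \<in> P t\<^sub>0"
      from split[OF t2(1) P_sub[OF t0] this] obtain a b where
        ab: "a \<in> P t\<^sub>2" "b \<in> P t\<^sub>0 \<inter> Q t\<^sub>2" "x = a + b" by blast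
      have "b \<in> S" using ab(2) t2(3) pureS[OF \<open>s0 < t\<^sub>0\<close>] by blast
      then show "x \<in> S" using ab P2 S by (auto intro: subspace_add)
    qed
    then show False using nS by blast
  qed
  then have "v \<in> S" using P_top by blast
  then show ?thesis unfolding S_def J_def by blast
qed

lemma scale_decomposition_pure: "scale_decomposition av d smul D s0 (P s0) pure"
  unfolding scale_decomposition_def
proof (intro conjI allI impI)
  show "diff_submodule smul D (P s0)" by (rule P_sub) simp
  show "diff_submodule smul D (pure s)" for s by (rule sub_pure)
  show "pure s = {0}" if "s \<le> s0" for s using that by (simp add: pure_def)
  show "finite {s. s0 < s \<and> pure s \<noteq> {0}}" by (rule finite_support)
  show "quot_scale av d smul D A B \<le> s0" if "JH_factor smul D (P s0) A B" for A B
    using JH_scale_le_iff[OF P_sub[OF order_refl] order_refl] that by blast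
  show "quot_scale av d smul D A B = s" if s: "s0 < s" and AB: "JH_factor smul D (pure s) A B" for s A B
  proof (rule antisym)
    show "quot_scale av d smul D A B \<le> s"
      using JH_scale_le_iff[OF sub_pure, of s s] pure_subset(1)[OF s] s AB by auto
    show "s \<le> quot_scale av d smul D A B"
    proof (rule ccontr)
      define t where "t = max s0 (quot_scale av d smul D A B)"
      assume "\<not> ?thesis"
      then have t: "s0 \<le> t" "t < s" using s by (auto simp: t_def)
      then have "t < quot_scale av d smul D A B"
        using JH_scale_gt_iff[OF sub_pure t(1), of s] pure_subset(2)[OF s t] AB by blast
      then show False by (simp add: t_def)
    qed
  qed
  fix v
  let ?J = "{s. s0 < s \<and> pure s \<noteq> {0}}"
  show "\<exists>!pf. fst pf \<in> P s0 \<and> (\<forall>s. snd pf s \<in> pure s) \<and> v = fst pf + (\<Sum>s\<in>?J. snd pf s)"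
  proof (rule ex_ex1I)
    show "\<exists>pf. fst pf \<in> P s0 \<and> (\<forall>s. snd pf s \<in> pure s) \<and> v = fst pf + (\<Sum>s\<in>?J. snd pf s)"
      using pure_spanning[of v] by force
    fix x y :: "'v \<times> (real \<Rightarrow> 'v)"
    assume x: "fst x \<in> P s0 \<and> (\<forall>s. snd x s \<in> pure s) \<and> v = fst x + (\<Sum>s\<in>?J. snd x s)"
      and y: "fst y \<in> P s0 \<and> (\<forall>s. snd y s \<in> pure s) \<and> v = fst y + (\<Sum>s\<in>?J. snd y s)"
    have "fst x - fst y + (\<Sum>s\<in>?J. snd x s - snd y s) =
        (fst x + (\<Sum>s\<in>?J. snd x s)) - (fst y + (\<Sum>s\<in>?J. snd y s))"
      by (simp add: sum_subtractf algebra_simps)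
    also have "\<dots> = 0" using x y by simp
    finally have e1: "fst x - fst y + (\<Sum>s\<in>?J. snd x s - snd y s) = 0" .
    have e2: "fst x - fst y \<in> P s0"
      using x y sub_subspace[OF P_sub[OF order_refl]] by (intro subspace_diff) auto
    have e3: "s0 < s \<and> snd x s - snd y s \<in> pure s" if "s \<in> ?J" for s
      using that x y sub_subspace[OF sub_pure] by (auto intro: subspace_diff)
    have *: "fst x - fst y = 0 \<and> (\<forall>s\<in>?J. snd x s - snd y s = 0)"
      by (rule pure_independent[of ?J "\<lambda>s. snd x s - snd y s", OF finite_support e3 e2 e1])
    have "snd x s = snd y s" for s
    proof (cases "s \<in> ?J")
      case False
      then have "pure s = {0}" by (auto simp: pure_def)
      then have "snd x s \<in> {0}" "snd y s \<in> {0}" using x y by metis+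
      then show ?thesis by simp
    qed (use * in auto)
    then show "x = y" using * by (intro prod_eqI) auto
  qed
qed

text \<open>The Jordan-Hoelder criteria place every given summand inside the canonical one. Since
  the given summands span and the canonical ones are independent, the inclusions are
  equalities.\<close>

lemma scale_decomposition_unique:
  assumes W: "scale_decomposition av d smul D s0 Wp Ws"
  shows "Wp = P s0 \<and> Ws = pure"
proof -
  note W' = W[unfolded scale_decomposition_def]
  have Wp: "diff_submodule smul D Wp" using W' by (elim conjE)
  have "\<forall>s>s0. diff_submodule smul D (Ws s)" using W' by (elim conjE)
  then have Ws: "diff_submodule smul D (Ws s)" if "s0 < s" for s using that by blast
  have Ws0: "\<forall>s\<le>s0. Ws s = {0}" using W' by (elim conjE)
  have fin: "finite {s. s0 < s \<and> Ws s \<noteq> {0}}" using W' by (elim conjE)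
  have "\<forall>s>s0. \<forall>A B. JH_factor smul D (Ws s) A B \<longrightarrow> quot_scale av d smul D A B = s" using W' by (elim conjE)
  then have JHs: "quot_scale av d smul D A B = s" if "s0 < s" "JH_factor smul D (Ws s) A B" for s A B
    using that by blast
  have "\<forall>A B. JH_factor smul D Wp A B \<longrightarrow> quot_scale av d smul D A B \<le> s0" using W' by (elim conjE)
  then have JHp: "quot_scale av d smul D A B \<le> s0" if "JH_factor smul D Wp A B" for A B
    using that by blast
  define J where "J = {s. s0 < s \<and> Ws s \<noteq> {0}}"
  have dec: "\<exists>p\<in>Wp. \<exists>f. (\<forall>s. f s \<in> Ws s) \<and> v = p + (\<Sum>s\<in>J. f s)" for v
  proof -
    have "\<forall>v. \<exists>!pf. fst pf \<in> Wp \<and> (\<forall>s. snd pf s \<in> Ws s) \<and> v = fst pf + (\<Sum>s\<in>J. snd pf s)"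
      using W' unfolding J_def by (elim conjE)
    from ex1_implies_ex[OF spec[OF this]] show ?thesis by blast
  qed
  have Wp_sub: "Wp \<subseteq> P s0" using JH_scale_le_iff[OF Wp order_refl] JHp by blast
  have Ws_sub: "Ws s \<subseteq> pure s" if s: "s0 < s" for s
  proof -
    have "Ws s \<subseteq> P s" using JH_scale_le_iff[OF Ws[OF s], of s] JHs[OF s] s by auto
    moreover have "Ws s \<subseteq> Q t" if t: "s0 \<le> t" "t < s" for t
      using JH_scale_gt_iff[OF Ws[OF s] t(1)] JHs[OF s] t(2) by auto
    then have "Ws s \<subseteq> (\<Inter>t\<in>{s0..<s}. Q t)" by (intro INT_greatest) auto
    ultimately show ?thesis using s by (simp add: pure_def)
  qed
  have "P s0 \<subseteq> Wp"
  proof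
    fix v assume v: "v \<in> P s0"
    obtain p f where pf: "p \<in> Wp" "\<And>s. f s \<in> Ws s" "v = p + (\<Sum>s\<in>J. f s)" using dec[of v] by blast
    have "p - v = 0 \<and> (\<forall>s\<in>J. f s = 0)"
    proof (rule pure_independent)
      show "p - v \<in> P s0" using pf(1) v Wp_sub sub_subspace[OF P_sub[OF order_refl]] by (intro subspace_diff) auto
      show "s0 < s \<and> f s \<in> pure s" if "s \<in> J" for s using that Ws_sub pf(2) by (auto simp: J_def)
    qed (use fin pf(3) in \<open>auto simp: J_def\<close>)
    then show "v \<in> Wp" using pf(1) by simp
  qed
  moreover have "pure s = Ws s" for s
  proof (cases "s0 < s")
    case True
    have "pure s \<subseteq> Ws s"
    proof
      fix v assume v: "v \<in> pure s"
      obtain p f where pf: "p \<in> Wp" "\<And>s. f s \<in> Ws s" "v = p + (\<Sum>s\<in>J. f s)" using dec[of v] by blast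
      \<comment> \<open>Subtracting \<open>v\<close> at index \<open>s\<close> turns its expansion
        into a relation among the canonical summands. The index \<open>s\<close> is inserted because
        it may lie outside the support \<open>J\<close>.\<close>
      define g where "g s' = f s' - (if s' = s then v else 0)" for s'
      have f0: "f s = 0" if "s \<notin> J" using that True pf(2)[of s] by (simp add: J_def)
      have J: "finite J" using fin by (simp add: J_def)
      have "(\<Sum>s'\<in>insert s J. f s') = (\<Sum>s'\<in>J. f s')"
        using J f0 by (cases "s \<in> J") (auto simp: insert_absorb)
      moreover have "(\<Sum>s'\<in>insert s J. if s' = s then v else 0) = v" using J by (subst sum.delta) auto
      ultimately have "(\<Sum>s'\<in>insert s J. g s') = (\<Sum>s'\<in>J. f s') - v"
        unfolding g_def by (simp only: sum_subtractf)
      then have "p + (\<Sum>s'\<in>insert s J. g s') = 0" using pf(3) by simp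
      moreover have "s0 < s' \<and> g s' \<in> pure s'" if "s' \<in> insert s J" for s'
      proof -
        have s': "s0 < s'" using that True by (auto simp: J_def)
        have "f s' \<in> pure s'" using Ws_sub[OF s'] pf(2) by blast
        moreover have "(if s' = s then v else 0) \<in> pure s'"
          using v subspace_0[OF sub_subspace[OF sub_pure]] by auto
        ultimately show ?thesis using s' sub_subspace[OF sub_pure] unfolding g_def by (auto intro: subspace_diff)
      qed
      ultimately have "\<forall>s'\<in>insert s J. g s' = 0"
        using pure_independent[of "insert s J" g p] J pf(1) Wp_sub by blast
      then have "v = f s" by (simp add: g_def)
      then show "v \<in> Ws s" using pf(2) by simp
    qed
    then show ?thesis using Ws_sub[OF True] by blast
  next
    case False
    then show ?thesis using Ws0 by (simp add: pure_def)
  qed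
  ultimately show ?thesis using Wp_sub by auto
qed

end

section \<open>Bounded module operators and their scale filtration\<close>

context nonarch_vector_space
begin

text \<open>By Leibniz, the values on the finite basis together with the bound on
  \<open>\<delta>\<close> determine a bound everywhere.\<close>

lemma twisted_additive_bounded:
  assumes \<delta>: "\<And>x. av (\<delta> x) \<le> r * av x" and r: "0 \<le> r"
    and T_add: "\<And>v w. T (v + w) = T v + T w"
    and T_smul: "\<And>f v. T (smul f v) = smul (\<delta> f) v + smul f (T v)"
  shows "\<exists>K. \<forall>v. nrm (T v) \<le> K * nrm v"
proof -
  define K where "K = (\<Sum>b\<in>Basis. r * nrm b + nrm (T b))"
  have K: "0 \<le> r * nrm b + nrm (T b)" for b using r nrm_nonneg by simp
  have T0: "T 0 = 0" using T_add[of 0 0] by simp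
  have T_sum: "T (sum x I) = (\<Sum>i\<in>I. T (x i))" for x and I :: "'v set"
    by (induction I rule: infinite_finite_induct) (simp_all add: T0 T_add)
  have "nrm (T v) \<le> K * nrm v" for v
  proof -
    let ?c = "representation Basis v"
    have "T v = (\<Sum>b\<in>Basis. smul (\<delta> (?c b)) b + smul (?c b) (T b))"
      using arg_cong[OF basis_expansion[of v], of T] by (simp add: T_sum T_smul)
    also have "nrm \<dots> \<le> K * nrm v"
    proof (rule nrm_sum_le)
      show "0 \<le> K * nrm v" unfolding K_def using K nrm_nonneg by (intro mult_nonneg_nonneg sum_nonneg) auto
      fix b assume b: "b \<in> Basis"
      have c: "av (?c b) \<le> nrm v" by (rule av_coord_le_nrm[OF b])
      have "av (\<delta> (?c b)) * nrm b \<le> (r * nrm v) * nrm b"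
        using \<delta>[of "?c b"] mult_left_mono[OF c r] nrm_nonneg by (intro mult_right_mono) auto
      moreover have "av (?c b) * nrm (T b) \<le> nrm v * nrm (T b)"
        using c nrm_nonneg by (rule mult_right_mono)
      moreover have "0 \<le> (r * nrm v) * nrm b" "0 \<le> nrm v * nrm (T b)" using r nrm_nonneg by auto
      moreover have "(r * nrm b + nrm (T b)) * nrm v \<le> K * nrm v"
        unfolding K_def using b K finite_Basis nrm_nonneg
        by (intro mult_right_mono member_le_sum[of b Basis "\<lambda>b. r * nrm b + nrm (T b)"]) auto
      ultimately show "nrm (smul (\<delta> (?c b)) b + smul (?c b) (T b)) \<le> K * nrm v"
        by (intro nrm_add_le) (simp_all add: nrm_smul algebra_simps)
    qed
    finally show ?thesis .
  qed
  then show ?thesis by blast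
qed

end

context twisted_operators
begin

context
  fixes s0 :: real and \<mu> :: "'i \<Rightarrow> real"
  assumes \<mu>: "\<And>i. spectral_norm av UNIV (d i) = \<mu> i" "\<And>i. 0 < \<mu> i" "\<And>i. r i = s0 * \<mu> i" and s0: "1 \<le> s0"
begin

text \<open>The common ratio enters here: one condition on \<open>t\<close> puts the thresholds of
  all directions above the norms of their derivations.\<close>

lemma r_le: "s0 \<le> t \<Longrightarrow> r i \<le> t * \<mu> i"
  using \<mu>(2)[of i] by (simp add: \<mu>(3))

text \<open>If every spectral norm is small, all fast parts of \<open>B\<close> lie in
  \<open>A\<close>, so each class has a representative that is slow in all directions
  simultaneously.\<close>

lemma quot_scale_le_iff_slows:
  assumes t: "s0 \<le> t" and A: "diff_submodule smul D A" and B: "diff_submodule smul D B" and AB: "A \<subset> B"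
  shows "quot_scale av d smul D A B \<le> t \<longleftrightarrow> (\<forall>v\<in>B. \<exists>a\<in>A. v - a \<in> slows UNIV (\<lambda>i. t * \<mu> i))"
proof -
  note bounds = op.quot_spectral_norm_bounds[OF r_le[OF t] diff_submoduleD[OF A] diff_submoduleD[OF B] psubset_imp_subset[OF AB]]
  have "quot_scale av d smul D A B \<le> t \<longleftrightarrow> (\<forall>i. max 1 (quot_spectral_norm av smul A B (D i) / \<mu> i) \<le> t)"
    unfolding quot_scale_def by (subst Max_le_iff) (auto simp: \<mu>(1))
  \<comment> \<open>The entry 1 of the maximum is harmless because
    \<open>1 \<le> s0 \<le> t\<close>.\<close>
  also have "\<dots> \<longleftrightarrow> (\<forall>i. quot_spectral_norm av smul A B (D i) \<le> t * \<mu> i)"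
    using t s0 \<mu>(2) by (simp add: pos_divide_le_eq)
  also have "\<dots> \<longleftrightarrow> (\<forall>v\<in>B. \<exists>a\<in>A. v - a \<in> slows UNIV (\<lambda>i. t * \<mu> i))"
  proof
    assume *: "\<forall>i. quot_spectral_norm av smul A B (D i) \<le> t * \<mu> i"
    show "\<forall>v\<in>B. \<exists>a\<in>A. v - a \<in> slows UNIV (\<lambda>i. t * \<mu> i)"
    proof
      fix v assume "v \<in> B"
      from slows_fasts_splitting[OF r_le[OF t] B this] obtain x y where
        xy: "x \<in> slows UNIV (\<lambda>i. t * \<mu> i)" "y \<in> fasts UNIV B (\<lambda>i. t * \<mu> i)" "v = x + y" by blast
      have "fasts UNIV B (\<lambda>i. t * \<mu> i) \<subseteq> A"
        unfolding fasts_def using bounds(2) * diff_submoduleD(1)[OF A] by (intro span_minimal UN_least) auto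
      then show "\<exists>a\<in>A. v - a \<in> slows UNIV (\<lambda>i. t * \<mu> i)" using xy by (intro bexI[of _ y]) auto
    qed
  next
    assume *: "\<forall>v\<in>B. \<exists>a\<in>A. v - a \<in> slows UNIV (\<lambda>i. t * \<mu> i)"
    show "\<forall>i. quot_spectral_norm av smul A B (D i) \<le> t * \<mu> i"
    proof
      fix i
      show "quot_spectral_norm av smul A B (D i) \<le> t * \<mu> i"
      proof (rule bounds(1))
        fix v assume "v \<in> B"
        then obtain a where "a \<in> A" "v - a \<in> slows UNIV (\<lambda>i. t * \<mu> i)" using * by blast
        then show "\<exists>a\<in>A. v - a \<in> op.slow i (t * \<mu> i)" by (auto simp: slows_def)
      qed
    qed
  qed
  finally show ?thesis .
qed

lemma scale_filtration_slows_fasts: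
  "scale_filtration smul Basis av d D s0 (\<lambda>t. slows UNIV (\<lambda>i. t * \<mu> i)) (\<lambda>t. fasts UNIV UNIV (\<lambda>i. t * \<mu> i))"
proof
  show "D i (v + w) = D i v + D i w" for i v w by (rule op.T_add)
next
  fix t assume t: "s0 \<le> t"
  show "diff_submodule smul D (slows UNIV (\<lambda>i. t * \<mu> i))" by (rule diff_submodule_slows[OF r_le[OF t]])
  show "diff_submodule smul D (fasts UNIV UNIV (\<lambda>i. t * \<mu> i))"
    by (rule diff_submodule_fasts[OF r_le[OF t] diff_submodule_UNIV])
  show "v = 0" if "v \<in> slows UNIV (\<lambda>i. t * \<mu> i)" "v \<in> fasts UNIV UNIV (\<lambda>i. t * \<mu> i)" for v
    by (rule slows_fasts_disjoint[OF r_le[OF t] that])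
  show "\<exists>x\<in>B \<inter> slows UNIV (\<lambda>i. t * \<mu> i). \<exists>y\<in>B \<inter> fasts UNIV UNIV (\<lambda>i. t * \<mu> i). v = x + y"
    if B: "diff_submodule smul D B" and v: "v \<in> B" for B v
  proof -
    have "fasts UNIV B (\<lambda>i. t * \<mu> i) \<subseteq> B \<inter> fasts UNIV UNIV (\<lambda>i. t * \<mu> i)"
      using fasts_subset[OF diff_submoduleD(1)[OF B]] fasts_mono[OF r_le[OF t] order_refl subset_UNIV] by blast
    then show ?thesis using slows_fasts_splitting[OF r_le[OF t] B v, of UNIV] by blast
  qed
  show "quot_scale av d smul D A B \<le> t \<longleftrightarrow> (\<forall>v\<in>B. \<exists>a\<in>A. v - a \<in> slows UNIV (\<lambda>i. t * \<mu> i))"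
    if "diff_submodule smul D A" "diff_submodule smul D B" "A \<subset> B" for A B
    by (rule quot_scale_le_iff_slows[OF t that])
next
  fix s t assume "s0 \<le> s" "s \<le> t"
  then show "slows UNIV (\<lambda>i. s * \<mu> i) \<subseteq> slows UNIV (\<lambda>i. t * \<mu> i)"
    unfolding slows_def using \<mu>(2) by (intro INT_anti_mono op.slow_mono order_refl mult_right_mono) (auto simp: less_imp_le)
next
  fix s v assume s: "s0 \<le> s" and v: "\<And>t. s < t \<Longrightarrow> v \<in> slows UNIV (\<lambda>i. t * \<mu> i)"
  show "v \<in> slows UNIV (\<lambda>i. s * \<mu> i)"
    unfolding slows_def
  proof
    fix i
    show "v \<in> op.slow i (s * \<mu> i)"
    proof (rule op.slow_right_continuous)
      fix \<rho> assume "s * \<mu> i < \<rho>"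
      then have "s < \<rho> / \<mu> i" using \<mu>(2)[of i] by (simp add: pos_less_divide_eq)
      from v[OF this] have "v \<in> op.slow i (\<rho> / \<mu> i * \<mu> i)" unfolding slows_def by blast
      then show "v \<in> op.slow i \<rho>" using \<mu>(2)[of i] by simp
    qed
  qed
next
  \<comment> \<open>The sum dominates each \<open>\<bar>K i\<bar> / \<mu> i\<close>, so a single
    \<open>t\<close> makes every vector slow in every direction.\<close>
  define t where "t = max s0 (\<Sum>i\<in>UNIV. \<bar>K i\<bar> / \<mu> i)"
  have "\<bar>K i\<bar> \<le> t * \<mu> i" for i
  proof -
    have "\<bar>K i\<bar> / \<mu> i \<le> (\<Sum>i\<in>UNIV. \<bar>K i\<bar> / \<mu> i)"
      using \<mu>(2) by (intro member_le_sum) (auto simp: less_imp_le)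
    then have "\<bar>K i\<bar> / \<mu> i \<le> t" by (simp add: t_def)
    then show ?thesis using \<mu>(2)[of i] by (simp add: pos_divide_le_eq)
  qed
  then have "slows UNIV (\<lambda>i. t * \<mu> i) = UNIV" using op.mem_slow_if_bounded by (auto simp: slows_def)
  then show "\<exists>t\<ge>s0. slows UNIV (\<lambda>i. t * \<mu> i) = UNIV" by (intro exI[of _ t]) (simp add: t_def)
qed

end

end

text \<open>Should a spectral norm of \<open>d i\<close> vanish, then \<open>s0 = 0\<close> and every scale is \<open>1\<close>, because \<open>x / 0 = 0\<close>.\<close>

lemma (in finite_dimensional_vector_space) scale_filtration_degenerate:
  fixes D :: "'i::finite \<Rightarrow> 'b \<Rightarrow> 'b"
  assumes "\<And>i. spectral_norm av UNIV (d i) = 0" and D_add: "\<And>i v w. D i (v + w) = D i v + D i w"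
  shows "scale_filtration scale Basis av d D 0
    (\<lambda>t. if 1 \<le> t then UNIV else {0}) (\<lambda>t. if 1 \<le> t then {0} else UNIV)"
proof
  have one: "quot_scale av d scale D A B = 1" for A B
    using assms(1) by (simp add: quot_scale_def)
  have D0: "D i 0 = 0" for i using D_add[of i 0 0] by simp
  have zero: "0 \<in> A" if "diff_submodule scale D A" for A
    using that subspace_0 by (simp add: diff_submodule_def)
  show "D i (v + w) = D i v + D i w" for i v w by (rule D_add)
  show "diff_submodule scale D (if 1 \<le> t then UNIV else {0})"
    and "diff_submodule scale D (if 1 \<le> t then {0} else UNIV)" for t :: real
    by (auto simp: diff_submodule_def D0)
  show "\<exists>x\<in>B \<inter> (if 1 \<le> t then UNIV else {0}). \<exists>y\<in>B \<inter> (if 1 \<le> t then {0} else UNIV). v = x + y"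
    if "diff_submodule scale D B" "v \<in> B" for B v and t :: real
    using zero[OF that(1)] that(2) by auto
  show "v = 0" if "v \<in> (if 1 \<le> t then UNIV else {0})" "v \<in> (if 1 \<le> t then {0} else UNIV)" for v and t :: real
    using that by (auto split: if_splits)
  show "(if 1 \<le> s then UNIV else {0}) \<subseteq> (if 1 \<le> t then UNIV else {0 :: 'b})" if "s \<le> t" for s t :: real
    using that by auto
  show "v \<in> (if 1 \<le> s then UNIV else {0})" if "\<And>t. s < t \<Longrightarrow> v \<in> (if 1 \<le> t then UNIV else {0})" for s :: real and v :: 'b
  proof (cases "1 \<le> s")
    case False
    then obtain t where "s < t" "t < 1" using dense[of s 1] by auto
    then show ?thesis using that[of t] by auto
  qed simp
  show "\<exists>t\<ge>0. (if 1 \<le> (t::real) then UNIV else {0 :: 'b}) = UNIV" by (intro exI[of _ 1]) simp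
  show "quot_scale av d scale D A B \<le> t \<longleftrightarrow> (\<forall>v\<in>B. \<exists>a\<in>A. v - a \<in> (if 1 \<le> t then UNIV else {0}))"
    if "diff_submodule scale D A" "A \<subset> B" for A B and t :: real
    unfolding one using zero[OF that(1)] that(2) by (auto split: if_splits)
qed

lemma (in scale_filtration) ex1_scale_decomposition:
  "\<exists>!W. scale_decomposition av d smul D s0 (fst W) (snd W)"
  by (rule ex1I[of _ "(P s0, pure)"]) (auto simp: scale_decomposition_pure dest: scale_decomposition_unique intro: prod_eqI)

theorem theorem3p26:
  fixes av :: "'f::field_char_0 \<Rightarrow> real"
    and d :: "'i::finite \<Rightarrow> 'f \<Rightarrow> 'f"
    and smul :: "'f \<Rightarrow> 'v::ab_group_add \<Rightarrow> 'v"
    and D :: "'i \<Rightarrow> 'v \<Rightarrow> 'v"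
    and s0 :: real
  assumes "complete_nonarch_field av"
    and "\<And>i. derivation (d i)"
    and "\<And>i. \<exists>x. d i x \<noteq> 0"
    and "\<And>i j x. d i (d j x) = d j (d i x)"
    and "\<And>i. \<exists>C. \<forall>x. av (d i x) \<le> C * av x"
    and "\<And>i. op_norm av UNIV (d i) / spectral_norm av UNIV (d i) = s0"
    and "differential_module smul d D"
  shows "\<exists>!P. scale_decomposition av d smul D s0 (fst P) (snd P)"
proof -
  interpret F: complete_nonarch_field av by fact
  interpret M: differential_module smul d D by fact
  obtain X where X: "finite X" "M.span X = UNIV" using M.finite_dim by blast
  obtain Basis where Basis: "Basis \<subseteq> X" "M.independent Basis" "X \<subseteq> M.span Basis"
    using M.maximal_independent_subset[of X] by blast
  interpret V: finite_dimensional_vector_space smul Basis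
  proof
    show "finite Basis" using Basis(1) X(1) by (rule finite_subset)
    show "M.independent Basis" by (rule Basis(2))
    have "M.span X \<subseteq> M.span Basis" using Basis(3) by (intro M.span_minimal) auto
    then show "M.span Basis = UNIV" using X(2) by auto
  qed
  define r where "r i = op_norm av UNIV (d i)" for i
  define \<mu> where "\<mu> i = spectral_norm av UNIV (d i)" for i
  have bounded_d: "bounded_endo av UNIV (d i) (r i)" for i
  proof -
    obtain C where C: "\<And>x. av (d i x) \<le> C * av x" using assms(5) by blast
    interpret bounded_endo av UNIV "d i" "\<bar>C\<bar>"
    proof
      show "av (d i x) \<le> \<bar>C\<bar> * av x" for x
        using C[of x] mult_right_mono[OF abs_ge_self[of C] F.av_nonneg[of x]] by linarith
    qed (auto simp: F.av_nonneg)
    show ?thesis unfolding r_def using op_norm_nonneg le_op_norm by unfold_locales (auto simp: F.av_nonneg)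
  qed
  have r_pos: "0 < r i" for i
  proof -
    obtain x where "d i x \<noteq> 0" using assms(3) by blast
    then have "0 < av (d i x)" using F.av_nonneg[of "d i x"] F.av_eq_0_iff[of "d i x"] by simp
    also have "\<dots> \<le> r i * av x" using bounded_endo.bounded[OF bounded_d] by simp
    finally show ?thesis using F.av_nonneg[of x] by (simp add: zero_less_mult_iff)
  qed
  have \<mu>_nonneg: "0 \<le> \<mu> i" for i unfolding \<mu>_def by (rule bounded_endo.spectral_norm_nonneg[OF bounded_d])
  have \<mu>_le: "\<mu> i \<le> r i" for i unfolding \<mu>_def
    using bounded_endo.funpow_bounded[OF bounded_d] r_pos[of i]
    by (intro bounded_endo.spectral_norm_le[OF bounded_d, where C = 1]) auto
  have s0: "r i / \<mu> i = s0" for i using assms(6) by (simp add: r_def \<mu>_def)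
  show ?thesis
  \<comment> \<open>All \<open>r i\<close> are positive, so \<open>s0 = 0\<close> can only come from
    division by a vanishing spectral norm, and then all of them vanish.\<close>
  proof (cases "s0 = 0")
    case True
    then have "\<mu> i = 0" for i using s0[of i] r_pos[of i] by auto
    then have "scale_filtration smul Basis av d D s0
        (\<lambda>t. if 1 \<le> t then UNIV else {0}) (\<lambda>t. if 1 \<le> t then {0} else UNIV)"
      unfolding True \<mu>_def by (intro V.scale_filtration_degenerate M.D_add)
    then show ?thesis by (rule scale_filtration.ex1_scale_decomposition)
  next
    case False
    then have \<mu>_pos: "0 < \<mu> i" for i using s0[of i] \<mu>_nonneg[of i] by (cases "\<mu> i = 0") auto
    interpret N: nonarch_vector_space av smul Basis by unfold_locales
    have d_add: "d i (x + y) = d i x + d i y" for i x y using assms(2) by (simp add: derivation_def)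
    have d_le: "av (d i x) \<le> r i * av x" for i x using bounded_endo.bounded[OF bounded_d] by simp
    have "\<forall>i. \<exists>K. \<forall>v. N.nrm (D i v) \<le> K * N.nrm v"
      using N.twisted_additive_bounded[OF d_le _ M.D_add M.D_smul] r_pos by (auto simp: less_imp_le)
    then obtain K where K: "\<And>i v. N.nrm (D i v) \<le> K i * N.nrm v" by metis
    interpret O: twisted_operators av smul Basis d r D K
      using d_add d_le r_pos M.D_add M.D_smul K M.D_commute by unfold_locales (auto simp: less_imp_le)
    \<comment> \<open>A spectral norm is at most the operator norm; \<open>undefined\<close> stands
      for an arbitrary index.\<close>
    have "1 \<le> s0" using s0[of undefined] \<mu>_pos[of undefined] \<mu>_le[of undefined] by auto
    moreover have "r i = s0 * \<mu> i" for i using s0[of i] \<mu>_pos[of i] by auto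
    ultimately show ?thesis
      using \<mu>_pos by (intro scale_filtration.ex1_scale_decomposition[OF O.scale_filtration_slows_fasts[of \<mu>]]) (auto simp: \<mu>_def)
  qed
qed

end
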